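(* Let $F:\mathcal C\to\mathcal M$ be an admissible functor, where $\mathcal C=\mathsf{Alg}_P(\mathcal M)$. Then the collection $\partial^{\mathrm{spec}}F:=\{\partial_n^{\mathrm{spec}}F\}_{n\ge0}$ forms a symmetric sequence in the functor category of multilinear functors from powers of $\mathcal C$ to $\mathcal M$.
   Context: $(\mathcal M,\otimes,\mathbf 1)$ is a normed symmetric monoidal category (Hom-spaces are complex Banach spaces, composition and tensor of morphisms bilinear and submultiplicative in norm); objects carry a norm. $P$ is a colored operad in $\mathcal M$; $\mathcal C$ is pointed (zero object $0$) with finite coproducts $\oplus$, and $\mathcal M$ admits the relevant homotopy limits. Admissible: $\|F(A)\|\le\Phi(\|\sigma_P(A)\|)$ for all $A$, for some nondecreasing $\Phi:[0,\infty)\to[0,\infty)$, where $\sigma_P(A)=\mathrm{Hoch}_{\mathcal M}(A)\otimes_P\mathcal O_P^{\mathrm{res}}$ ($\mathcal O_P^{\mathrm{res}}\cong\coprod_cP(c;c)$) is the operadic spectrum, regarded via analytic realization as a subset of $\mathbb C$, and $\|\sigma_P(A)\|=\sup\{|\lambda|:\lambda\in\sigma_P(A)\}$. Spectral derivatives: for $n\ge1$, $\partial_n^{\mathrm{spec}}F=\mathrm{cr}_nF:\mathcal C^n\to\mathcal M$, where $\mathrm{cr}_nF(A_1,\dots,A_n)$ is the total homotopy fiber of the cube $S\mapsto F(\bigoplus_{i\in S}A_i)$, $S\subseteq\{1,\dots,n\}$ (these cross-effects are taken to be multilinear with respect to the tensor structure); $\partial_0^{\mathrm{spec}}F=F(0)$.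 A symmetric sequence is a collection $\{X_n\}_{n\ge0}$ with $X_n$ equipped with an action of the symmetric group $\Sigma_n$. Here the $\Sigma_n$-action on $\partial_n^{\mathrm{spec}}F$ is by permutation of its inputs: natural isomorphisms $\partial_n^{\mathrm{spec}}F(A_1,\dots,A_n)\cong\partial_n^{\mathrm{spec}}F(A_{\sigma(1)},\dots,A_{\sigma(n)})$, compatible with composition in $\Sigma_n$; $\Sigma_0$ acts trivially. *)

theory Defs
  imports "HOL-Analysis.Analysis" "HOL-Combinatorics.Combinatorics"
begin

section \<open>Categories, functors, natural transformations\<close>

record ('o, 'm) cat =
  Obj :: "'o set"
  Arr :: "'m set"
  Dom :: "'m \<Rightarrow> 'o"
  Cod :: "'m \<Rightarrow> 'o"
  Idn :: "'o \<Rightarrow> 'm"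
  Cmp :: "'m \<Rightarrow> 'm \<Rightarrow> 'm"  (infixl "\<cdot>\<index>" 70)

definition hom :: "('o, 'm, 'z) cat_scheme \<Rightarrow> 'o \<Rightarrow> 'o \<Rightarrow> 'm set" where
  "hom C X Y = {f \<in> Arr C. Dom C f = X \<and> Cod C f = Y}"

locale category =
  fixes C :: "('o, 'm, 'z) cat_scheme" (structure)
  assumes dom_cod: "f \<in> Arr C \<Longrightarrow> Dom C f \<in> Obj C \<and> Cod C f \<in> Obj C"
    and id_hom: "X \<in> Obj C \<Longrightarrow> Idn C X \<in> hom C X X"
    and cmp_hom: "f \<in> hom C X Y \<Longrightarrow> g \<in> hom C Y Z \<Longrightarrow> g \<cdot> f \<in> hom C X Z"
    and id_left: "f \<in> hom C X Y \<Longrightarrow> Idn C Y \<cdot> f = f"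
    and id_right: "f \<in> hom C X Y \<Longrightarrow> f \<cdot> Idn C X = f"
    and cmp_assoc: "f \<in> hom C X Y \<Longrightarrow> g \<in> hom C Y Z \<Longrightarrow> h \<in> hom C Z V \<Longrightarrow>
      h \<cdot> g \<cdot> f = h \<cdot> (g \<cdot> f)"

definition inverse_arrows :: "('o, 'm, 'z) cat_scheme \<Rightarrow> 'm \<Rightarrow> 'm \<Rightarrow> bool" where
  "inverse_arrows C f g \<longleftrightarrow>
     f \<in> hom C (Dom C f) (Cod C f) \<and> g \<in> hom C (Cod C f) (Dom C f) \<and>
     Cmp C g f = Idn C (Dom C f) \<and> Cmp C f g = Idn C (Cod C f)"

definition is_iso :: "('o, 'm, 'z) cat_scheme \<Rightarrow> 'm \<Rightarrow> bool" where
  "is_iso C f \<longleftrightarrow> (\<exists>g. inverse_arrows C f g)"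

definition inv_arr :: "('o, 'm, 'z) cat_scheme \<Rightarrow> 'm \<Rightarrow> 'm" where
  "inv_arr C f = (THE g. inverse_arrows C f g)"

definition isomorphic :: "('o, 'm, 'z) cat_scheme \<Rightarrow> 'o \<Rightarrow> 'o \<Rightarrow> bool" where
  "isomorphic C X Y \<longleftrightarrow> (\<exists>f \<in> hom C X Y. is_iso C f)"

definition zero_object :: "('o, 'm, 'z) cat_scheme \<Rightarrow> 'o \<Rightarrow> bool" where
  "zero_object C Z \<longleftrightarrow> Z \<in> Obj C \<and>
     (\<forall>X \<in> Obj C. (\<exists>!f. f \<in> hom C X Z) \<and> (\<exists>!f. f \<in> hom C Z X))"

definition coproduct ::
  "('o, 'm, 'z) cat_scheme \<Rightarrow> 'i set \<Rightarrow> ('i \<Rightarrow> 'o) \<Rightarrow> ('i \<Rightarrow> 'm) \<Rightarrow> 'o \<Rightarrow> bool" where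
  "coproduct C I X ins T \<longleftrightarrow>
     T \<in> Obj C \<and> (\<forall>i\<in>I. X i \<in> Obj C \<and> ins i \<in> hom C (X i) T) \<and>
     (\<forall>Y \<in> Obj C. \<forall>f. (\<forall>i\<in>I. f i \<in> hom C (X i) Y) \<longrightarrow>
        (\<exists>!h. h \<in> hom C T Y \<and> (\<forall>i\<in>I. Cmp C h (ins i) = f i)))"

text \<open>Functors and transformations are extensional (\<open>undefined\<close> off the source category), so that
  equality of functors and of transformations is the intended one.\<close>

record ('o, 'm, 'p, 'q) functr =
  fob :: "'o \<Rightarrow> 'p"
  far :: "'m \<Rightarrow> 'q"

definition functors ::
  "('o, 'm, 'z) cat_scheme \<Rightarrow> ('p, 'q, 'y) cat_scheme \<Rightarrow> ('o, 'm, 'p, 'q) functr set" where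
  "functors I C = {F.
     fob F \<in> Obj I \<rightarrow>\<^sub>E Obj C \<and> far F \<in> Arr I \<rightarrow>\<^sub>E Arr C \<and>
     (\<forall>f \<in> Arr I. far F f \<in> hom C (fob F (Dom I f)) (fob F (Cod I f))) \<and>
     (\<forall>X \<in> Obj I. far F (Idn I X) = Idn C (fob F X)) \<and>
     (\<forall>X Y Z. \<forall>f \<in> hom I X Y. \<forall>g \<in> hom I Y Z.
        far F (Cmp I g f) = Cmp C (far F g) (far F f))}"

record ('o, 'm, 'p, 'q) ntrans =
  nsrc :: "('o, 'm, 'p, 'q) functr"
  ntgt :: "('o, 'm, 'p, 'q) functr"
  ncmp :: "'o \<Rightarrow> 'q"

definition nat_transformations ::
  "('o, 'm, 'z) cat_scheme \<Rightarrow> ('p, 'q, 'y) cat_scheme \<Rightarrow> ('o, 'm, 'p, 'q) ntrans set" where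
  "nat_transformations I C = {t.
     nsrc t \<in> functors I C \<and> ntgt t \<in> functors I C \<and> ncmp t \<in> extensional (Obj I) \<and>
     (\<forall>X \<in> Obj I. ncmp t X \<in> hom C (fob (nsrc t) X) (fob (ntgt t) X)) \<and>
     (\<forall>f \<in> Arr I. Cmp C (ncmp t (Cod I f)) (far (nsrc t) f) =
                   Cmp C (far (ntgt t) f) (ncmp t (Dom I f)))}"

definition fun_cat ::
  "('o, 'm, 'z) cat_scheme \<Rightarrow> ('p, 'q, 'y) cat_scheme \<Rightarrow>
   (('o, 'm, 'p, 'q) functr, ('o, 'm, 'p, 'q) ntrans) cat" where
  "fun_cat I C = \<lparr> Obj = functors I C, Arr = nat_transformations I C, Dom = nsrc, Cod = ntgt,
     Idn = (\<lambda>F. \<lparr> nsrc = F, ntgt = F, ncmp = (\<lambda>X \<in> Obj I. Idn C (fob F X)) \<rparr>),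
     Cmp = (\<lambda>s t. \<lparr> nsrc = nsrc t, ntgt = ntgt s,
                    ncmp = (\<lambda>X \<in> Obj I. Cmp C (ncmp s X) (ncmp t X)) \<rparr>) \<rparr>"

definition full_subcat :: "('o, 'm) cat \<Rightarrow> 'o set \<Rightarrow> ('o, 'm) cat" where
  "full_subcat C S = C \<lparr> Obj := Obj C \<inter> S, Arr := {f \<in> Arr C. Dom C f \<in> S \<and> Cod C f \<in> S} \<rparr>"

definition pow_cat :: "('o, 'm, 'z) cat_scheme \<Rightarrow> nat \<Rightarrow> (nat \<Rightarrow> 'o, nat \<Rightarrow> 'm) cat" where
  "pow_cat C n = \<lparr> Obj = {1..n} \<rightarrow>\<^sub>E Obj C, Arr = {1..n} \<rightarrow>\<^sub>E Arr C,
     Dom = (\<lambda>f. \<lambda>i \<in> {1..n}. Dom C (f i)), Cod = (\<lambda>f. \<lambda>i \<in> {1..n}. Cod C (f i)),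
     Idn = (\<lambda>X. \<lambda>i \<in> {1..n}. Idn C (X i)),
     Cmp = (\<lambda>g f. \<lambda>i \<in> {1..n}. Cmp C (g i) (f i)) \<rparr>"


section \<open>Normed symmetric monoidal categories\<close>

locale complex_banach_space =
  fixes V :: "'v set" and add :: "'v \<Rightarrow> 'v \<Rightarrow> 'v" and smul :: "complex \<Rightarrow> 'v \<Rightarrow> 'v"
    and zero :: 'v and nrm :: "'v \<Rightarrow> real"
  assumes add_closed: "x \<in> V \<Longrightarrow> y \<in> V \<Longrightarrow> add x y \<in> V"
    and smul_closed: "x \<in> V \<Longrightarrow> smul a x \<in> V"
    and zero_closed: "zero \<in> V"
    and add_assoc: "x \<in> V \<Longrightarrow> y \<in> V \<Longrightarrow> z \<in> V \<Longrightarrow> add (add x y) z = add x (add y z)"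
    and add_commute: "x \<in> V \<Longrightarrow> y \<in> V \<Longrightarrow> add x y = add y x"
    and add_zero: "x \<in> V \<Longrightarrow> add x zero = x"
    and add_inverse: "x \<in> V \<Longrightarrow> add x (smul (-1) x) = zero"
    and smul_add: "x \<in> V \<Longrightarrow> y \<in> V \<Longrightarrow> smul a (add x y) = add (smul a x) (smul a y)"
    and add_smul: "x \<in> V \<Longrightarrow> smul (a + b) x = add (smul a x) (smul b x)"
    and smul_smul: "x \<in> V \<Longrightarrow> smul a (smul b x) = smul (a * b) x"
    and smul_one: "x \<in> V \<Longrightarrow> smul 1 x = x"
    and nrm_nonneg: "x \<in> V \<Longrightarrow> 0 \<le> nrm x"
    and nrm_eq_0: "x \<in> V \<Longrightarrow> nrm x = 0 \<longleftrightarrow> x = zero"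
    and nrm_triangle: "x \<in> V \<Longrightarrow> y \<in> V \<Longrightarrow> nrm (add x y) \<le> nrm x + nrm y"
    and nrm_smul: "x \<in> V \<Longrightarrow> nrm (smul a x) = cmod a * nrm x"
    and complete: "Metric_space.mcomplete V (\<lambda>x y. nrm (add x (smul (-1) y)))"

text \<open>\<open>assc X Y Z : (X \<otimes> Y) \<otimes> Z \<rightarrow> X \<otimes> (Y \<otimes> Z)\<close>, \<open>lun X : 1 \<otimes> X \<rightarrow> X\<close>, \<open>run X : X \<otimes> 1 \<rightarrow> X\<close>,
  \<open>brd X Y : X \<otimes> Y \<rightarrow> Y \<otimes> X\<close>; \<open>\<otimes>\<close> is the tensor on objects and \<open>\<odot>\<close> the tensor on arrows.\<close>

record ('o, 'm) nmcat = "('o, 'm) cat" +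
  hadd :: "'m \<Rightarrow> 'm \<Rightarrow> 'm"
  hscale :: "complex \<Rightarrow> 'm \<Rightarrow> 'm"
  hzero :: "'o \<Rightarrow> 'o \<Rightarrow> 'm"
  hnorm :: "'m \<Rightarrow> real"
  onorm :: "'o \<Rightarrow> real"
  tob :: "'o \<Rightarrow> 'o \<Rightarrow> 'o"  (infixr "\<otimes>\<index>" 75)
  tar :: "'m \<Rightarrow> 'm \<Rightarrow> 'm"  (infixr "\<odot>\<index>" 75)
  tunit :: "'o"
  assc :: "'o \<Rightarrow> 'o \<Rightarrow> 'o \<Rightarrow> 'm"
  lun :: "'o \<Rightarrow> 'm"
  run :: "'o \<Rightarrow> 'm"
  brd :: "'o \<Rightarrow> 'o \<Rightarrow> 'm"

locale normed_sym_mon_cat = category M for M :: "('o, 'm) nmcat" (structure) +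
  assumes hom_banach: "X \<in> Obj M \<Longrightarrow> Y \<in> Obj M \<Longrightarrow>
      complex_banach_space (hom M X Y) (hadd M) (hscale M) (hzero M X Y) (hnorm M)"
    and cmp_add_left: "f \<in> hom M X Y \<Longrightarrow> g \<in> hom M Y Z \<Longrightarrow> g' \<in> hom M Y Z \<Longrightarrow>
      hadd M g g' \<cdot> f = hadd M (g \<cdot> f) (g' \<cdot> f)"
    and cmp_add_right: "f \<in> hom M X Y \<Longrightarrow> f' \<in> hom M X Y \<Longrightarrow> g \<in> hom M Y Z \<Longrightarrow>
      g \<cdot> hadd M f f' = hadd M (g \<cdot> f) (g \<cdot> f')"
    and cmp_scale_left: "f \<in> hom M X Y \<Longrightarrow> g \<in> hom M Y Z \<Longrightarrow>
      hscale M a g \<cdot> f = hscale M a (g \<cdot> f)"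
    and cmp_scale_right: "f \<in> hom M X Y \<Longrightarrow> g \<in> hom M Y Z \<Longrightarrow>
      g \<cdot> hscale M a f = hscale M a (g \<cdot> f)"
    and cmp_norm: "f \<in> hom M X Y \<Longrightarrow> g \<in> hom M Y Z \<Longrightarrow> hnorm M (g \<cdot> f) \<le> hnorm M g * hnorm M f"
    and onorm_nonneg: "X \<in> Obj M \<Longrightarrow> 0 \<le> onorm M X"
    and tob_obj: "X \<in> Obj M \<Longrightarrow> Y \<in> Obj M \<Longrightarrow> X \<otimes> Y \<in> Obj M"
    and tunit_obj: "tunit M \<in> Obj M"
    and tar_hom: "f \<in> hom M X Y \<Longrightarrow> g \<in> hom M X' Y' \<Longrightarrow> f \<odot> g \<in> hom M (X \<otimes> X') (Y \<otimes> Y')"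
    and tar_id: "X \<in> Obj M \<Longrightarrow> Y \<in> Obj M \<Longrightarrow> Idn M X \<odot> Idn M Y = Idn M (X \<otimes> Y)"
    and tar_cmp: "f \<in> hom M X Y \<Longrightarrow> g \<in> hom M Y Z \<Longrightarrow> f' \<in> hom M X' Y' \<Longrightarrow> g' \<in> hom M Y' Z' \<Longrightarrow>
      (g \<cdot> f) \<odot> (g' \<cdot> f') = (g \<odot> g') \<cdot> (f \<odot> f')"
    and tar_add_left: "f \<in> hom M X Y \<Longrightarrow> f' \<in> hom M X Y \<Longrightarrow> g \<in> hom M X' Y' \<Longrightarrow>
      hadd M f f' \<odot> g = hadd M (f \<odot> g) (f' \<odot> g)"
    and tar_add_right: "f \<in> hom M X Y \<Longrightarrow> g \<in> hom M X' Y' \<Longrightarrow> g' \<in> hom M X' Y' \<Longrightarrow>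
      f \<odot> hadd M g g' = hadd M (f \<odot> g) (f \<odot> g')"
    and tar_scale_left: "f \<in> hom M X Y \<Longrightarrow> g \<in> hom M X' Y' \<Longrightarrow>
      hscale M a f \<odot> g = hscale M a (f \<odot> g)"
    and tar_scale_right: "f \<in> hom M X Y \<Longrightarrow> g \<in> hom M X' Y' \<Longrightarrow>
      f \<odot> hscale M a g = hscale M a (f \<odot> g)"
    and tar_norm: "f \<in> hom M X Y \<Longrightarrow> g \<in> hom M X' Y' \<Longrightarrow>
      hnorm M (f \<odot> g) \<le> hnorm M f * hnorm M g"
    and assc_hom: "X \<in> Obj M \<Longrightarrow> Y \<in> Obj M \<Longrightarrow> Z \<in> Obj M \<Longrightarrow>
      assc M X Y Z \<in> hom M ((X \<otimes> Y) \<otimes> Z) (X \<otimes> (Y \<otimes> Z)) \<and> is_iso M (assc M X Y Z)"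
    and lun_hom: "X \<in> Obj M \<Longrightarrow> lun M X \<in> hom M (tunit M \<otimes> X) X \<and> is_iso M (lun M X)"
    and run_hom: "X \<in> Obj M \<Longrightarrow> run M X \<in> hom M (X \<otimes> tunit M) X \<and> is_iso M (run M X)"
    and brd_hom: "X \<in> Obj M \<Longrightarrow> Y \<in> Obj M \<Longrightarrow> brd M X Y \<in> hom M (X \<otimes> Y) (Y \<otimes> X)"
    and assc_nat: "f \<in> hom M X X' \<Longrightarrow> g \<in> hom M Y Y' \<Longrightarrow> h \<in> hom M Z Z' \<Longrightarrow>
      assc M X' Y' Z' \<cdot> ((f \<odot> g) \<odot> h) = (f \<odot> (g \<odot> h)) \<cdot> assc M X Y Z"
    and lun_nat: "f \<in> hom M X X' \<Longrightarrow> lun M X' \<cdot> (Idn M (tunit M) \<odot> f) = f \<cdot> lun M X"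
    and run_nat: "f \<in> hom M X X' \<Longrightarrow> run M X' \<cdot> (f \<odot> Idn M (tunit M)) = f \<cdot> run M X"
    and brd_nat: "f \<in> hom M X X' \<Longrightarrow> g \<in> hom M Y Y' \<Longrightarrow>
      brd M X' Y' \<cdot> (f \<odot> g) = (g \<odot> f) \<cdot> brd M X Y"
    and pentagon: "X \<in> Obj M \<Longrightarrow> Y \<in> Obj M \<Longrightarrow> Z \<in> Obj M \<Longrightarrow> V \<in> Obj M \<Longrightarrow>
      assc M X Y (Z \<otimes> V) \<cdot> assc M (X \<otimes> Y) Z V =
      (Idn M X \<odot> assc M Y Z V) \<cdot> assc M X (Y \<otimes> Z) V \<cdot> (assc M X Y Z \<odot> Idn M V)"
    and triangle: "X \<in> Obj M \<Longrightarrow> Y \<in> Obj M \<Longrightarrow>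
      (Idn M X \<odot> lun M Y) \<cdot> assc M X (tunit M) Y = run M X \<odot> Idn M Y"
    and hexagon: "X \<in> Obj M \<Longrightarrow> Y \<in> Obj M \<Longrightarrow> Z \<in> Obj M \<Longrightarrow>
      assc M Y Z X \<cdot> brd M X (Y \<otimes> Z) \<cdot> assc M X Y Z =
      (Idn M Y \<odot> brd M X Z) \<cdot> assc M Y X Z \<cdot> (brd M X Y \<odot> Idn M Z)"
    and symmetry: "X \<in> Obj M \<Longrightarrow> Y \<in> Obj M \<Longrightarrow> brd M Y X \<cdot> brd M X Y = Idn M (X \<otimes> Y)"

subsection \<open>Iterated tensor products\<close>

primrec tens :: "('o, 'm) nmcat \<Rightarrow> 'o list \<Rightarrow> 'o" where
  "tens M [] = tunit M"
| "tens M (X # Xs) = X \<otimes>\<^bsub>M\<^esub> tens M Xs"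

primrec tens_arr :: "('o, 'm) nmcat \<Rightarrow> 'm list \<Rightarrow> 'm" where
  "tens_arr M [] = Idn M (tunit M)"
| "tens_arr M (f # fs) = f \<odot>\<^bsub>M\<^esub> tens_arr M fs"

text \<open>\<open>X \<otimes> (Y \<otimes> Z) \<rightarrow> Y \<otimes> (X \<otimes> Z)\<close>\<close>
definition swap_front :: "('o, 'm) nmcat \<Rightarrow> 'o \<Rightarrow> 'o \<Rightarrow> 'o \<Rightarrow> 'm" where
  "swap_front M X Y Z =
     assc M Y X Z \<cdot>\<^bsub>M\<^esub> (brd M X Y \<odot>\<^bsub>M\<^esub> Idn M Z) \<cdot>\<^bsub>M\<^esub> inv_arr M (assc M X Y Z)"

text \<open>\<open>(X \<otimes> Y) \<otimes> Z \<rightarrow> (X \<otimes> Z) \<otimes> Y\<close>\<close>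
definition swap_back :: "('o, 'm) nmcat \<Rightarrow> 'o \<Rightarrow> 'o \<Rightarrow> 'o \<Rightarrow> 'm" where
  "swap_back M X Y Z =
     inv_arr M (assc M X Z Y) \<cdot>\<^bsub>M\<^esub> (Idn M X \<odot>\<^bsub>M\<^esub> brd M Y Z) \<cdot>\<^bsub>M\<^esub> assc M X Y Z"

text \<open>\<open>tens (Xs @ Ys) \<rightarrow> tens Xs \<otimes> tens Ys\<close>\<close>
primrec tens_split :: "('o, 'm) nmcat \<Rightarrow> 'o list \<Rightarrow> 'o list \<Rightarrow> 'm" where
  "tens_split M [] Ys = inv_arr M (lun M (tens M Ys))"
| "tens_split M (X # Xs) Ys =
     inv_arr M (assc M X (tens M Xs) (tens M Ys)) \<cdot>\<^bsub>M\<^esub> (Idn M X \<odot>\<^bsub>M\<^esub> tens_split M Xs Ys)"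

text \<open>For \<open>f : Q \<otimes> tens Ys \<rightarrow> Y\<close>, the arrow \<open>Q \<otimes> tens (Xs @ Ys @ Zs) \<rightarrow> tens (Xs @ Y # Zs)\<close> that
  moves \<open>Q\<close> past \<open>Xs\<close> and applies \<open>f\<close>.\<close>
primrec tens_apply ::
  "('o, 'm) nmcat \<Rightarrow> 'o \<Rightarrow> 'm \<Rightarrow> 'o list \<Rightarrow> 'o list \<Rightarrow> 'o list \<Rightarrow> 'm" where
  "tens_apply M Q f [] Ys Zs =
     (f \<odot>\<^bsub>M\<^esub> Idn M (tens M Zs)) \<cdot>\<^bsub>M\<^esub> inv_arr M (assc M Q (tens M Ys) (tens M Zs))
       \<cdot>\<^bsub>M\<^esub> (Idn M Q \<odot>\<^bsub>M\<^esub> tens_split M Ys Zs)"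
| "tens_apply M Q f (X # Xs) Ys Zs =
     (Idn M X \<odot>\<^bsub>M\<^esub> tens_apply M Q f Xs Ys Zs) \<cdot>\<^bsub>M\<^esub> swap_front M Q X (tens M (Xs @ Ys @ Zs))"

text \<open>\<open>tens Xs \<rightarrow> Xs ! k \<otimes> tens (Xs without entry k)\<close>\<close>
fun tens_extract :: "('o, 'm) nmcat \<Rightarrow> nat \<Rightarrow> 'o list \<Rightarrow> 'm" where
  "tens_extract M 0 Xs = Idn M (tens M Xs)"
| "tens_extract M (Suc k) (X # Xs) =
     swap_front M X (Xs ! k) (tens M (take k Xs @ drop (Suc k) Xs))
       \<cdot>\<^bsub>M\<^esub> (Idn M X \<odot>\<^bsub>M\<^esub> tens_extract M k Xs)"
| "tens_extract M (Suc k) [] = Idn M (tunit M)"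

text \<open>The symmetry \<open>tens Xs \<rightarrow> tens (permute_list \<sigma> Xs)\<close> for \<open>\<sigma>\<close> a permutation of \<open>{..<n}\<close>,
  \<open>n = length Xs\<close>: extract entry \<open>\<sigma> 0\<close> and permute the remaining ones.\<close>
primrec tens_perm :: "('o, 'm) nmcat \<Rightarrow> nat \<Rightarrow> (nat \<Rightarrow> nat) \<Rightarrow> 'o list \<Rightarrow> 'm" where
  "tens_perm M 0 \<sigma> Xs = Idn M (tunit M)"
| "tens_perm M (Suc n) \<sigma> Xs =
     (Idn M (Xs ! \<sigma> 0) \<odot>\<^bsub>M\<^esub>
        tens_perm M n (\<lambda>j. if \<sigma> 0 < \<sigma> (Suc j) then \<sigma> (Suc j) - 1 else \<sigma> (Suc j))
          (take (\<sigma> 0) Xs @ drop (Suc (\<sigma> 0)) Xs))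
       \<cdot>\<^bsub>M\<^esub> tens_extract M (\<sigma> 0) Xs"


section \<open>Colored operads, modules and algebras\<close>

text \<open>The set of colors is the type \<open>'c\<close>. Operads are given by units, partial compositions
  \<open>pcomp as bs cs b d : P(as, b, cs; d) \<otimes> P(bs; b) \<rightarrow> P(as, bs, cs; d)\<close>
  and right actions \<open>psym \<sigma> cs d : P(cs; d) \<rightarrow> P(c\<^sub>\<sigma>\<^sub>(\<^sub>0\<^sub>), ..., c\<^sub>\<sigma>\<^sub>(\<^sub>n\<^sub>-\<^sub>1\<^sub>); d)\<close>.\<close>

record ('c, 'o, 'm) opd =
  pob :: "'c list \<Rightarrow> 'c \<Rightarrow> 'o"
  punit :: "'c \<Rightarrow> 'm"
  pcomp :: "'c list \<Rightarrow> 'c list \<Rightarrow> 'c list \<Rightarrow> 'c \<Rightarrow> 'c \<Rightarrow> 'm"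
  psym :: "(nat \<Rightarrow> nat) \<Rightarrow> 'c list \<Rightarrow> 'c \<Rightarrow> 'm"

record ('c, 'o, 'm) rmod =
  rob :: "'c list \<Rightarrow> 'o"
  ract :: "'c list \<Rightarrow> 'c list \<Rightarrow> 'c list \<Rightarrow> 'c \<Rightarrow> 'm"
  rsym :: "(nat \<Rightarrow> nat) \<Rightarrow> 'c list \<Rightarrow> 'm"

definition inner_perm :: "nat \<Rightarrow> nat \<Rightarrow> (nat \<Rightarrow> nat) \<Rightarrow> nat \<Rightarrow> nat" where
  "inner_perm a b \<tau> j = (if a \<le> j \<and> j < a + b then a + \<tau> (j - a) else j)"

text \<open>The block permutation obtained from \<open>\<sigma>\<close> by replacing the input in position \<open>a = \<sigma> a'\<close>
  by \<open>b\<close> inputs kept in order.\<close>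
definition block_perm :: "nat \<Rightarrow> nat \<Rightarrow> nat \<Rightarrow> (nat \<Rightarrow> nat) \<Rightarrow> nat \<Rightarrow> nat" where
  "block_perm a a' b \<sigma> j =
     (let e = (\<lambda>p. if p < a then p else p + b - 1) in
      if j < a' then e (\<sigma> j) else if j < a' + b then a + (j - a') else e (\<sigma> (j + 1 - b)))"

locale right_module =
  fixes M :: "('o, 'm) nmcat" (structure) and P :: "('c, 'o, 'm) opd" and H :: "('c, 'o, 'm) rmod"
  assumes rob_obj: "rob H cs \<in> Obj M"
    and ract_hom: "ract H as bs cs b \<in> hom M (rob H (as @ b # cs) \<otimes> pob P bs b) (rob H (as @ bs @ cs))"
    and rsym_hom: "\<sigma> permutes {..<length cs} \<Longrightarrow>
      rsym H \<sigma> cs \<in> hom M (rob H cs) (rob H (permute_list \<sigma> cs))"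
    and rsym_id: "rsym H id cs = Idn M (rob H cs)"
    and rsym_cmp: "\<sigma> permutes {..<length cs} \<Longrightarrow> \<tau> permutes {..<length cs} \<Longrightarrow>
      rsym H (\<sigma> \<circ> \<tau>) cs = rsym H \<tau> (permute_list \<sigma> cs) \<cdot> rsym H \<sigma> cs"
    and ract_unit: "ract H as [b] cs b \<cdot> (Idn M (rob H (as @ b # cs)) \<odot> punit P b)
      = run M (rob H (as @ b # cs))"
    and ract_sequential:
      "ract H (as @ ds) es (fs @ cs) e
         \<cdot> (ract H as (ds @ e # fs) cs b \<odot> Idn M (pob P es e))
       = ract H as (ds @ es @ fs) cs b
         \<cdot> (Idn M (rob H (as @ b # cs)) \<odot> pcomp P ds es fs e b)
         \<cdot> assc M (rob H (as @ b # cs)) (pob P (ds @ e # fs) b) (pob P es e)"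
    and ract_parallel:
      "ract H (as @ bs @ cs) bs' es b'
         \<cdot> (ract H as bs (cs @ b' # es) b \<odot> Idn M (pob P bs' b'))
       = ract H as bs (cs @ bs' @ es) b
         \<cdot> (ract H (as @ b # cs) bs' es b' \<odot> Idn M (pob P bs b))
         \<cdot> swap_back M (rob H (as @ b # cs @ b' # es)) (pob P bs b) (pob P bs' b')"
    and ract_inner: "\<tau> permutes {..<length bs} \<Longrightarrow>
      ract H as (permute_list \<tau> bs) cs b \<cdot> (Idn M (rob H (as @ b # cs)) \<odot> psym P \<tau> bs b)
       = rsym H (inner_perm (length as) (length bs) \<tau>) (as @ bs @ cs) \<cdot> ract H as bs cs b"
    and ract_outer: "\<sigma> permutes {..<length (as @ b # cs)} \<Longrightarrow>
      permute_list \<sigma> (as @ b # cs) = as' @ b # cs' \<Longrightarrow> \<sigma> (length as') = length as \<Longrightarrow>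
      ract H as' bs cs' b \<cdot> (rsym H \<sigma> (as @ b # cs) \<odot> Idn M (pob P bs b))
       = rsym H (block_perm (length as) (length as') (length bs) \<sigma>) (as @ bs @ cs)
         \<cdot> ract H as bs cs b"

definition regular_module :: "('c, 'o, 'm) opd \<Rightarrow> 'c \<Rightarrow> ('c, 'o, 'm) rmod" where
  "regular_module P d = \<lparr> rob = (\<lambda>cs. pob P cs d), ract = (\<lambda>as bs cs b. pcomp P as bs cs b d),
     rsym = (\<lambda>\<sigma> cs. psym P \<sigma> cs d) \<rparr>"

text \<open>That every \<open>P(-; d)\<close> is a right module over \<open>P\<close> comprises the right unit, both associativity
  and both equivariance axioms of an operad.\<close>
locale colored_operad =
  fixes M :: "('o, 'm) nmcat" (structure) and P :: "('c, 'o, 'm) opd"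
  assumes punit_hom: "punit P c \<in> hom M (tunit M) (pob P [c] c)"
    and regular: "right_module M P (regular_module P d)"
    and unit_left: "pcomp P [] cs [] d d \<cdot> (punit P d \<odot> Idn M (pob P cs d)) = lun M (pob P cs d)"

record ('c, 'o, 'm) alg =
  aob :: "'c \<Rightarrow> 'o"
  aact :: "'c list \<Rightarrow> 'c \<Rightarrow> 'm"

text \<open>Families \<open>t cs : H(cs) \<otimes> A(c\<^sub>1) \<otimes> ... \<otimes> A(c\<^sub>n) \<rightarrow> T\<close> that are equivariant and coequalize
  the actions of \<open>P\<close> on the right module \<open>H\<close> and on \<open>A\<close>.\<close>
definition balanced ::
  "('o, 'm) nmcat \<Rightarrow> ('c, 'o, 'm) opd \<Rightarrow> ('c, 'o, 'm) rmod \<Rightarrow> ('c, 'o, 'm) alg \<Rightarrow> 'o \<Rightarrow>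
   ('c list \<Rightarrow> 'm) \<Rightarrow> bool" where
  "balanced M P H A T t \<longleftrightarrow> T \<in> Obj M \<and>
     (\<forall>cs. t cs \<in> hom M (rob H cs \<otimes>\<^bsub>M\<^esub> tens M (map (aob A) cs)) T) \<and>
     (\<forall>cs \<sigma>. \<sigma> permutes {..<length cs} \<longrightarrow>
        t (permute_list \<sigma> cs)
          \<cdot>\<^bsub>M\<^esub> (rsym H \<sigma> cs \<odot>\<^bsub>M\<^esub> tens_perm M (length cs) \<sigma> (map (aob A) cs)) = t cs) \<and>
     (\<forall>as bs cs b.
        t (as @ bs @ cs)
          \<cdot>\<^bsub>M\<^esub> (ract H as bs cs b \<odot>\<^bsub>M\<^esub> Idn M (tens M (map (aob A) (as @ bs @ cs))))
        = t (as @ b # cs)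
          \<cdot>\<^bsub>M\<^esub> (Idn M (rob H (as @ b # cs)) \<odot>\<^bsub>M\<^esub>
                 tens_apply M (pob P bs b) (aact A bs b)
                   (map (aob A) as) (map (aob A) bs) (map (aob A) cs))
          \<cdot>\<^bsub>M\<^esub> assc M (rob H (as @ b # cs)) (pob P bs b) (tens M (map (aob A) (as @ bs @ cs))))"

text \<open>The structure maps \<open>P(cs; d) \<otimes> A(c\<^sub>1) \<otimes> ... \<otimes> A(c\<^sub>n) \<rightarrow> A(d)\<close> are equivariant and associative
  precisely if they are balanced as a family out of \<open>P(-; d)\<close>.\<close>
definition is_algebra :: "('o, 'm) nmcat \<Rightarrow> ('c, 'o, 'm) opd \<Rightarrow> ('c, 'o, 'm) alg \<Rightarrow> bool" where
  "is_algebra M P A \<longleftrightarrow>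
     (\<forall>c. aob A c \<in> Obj M) \<and>
     (\<forall>d. balanced M P (regular_module P d) A (aob A d) (\<lambda>cs. aact A cs d)) \<and>
     (\<forall>c. aact A [c] c \<cdot>\<^bsub>M\<^esub> (punit P c \<odot>\<^bsub>M\<^esub> Idn M (tens M [aob A c]))
           = run M (aob A c) \<cdot>\<^bsub>M\<^esub> lun M (tens M [aob A c]))"

record ('c, 'o, 'm) alghom =
  asrc :: "('c, 'o, 'm) alg"
  atgt :: "('c, 'o, 'm) alg"
  acmp :: "'c \<Rightarrow> 'm"

definition is_alghom :: "('o, 'm) nmcat \<Rightarrow> ('c, 'o, 'm) opd \<Rightarrow> ('c, 'o, 'm) alghom \<Rightarrow> bool" where
  "is_alghom M P f \<longleftrightarrow>
     is_algebra M P (asrc f) \<and> is_algebra M P (atgt f) \<and>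
     (\<forall>c. acmp f c \<in> hom M (aob (asrc f) c) (aob (atgt f) c)) \<and>
     (\<forall>cs d. acmp f d \<cdot>\<^bsub>M\<^esub> aact (asrc f) cs d =
        aact (atgt f) cs d \<cdot>\<^bsub>M\<^esub> (Idn M (pob P cs d) \<odot>\<^bsub>M\<^esub> tens_arr M (map (acmp f) cs)))"

definition alg_cat ::
  "('o, 'm) nmcat \<Rightarrow> ('c, 'o, 'm) opd \<Rightarrow> (('c, 'o, 'm) alg, ('c, 'o, 'm) alghom) cat" where
  "alg_cat M P = \<lparr> Obj = {A. is_algebra M P A}, Arr = {f. is_alghom M P f}, Dom = asrc, Cod = atgt,
     Idn = (\<lambda>A. \<lparr> asrc = A, atgt = A, acmp = (\<lambda>c. Idn M (aob A c)) \<rparr>),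
     Cmp = (\<lambda>g f. \<lparr> asrc = asrc f, atgt = atgt g, acmp = (\<lambda>c. acmp g c \<cdot>\<^bsub>M\<^esub> acmp f c) \<rparr>) \<rparr>"

text \<open>\<open>T\<close> with \<open>t\<close> is the relative tensor product of the right module \<open>H\<close> and the left module \<open>A\<close>
  over \<open>P\<close>, that is, the coequalizer of the two actions of \<open>P\<close>.\<close>
definition relative_tensor ::
  "('o, 'm) nmcat \<Rightarrow> ('c, 'o, 'm) opd \<Rightarrow> ('c, 'o, 'm) rmod \<Rightarrow> ('c, 'o, 'm) alg \<Rightarrow> 'o \<Rightarrow>
   ('c list \<Rightarrow> 'm) \<Rightarrow> bool" where
  "relative_tensor M P H A T t \<longleftrightarrow> balanced M P H A T t \<and>
     (\<forall>Z s. balanced M P H A Z s \<longrightarrow> (\<exists>!h. h \<in> hom M T Z \<and> (\<forall>cs. h \<cdot>\<^bsub>M\<^esub> t cs = s cs)))"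


section \<open>Operadic spectrum and admissible functors\<close>

text \<open>\<open>Hoch A\<close> is the Hochschild object with its right \<open>P\<close>-action, \<open>Ores\<close> the residual left
  \<open>P\<close>-module, \<open>sig A\<close> the operadic spectrum \<open>Hoch A \<otimes>\<^sub>P Ores\<close>, and \<open>realize\<close> the analytic
  realization of objects as (bounded) sets of complex numbers.\<close>
locale spectral_data =
  fixes M :: "('o, 'm) nmcat" and P :: "('c, 'o, 'm) opd"
    and Hoch :: "('c, 'o, 'm) alg \<Rightarrow> ('c, 'o, 'm) rmod"
    and Ores :: "('c, 'o, 'm) alg"
    and sig :: "('c, 'o, 'm) alg \<Rightarrow> 'o"
    and realize :: "'o \<Rightarrow> complex set"
  assumes Hoch_module: "is_algebra M P A \<Longrightarrow> right_module M P (Hoch A)"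
    and Ores_module: "is_algebra M P Ores"
    and Ores_total: "\<exists>T ins ins'. coproduct M UNIV (aob Ores) ins T \<and>
                       coproduct M UNIV (\<lambda>c. pob P [c] c) ins' T"
    and sig_tensor: "is_algebra M P A \<Longrightarrow> \<exists>t. relative_tensor M P (Hoch A) Ores (sig A) t"
    and realize_bounded: "X \<in> Obj M \<Longrightarrow> bounded (realize X)"
    and realize_iso: "isomorphic M X Y \<Longrightarrow> realize X = realize Y"

definition spectral_norm :: "complex set \<Rightarrow> real" where
  "spectral_norm S = (if S = {} then 0 else (SUP z\<in>S. cmod z))"

definition admissible ::
  "('o, 'm) nmcat \<Rightarrow> ('c, 'o, 'm) opd \<Rightarrow> (('c, 'o, 'm) alg \<Rightarrow> 'o) \<Rightarrow> ('o \<Rightarrow> complex set) \<Rightarrow>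
   (('c, 'o, 'm) alg, ('c, 'o, 'm) alghom, 'o, 'm) functr \<Rightarrow> bool" where
  "admissible M P sig realize F \<longleftrightarrow> F \<in> functors (alg_cat M P) M \<and>
     (\<exists>\<Phi> :: real \<Rightarrow> real. mono_on {0..} \<Phi> \<and> (\<forall>x\<ge>0. 0 \<le> \<Phi> x) \<and>
        (\<forall>A \<in> Obj (alg_cat M P). onorm M (fob F A) \<le> \<Phi> (spectral_norm (realize (sig A)))))"


section \<open>Localization and homotopy limits\<close>

locale weak_equivalences = category C for C :: "('o, 'm, 'z) cat_scheme" (structure) +
  fixes W :: "'m set"
  assumes W_arr: "W \<subseteq> Arr C"
    and iso_W: "is_iso C f \<Longrightarrow> f \<in> W"
    and two_of_three: "f \<in> hom C X Y \<Longrightarrow> g \<in> hom C Y Z \<Longrightarrow>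
      (f \<in> W \<and> g \<in> W \<longrightarrow> g \<cdot> f \<in> W) \<and> (f \<in> W \<and> g \<cdot> f \<in> W \<longrightarrow> g \<in> W) \<and>
      (g \<in> W \<and> g \<cdot> f \<in> W \<longrightarrow> f \<in> W)"

text \<open>The localization \<open>C[W\<inverse>]\<close>: its arrows are zigzags modulo the congruence generated by the
  relations of \<open>C\<close> and by making \<open>Bwd w\<close> inverse to \<open>Fwd w\<close>.\<close>

datatype 'm zstep = Fwd 'm | Bwd 'm

inductive zpath :: "('o, 'm, 'z) cat_scheme \<Rightarrow> 'm set \<Rightarrow> 'o \<Rightarrow> 'm zstep list \<Rightarrow> 'o \<Rightarrow> bool"
  for C :: "('o, 'm, 'z) cat_scheme" and W :: "'m set" where
  zpath_nil: "X \<in> Obj C \<Longrightarrow> zpath C W X [] X"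
| zpath_fwd: "f \<in> hom C X Y \<Longrightarrow> zpath C W Y p Z \<Longrightarrow> zpath C W X (Fwd f # p) Z"
| zpath_bwd: "w \<in> W \<Longrightarrow> w \<in> hom C Y X \<Longrightarrow> zpath C W Y p Z \<Longrightarrow> zpath C W X (Bwd w # p) Z"

inductive zeq :: "('o, 'm, 'z) cat_scheme \<Rightarrow> 'm set \<Rightarrow> 'o \<Rightarrow> 'o \<Rightarrow> 'm zstep list \<Rightarrow> 'm zstep list \<Rightarrow> bool"
  for C :: "('o, 'm, 'z) cat_scheme" and W :: "'m set" where
  zeq_refl: "zpath C W X p Y \<Longrightarrow> zeq C W X Y p p"
| zeq_sym: "zeq C W X Y p q \<Longrightarrow> zeq C W X Y q p"
| zeq_trans: "zeq C W X Y p q \<Longrightarrow> zeq C W X Y q r \<Longrightarrow> zeq C W X Y p r"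
| zeq_append: "zeq C W X Y p p' \<Longrightarrow> zeq C W Y Z q q' \<Longrightarrow> zeq C W X Z (p @ q) (p' @ q')"
| zeq_id: "X \<in> Obj C \<Longrightarrow> zeq C W X X [Fwd (Idn C X)] []"
| zeq_cmp: "f \<in> hom C X Y \<Longrightarrow> g \<in> hom C Y Z \<Longrightarrow> zeq C W X Z [Fwd f, Fwd g] [Fwd (Cmp C g f)]"
| zeq_fb: "w \<in> W \<Longrightarrow> w \<in> hom C X Y \<Longrightarrow> zeq C W X X [Fwd w, Bwd w] []"
| zeq_bf: "w \<in> W \<Longrightarrow> w \<in> hom C X Y \<Longrightarrow> zeq C W Y Y [Bwd w, Fwd w] []"

definition loc_cat ::
  "('o, 'm, 'z) cat_scheme \<Rightarrow> 'm set \<Rightarrow> ('o, 'o \<times> 'm zstep list set \<times> 'o) cat" where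
  "loc_cat C W = \<lparr> Obj = Obj C,
     Arr = {(X, {q. zeq C W X Y p q}, Y) | X Y p. zpath C W X p Y},
     Dom = fst, Cod = (\<lambda>f. snd (snd f)),
     Idn = (\<lambda>X. (X, {q. zeq C W X X [] q}, X)),
     Cmp = (\<lambda>(Y, Q, Z) (X, P, Y'). (X, {r. \<exists>p\<in>P. \<exists>q\<in>Q. zeq C W X Z (p @ q) r}, Z)) \<rparr>"

definition loc_arr ::
  "('o, 'm, 'z) cat_scheme \<Rightarrow> 'm set \<Rightarrow> 'm \<Rightarrow> 'o \<times> 'm zstep list set \<times> 'o" where
  "loc_arr C W f = (Dom C f, {q. zeq C W (Dom C f) (Cod C f) [Fwd f] q}, Cod C f)"

text \<open>The action on localizations of a functor \<open>G\<close> into \<open>C\<close> that preserves weak equivalences.\<close>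
definition loc_map ::
  "('o, 'm, 'z) cat_scheme \<Rightarrow> 'm set \<Rightarrow> ('p, 'q, 'o, 'm) functr \<Rightarrow>
   'p \<times> 'q zstep list set \<times> 'p \<Rightarrow> 'o \<times> 'm zstep list set \<times> 'o" where
  "loc_map C W G = (\<lambda>(X, P, Y). (fob G X,
     {q. \<exists>p\<in>P. zeq C W (fob G X) (fob G Y) (map (map_zstep (far G)) p) q}, fob G Y))"

text \<open>A finite poset is represented as a finite set of finite sets of naturals under reverse
  inclusion (every finite poset is of this form): there is one arrow \<open>S \<rightarrow> T\<close> if \<open>T \<subseteq> S\<close>.\<close>

definition index_poset :: "nat set set \<Rightarrow> bool" where
  "index_poset J \<longleftrightarrow> finite J \<and> (\<forall>S\<in>J. finite S)"

definition poset_cat :: "nat set set \<Rightarrow> (nat set, nat set \<times> nat set) cat" where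
  "poset_cat J = \<lparr> Obj = J, Arr = {(S, T). S \<in> J \<and> T \<in> J \<and> T \<subseteq> S}, Dom = fst, Cod = snd,
     Idn = (\<lambda>S. (S, S)), Cmp = (\<lambda>g f. (fst f, snd g)) \<rparr>"

type_synonym ('p, 'q) diagram = "(nat set, nat set \<times> nat set, 'p, 'q) functr"
type_synonym ('p, 'q) diagram_map = "(nat set, nat set \<times> nat set, 'p, 'q) ntrans"

abbreviation diagrams ::
  "('p, 'q, 'y) cat_scheme \<Rightarrow> nat set set \<Rightarrow> (('p, 'q) diagram, ('p, 'q) diagram_map) cat" where
  "diagrams C J \<equiv> fun_cat (poset_cat J) C"

definition pointwise :: "('p, 'q, 'y) cat_scheme \<Rightarrow> 'q set \<Rightarrow> nat set set \<Rightarrow> ('p, 'q) diagram_map set" where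
  "pointwise C W J = {t \<in> Arr (diagrams C J). \<forall>S\<in>J. ncmp t S \<in> W}"

definition const_diagram :: "('p, 'q, 'y) cat_scheme \<Rightarrow> nat set set \<Rightarrow> 'p \<Rightarrow> ('p, 'q) diagram" where
  "const_diagram C J X = \<lparr> fob = (\<lambda>S\<in>J. X), far = (\<lambda>a \<in> Arr (poset_cat J). Idn C X) \<rparr>"

definition const_map :: "('p, 'q, 'y) cat_scheme \<Rightarrow> nat set set \<Rightarrow> 'q \<Rightarrow> ('p, 'q) diagram_map" where
  "const_map C J f = \<lparr> nsrc = const_diagram C J (Dom C f), ntgt = const_diagram C J (Cod C f),
     ncmp = (\<lambda>S\<in>J. f) \<rparr>"

definition monotone_map :: "nat set set \<Rightarrow> nat set set \<Rightarrow> (nat set \<Rightarrow> nat set) \<Rightarrow> bool" where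
  "monotone_map J' J u \<longleftrightarrow> u ` J' \<subseteq> J \<and> (\<forall>S\<in>J'. \<forall>T\<in>J'. T \<subseteq> S \<longrightarrow> u T \<subseteq> u S)"

definition reindex :: "nat set set \<Rightarrow> (nat set \<Rightarrow> nat set) \<Rightarrow> ('p, 'q) diagram \<Rightarrow> ('p, 'q) diagram" where
  "reindex J' u D = \<lparr> fob = (\<lambda>S\<in>J'. fob D (u S)),
     far = (\<lambda>a \<in> Arr (poset_cat J'). far D (u (fst a), u (snd a))) \<rparr>"

definition reindex_map ::
  "nat set set \<Rightarrow> (nat set \<Rightarrow> nat set) \<Rightarrow> ('p, 'q) diagram_map \<Rightarrow> ('p, 'q) diagram_map" where
  "reindex_map J' u t = \<lparr> nsrc = reindex J' u (nsrc t), ntgt = reindex J' u (ntgt t),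
     ncmp = (\<lambda>S\<in>J'. ncmp t (u S)) \<rparr>"

text \<open>\<open>hlim J\<close> is the homotopy limit functor on \<open>J\<close>-shaped diagrams,
  \<open>hunit J X : X \<rightarrow> holim\<^sub>J (const X)\<close> the canonical map, and
  \<open>hres J J' u D : holim\<^sub>J D \<rightarrow> holim\<^sub>J\<^sub>' (D \<circ> u)\<close> restriction along \<open>u : J' \<rightarrow> J\<close>.\<close>
record ('o, 'm) holims =
  hlim :: "nat set set \<Rightarrow> (('o, 'm) diagram, ('o, 'm) diagram_map, 'o, 'm) functr"
  hunit :: "nat set set \<Rightarrow> 'o \<Rightarrow> 'm"
  hres :: "nat set set \<Rightarrow> nat set set \<Rightarrow> (nat set \<Rightarrow> nat set) \<Rightarrow> ('o, 'm) diagram \<Rightarrow> 'm"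

text \<open>A model of homotopy limits over finite posets. The characterizing property is
  \<open>hlim_adjoint\<close>: on homotopy categories \<open>hlim J\<close> is right adjoint to the constant diagram functor,
  with unit \<open>hunit J\<close>. The remaining axioms are the functoriality of the model in the diagram and,
  as for the Bousfield-Kan formula, strictly in the indexing category.\<close>
locale homotopy_limits = weak_equivalences M W
  for M :: "('o, 'm, 'z) cat_scheme" (structure) and W :: "'m set" +
  fixes L :: "('o, 'm) holims"
  assumes hlim_functor: "index_poset J \<Longrightarrow> hlim L J \<in> functors (diagrams M J) M"
    and hlim_weq: "index_poset J \<Longrightarrow> t \<in> pointwise M W J \<Longrightarrow> far (hlim L J) t \<in> W"
    and hunit_hom: "index_poset J \<Longrightarrow> X \<in> Obj M \<Longrightarrow>
      hunit L J X \<in> hom M X (fob (hlim L J) (const_diagram M J X))"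
    and hunit_nat: "index_poset J \<Longrightarrow> f \<in> hom M X Y \<Longrightarrow>
      far (hlim L J) (const_map M J f) \<cdot> hunit L J X = hunit L J Y \<cdot> f"
    and hlim_adjoint: "index_poset J \<Longrightarrow> X \<in> Obj M \<Longrightarrow> D \<in> Obj (diagrams M J) \<Longrightarrow>
      bij_betw (\<lambda>a. loc_map M W (hlim L J) a \<cdot>\<^bsub>loc_cat M W\<^esub> loc_arr M W (hunit L J X))
        (hom (loc_cat (diagrams M J) (pointwise M W J)) (const_diagram M J X) D)
        (hom (loc_cat M W) X (fob (hlim L J) D))"
    and hres_hom: "index_poset J \<Longrightarrow> index_poset J' \<Longrightarrow> monotone_map J' J u \<Longrightarrow>
      D \<in> Obj (diagrams M J) \<Longrightarrow>
      hres L J J' u D \<in> hom M (fob (hlim L J) D) (fob (hlim L J') (reindex J' u D))"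
    and hres_nat: "index_poset J \<Longrightarrow> index_poset J' \<Longrightarrow> monotone_map J' J u \<Longrightarrow>
      t \<in> hom (diagrams M J) D E \<Longrightarrow>
      hres L J J' u E \<cdot> far (hlim L J) t = far (hlim L J') (reindex_map J' u t) \<cdot> hres L J J' u D"
    and hres_id: "index_poset J \<Longrightarrow> (\<And>S. S \<in> J \<Longrightarrow> u S = S) \<Longrightarrow> D \<in> Obj (diagrams M J) \<Longrightarrow>
      hres L J J u D = Idn M (fob (hlim L J) D)"
    and hres_cmp: "index_poset J \<Longrightarrow> index_poset J' \<Longrightarrow> index_poset J'' \<Longrightarrow>
      monotone_map J' J u \<Longrightarrow> monotone_map J'' J' v \<Longrightarrow> (\<And>S. S \<in> J'' \<Longrightarrow> w S = u (v S)) \<Longrightarrow>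
      D \<in> Obj (diagrams M J) \<Longrightarrow>
      hres L J J'' w D = hres L J' J'' v (reindex J' u D) \<cdot> hres L J J' u D"
    and hres_hunit: "index_poset J \<Longrightarrow> index_poset J' \<Longrightarrow> monotone_map J' J u \<Longrightarrow> X \<in> Obj M \<Longrightarrow>
      hres L J J' u (const_diagram M J X) \<cdot> hunit L J X = hunit L J' X"


section \<open>Total homotopy fibers\<close>

text \<open>The cospan shape \<open>{1} \<rightarrow> {} \<leftarrow> {2}\<close>.\<close>
definition cospan :: "nat set set" where
  "cospan = {{}, {1}, {2}}"

definition fiber_diagram :: "('o, 'm) nmcat \<Rightarrow> 'o \<Rightarrow> 'm \<Rightarrow> ('o, 'm) diagram" where
  "fiber_diagram M z f = \<lparr>
     fob = (\<lambda>S \<in> cospan. if S = {1} then Dom M f else if S = {} then Cod M f else z),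
     far = (\<lambda>a \<in> Arr (poset_cat cospan).
        if a = ({1}, {}) then f else if a = ({2}, {}) then hzero M z (Cod M f)
        else if a = ({1}, {1}) then Idn M (Dom M f) else if a = ({}, {}) then Idn M (Cod M f)
        else Idn M z) \<rparr>"

text \<open>The homotopy fiber of \<open>f : X \<rightarrow> Y\<close>, that is, the homotopy limit of \<open>X \<rightarrow> Y \<leftarrow> 0\<close>, and the map
  of homotopy fibers induced by a commutative square \<open>b \<cdot> f = g \<cdot> a\<close>.\<close>
definition hofiber :: "('o, 'm) nmcat \<Rightarrow> 'o \<Rightarrow> ('o, 'm) holims \<Rightarrow> 'm \<Rightarrow> 'o" where
  "hofiber M z L f = fob (hlim L cospan) (fiber_diagram M z f)"

definition hofiber_map ::
  "('o, 'm) nmcat \<Rightarrow> 'o \<Rightarrow> ('o, 'm) holims \<Rightarrow> 'm \<Rightarrow> 'm \<Rightarrow> 'm \<Rightarrow> 'm \<Rightarrow> 'm" where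
  "hofiber_map M z L f g a b = far (hlim L cospan)
     \<lparr> nsrc = fiber_diagram M z f, ntgt = fiber_diagram M z g,
       ncmp = (\<lambda>S \<in> cospan. if S = {1} then a else if S = {} then b else Idn M z) \<rparr>"

definition cube :: "nat \<Rightarrow> nat set set" where
  "cube n = Pow {1..n}"

definition punctured_cube :: "nat \<Rightarrow> nat set set" where
  "punctured_cube n = Pow {1..n} - {{1..n}}"

text \<open>The canonical map from the initial vertex of an \<open>n\<close>-cube to the homotopy limit of the
  punctured cube; its homotopy fiber is the total homotopy fiber.\<close>
definition punctured_map :: "('o, 'm) nmcat \<Rightarrow> ('o, 'm) holims \<Rightarrow> nat \<Rightarrow> ('o, 'm) diagram \<Rightarrow> 'm" where
  "punctured_map M L n D =
     far (hlim L (punctured_cube n))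
       \<lparr> nsrc = const_diagram M (punctured_cube n) (fob D {1..n}),
         ntgt = reindex (punctured_cube n) id D,
         ncmp = (\<lambda>S \<in> punctured_cube n. far D ({1..n}, S)) \<rparr>
     \<cdot>\<^bsub>M\<^esub> hunit L (punctured_cube n) (fob D {1..n})"

definition total_hofiber :: "('o, 'm) nmcat \<Rightarrow> 'o \<Rightarrow> ('o, 'm) holims \<Rightarrow> nat \<Rightarrow> ('o, 'm) diagram \<Rightarrow> 'o" where
  "total_hofiber M z L n D = hofiber M z L (punctured_map M L n D)"

definition total_hofiber_map ::
  "('o, 'm) nmcat \<Rightarrow> 'o \<Rightarrow> ('o, 'm) holims \<Rightarrow> nat \<Rightarrow> ('o, 'm) diagram_map \<Rightarrow> 'm" where
  "total_hofiber_map M z L n t =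
     hofiber_map M z L (punctured_map M L n (nsrc t)) (punctured_map M L n (ntgt t))
       (ncmp t {1..n}) (far (hlim L (punctured_cube n)) (reindex_map (punctured_cube n) id t))"

text \<open>For an automorphism \<open>u\<close> of the poset \<open>cube n\<close> with inverse \<open>v\<close>, the canonical map
  from the total homotopy fiber of \<open>D \<circ> u\<close> to that of \<open>D\<close>.\<close>
definition total_hofiber_relabel ::
  "('o, 'm) nmcat \<Rightarrow> 'o \<Rightarrow> ('o, 'm) holims \<Rightarrow> nat \<Rightarrow>
   (nat set \<Rightarrow> nat set) \<Rightarrow> (nat set \<Rightarrow> nat set) \<Rightarrow> ('o, 'm) diagram \<Rightarrow> 'm" where
  "total_hofiber_relabel M z L n u v D =
     hofiber_map M z L (punctured_map M L n (reindex (cube n) u D)) (punctured_map M L n D)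
       (Idn M (fob D {1..n}))
       (hres L (punctured_cube n) (punctured_cube n) v (reindex (punctured_cube n) u D))"


section \<open>Cross-effects and spectral derivatives\<close>

text \<open>\<open>zob\<close> is the zero object and \<open>cop S A\<close>, for finite \<open>S\<close>, the chosen coproduct of
  \<open>(A i)\<^sub>i\<^sub>\<in>\<^sub>S\<close> with injections \<open>cinj S A i\<close>.\<close>
record ('o, 'm) coprods =
  zob :: 'o
  cop :: "nat set \<Rightarrow> (nat \<Rightarrow> 'o) \<Rightarrow> 'o"
  cinj :: "nat set \<Rightarrow> (nat \<Rightarrow> 'o) \<Rightarrow> nat \<Rightarrow> 'm"

definition pointed_with_coproducts :: "('o, 'm, 'z) cat_scheme \<Rightarrow> ('o, 'm) coprods \<Rightarrow> bool" where
  "pointed_with_coproducts C K \<longleftrightarrow> zero_object C (zob K) \<and>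
     (\<forall>S A. finite S \<longrightarrow> (\<forall>i\<in>S. A i \<in> Obj C) \<longrightarrow> coproduct C S A (cinj K S A) (cop K S A))"

definition zero_arr :: "('o, 'm, 'z) cat_scheme \<Rightarrow> ('o, 'm) coprods \<Rightarrow> 'o \<Rightarrow> 'o \<Rightarrow> 'm" where
  "zero_arr C K X Y = Cmp C (THE f. f \<in> hom C (zob K) Y) (THE f. f \<in> hom C X (zob K))"

definition copair ::
  "('o, 'm, 'z) cat_scheme \<Rightarrow> ('o, 'm) coprods \<Rightarrow> nat set \<Rightarrow> (nat \<Rightarrow> 'o) \<Rightarrow> 'o \<Rightarrow> (nat \<Rightarrow> 'm) \<Rightarrow> 'm" where
  "copair C K S A Y f =
     (THE h. h \<in> hom C (cop K S A) Y \<and> (\<forall>i\<in>S. Cmp C h (cinj K S A i) = f i))"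

text \<open>The map \<open>\<Oplus>\<^sub>i\<^sub>\<in>\<^sub>S A i \<rightarrow> \<Oplus>\<^sub>i\<^sub>\<in>\<^sub>T A i\<close>, \<open>T \<subseteq> S\<close>, that collapses the summands outside \<open>T\<close> to zero.\<close>
definition collapse ::
  "('o, 'm, 'z) cat_scheme \<Rightarrow> ('o, 'm) coprods \<Rightarrow> (nat \<Rightarrow> 'o) \<Rightarrow> nat set \<Rightarrow> nat set \<Rightarrow> 'm" where
  "collapse C K A S T = copair C K S A (cop K T A)
     (\<lambda>i. if i \<in> T then cinj K T A i else zero_arr C K (A i) (cop K T A))"

definition cop_map ::
  "('o, 'm, 'z) cat_scheme \<Rightarrow> ('o, 'm) coprods \<Rightarrow> nat set \<Rightarrow> (nat \<Rightarrow> 'o) \<Rightarrow> (nat \<Rightarrow> 'o) \<Rightarrow> (nat \<Rightarrow> 'm) \<Rightarrow> 'm" where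
  "cop_map C K S A B f = copair C K S A (cop K S B) (\<lambda>i. Cmp C (cinj K S B i) (f i))"

text \<open>The \<open>n\<close>-cube \<open>S \<mapsto> F (\<Oplus>\<^sub>i\<^sub>\<in>\<^sub>S A i)\<close>.\<close>
definition cross_cube ::
  "('o, 'm, 'z) cat_scheme \<Rightarrow> ('o, 'm) coprods \<Rightarrow> ('o, 'm, 'p, 'q) functr \<Rightarrow> nat \<Rightarrow> (nat \<Rightarrow> 'o) \<Rightarrow>
   ('p, 'q) diagram" where
  "cross_cube C K F n A = \<lparr> fob = (\<lambda>S \<in> cube n. fob F (cop K S A)),
     far = (\<lambda>a \<in> Arr (poset_cat (cube n)). far F (collapse C K A (fst a) (snd a))) \<rparr>"

definition cross_cube_map ::
  "('o, 'm, 'z) cat_scheme \<Rightarrow> ('o, 'm) coprods \<Rightarrow> ('o, 'm, 'p, 'q) functr \<Rightarrow> nat \<Rightarrow> (nat \<Rightarrow> 'm) \<Rightarrow>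
   ('p, 'q) diagram_map" where
  "cross_cube_map C K F n f =
     (let A = Dom (pow_cat C n) f; B = Cod (pow_cat C n) f in
      \<lparr> nsrc = cross_cube C K F n A, ntgt = cross_cube C K F n B,
        ncmp = (\<lambda>S \<in> cube n. far F (cop_map C K S A B f)) \<rparr>)"

definition cross_effect ::
  "('a, 'b, 'z) cat_scheme \<Rightarrow> ('a, 'b) coprods \<Rightarrow> ('o, 'm) nmcat \<Rightarrow> 'o \<Rightarrow> ('o, 'm) holims \<Rightarrow>
   ('a, 'b, 'o, 'm) functr \<Rightarrow> nat \<Rightarrow> (nat \<Rightarrow> 'a, nat \<Rightarrow> 'b, 'o, 'm) functr" where
  "cross_effect C K M z L F n = \<lparr>
     fob = (\<lambda>A \<in> Obj (pow_cat C n). total_hofiber M z L n (cross_cube C K F n A)),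
     far = (\<lambda>f \<in> Arr (pow_cat C n). total_hofiber_map M z L n (cross_cube_map C K F n f)) \<rparr>"

definition spectral_derivative ::
  "('a, 'b, 'z) cat_scheme \<Rightarrow> ('a, 'b) coprods \<Rightarrow> ('o, 'm) nmcat \<Rightarrow> 'o \<Rightarrow> ('o, 'm) holims \<Rightarrow>
   ('a, 'b, 'o, 'm) functr \<Rightarrow> nat \<Rightarrow> (nat \<Rightarrow> 'a, nat \<Rightarrow> 'b, 'o, 'm) functr" where
  "spectral_derivative C K M z L F n =
     (if n = 0 then \<lparr> fob = (\<lambda>A \<in> Obj (pow_cat C 0). fob F (zob K)),
                      far = (\<lambda>f \<in> Arr (pow_cat C 0). Idn M (fob F (zob K))) \<rparr>
      else cross_effect C K M z L F n)"


section \<open>Multilinear functors and symmetric sequences\<close>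

definition slot :: "('a, 'b, 'z) cat_scheme \<Rightarrow> nat \<Rightarrow> (nat \<Rightarrow> 'a) \<Rightarrow> nat \<Rightarrow> 'b \<Rightarrow> nat \<Rightarrow> 'b" where
  "slot C n A i f = (\<lambda>k \<in> {1..n}. Idn C (A k))(i := f)"

text \<open>In each variable separately, \<open>G\<close> takes finite (including empty) coproducts to coproducts in
  the homotopy-invariant sense, that is, in the homotopy category of \<open>M\<close>, and this is compatible with
  the tensor structure, that is, it holds for every \<open>V \<otimes> G(A\<^sub>1, ..., -, ..., A\<^sub>n)\<close>.\<close>
definition separately_linear ::
  "('a, 'b, 'z) cat_scheme \<Rightarrow> ('o, 'm) nmcat \<Rightarrow> 'm set \<Rightarrow> nat \<Rightarrow>
   (nat \<Rightarrow> 'a, nat \<Rightarrow> 'b, 'o, 'm) functr \<Rightarrow> bool" where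
  "separately_linear C M W n G \<longleftrightarrow>
     (\<forall>i\<in>{1..n}. \<forall>V \<in> Obj M. \<forall>A \<in> Obj (pow_cat C n). \<forall>I :: nat set. \<forall>B ins T.
       finite I \<and> coproduct C I B ins T \<longrightarrow>
       coproduct (loc_cat M W) I (\<lambda>j. V \<otimes>\<^bsub>M\<^esub> fob G (A(i := B j)))
         (\<lambda>j. loc_arr M W (Idn M V \<odot>\<^bsub>M\<^esub> far G (slot C n A i (ins j))))
         (V \<otimes>\<^bsub>M\<^esub> fob G (A(i := T))))"

definition multilinear_functors ::
  "('a, 'b, 'z) cat_scheme \<Rightarrow> ('o, 'm) nmcat \<Rightarrow> 'm set \<Rightarrow> nat \<Rightarrow>
   (nat \<Rightarrow> 'a, nat \<Rightarrow> 'b, 'o, 'm) functr set" where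
  "multilinear_functors C M W n =
     {G \<in> functors (pow_cat C n) M. separately_linear C M W n G}"

definition multilinear_cat ::
  "('a, 'b, 'z) cat_scheme \<Rightarrow> ('o, 'm) nmcat \<Rightarrow> 'm set \<Rightarrow> nat \<Rightarrow>
   ((nat \<Rightarrow> 'a, nat \<Rightarrow> 'b, 'o, 'm) functr, (nat \<Rightarrow> 'a, nat \<Rightarrow> 'b, 'o, 'm) ntrans) cat" where
  "multilinear_cat C M W n = full_subcat (fun_cat (pow_cat C n) M) (multilinear_functors C M W n)"

definition permute_tuple :: "nat \<Rightarrow> (nat \<Rightarrow> nat) \<Rightarrow> (nat \<Rightarrow> 'x) \<Rightarrow> nat \<Rightarrow> 'x" where
  "permute_tuple n \<sigma> A = (\<lambda>i \<in> {1..n}. A (\<sigma> i))"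

text \<open>The functor \<open>(A\<^sub>1, ..., A\<^sub>n) \<mapsto> G(A\<^sub>\<sigma>\<^sub>(\<^sub>1\<^sub>), ..., A\<^sub>\<sigma>\<^sub>(\<^sub>n\<^sub>))\<close>.\<close>
definition permute_inputs ::
  "('a, 'b, 'z) cat_scheme \<Rightarrow> nat \<Rightarrow> (nat \<Rightarrow> nat) \<Rightarrow> (nat \<Rightarrow> 'a, nat \<Rightarrow> 'b, 'o, 'm) functr \<Rightarrow>
   (nat \<Rightarrow> 'a, nat \<Rightarrow> 'b, 'o, 'm) functr" where
  "permute_inputs C n \<sigma> G = \<lparr>
     fob = (\<lambda>A \<in> Obj (pow_cat C n). fob G (permute_tuple n \<sigma> A)),
     far = (\<lambda>f \<in> Arr (pow_cat C n). far G (permute_tuple n \<sigma> f)) \<rparr>"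

text \<open>A symmetric sequence of multilinear functors, \<open>\<Sigma>\<^sub>n\<close> acting on \<open>X n\<close> by natural isomorphisms
  \<open>act n \<sigma> : X n (A\<^sub>1, ..., A\<^sub>n) \<rightarrow> X n (A\<^sub>\<sigma>\<^sub>(\<^sub>1\<^sub>), ..., A\<^sub>\<sigma>\<^sub>(\<^sub>n\<^sub>))\<close>. Since the target of \<open>act n \<sigma>\<close> at \<open>A\<close> is
  \<open>X n\<close> at \<open>A \<circ> \<sigma>\<close>, the action of \<open>\<sigma> \<circ> \<tau>\<close> is that of \<open>\<sigma>\<close> at \<open>A\<close> followed by that of \<open>\<tau>\<close> at \<open>A \<circ> \<sigma>\<close>.\<close>
definition symmetric_sequence ::
  "('a, 'b, 'z) cat_scheme \<Rightarrow> ('o, 'm) nmcat \<Rightarrow> 'm set \<Rightarrow>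
   (nat \<Rightarrow> (nat \<Rightarrow> 'a, nat \<Rightarrow> 'b, 'o, 'm) functr) \<Rightarrow>
   (nat \<Rightarrow> (nat \<Rightarrow> nat) \<Rightarrow> (nat \<Rightarrow> 'a, nat \<Rightarrow> 'b, 'o, 'm) ntrans) \<Rightarrow> bool" where
  "symmetric_sequence C M W X act \<longleftrightarrow> (\<forall>n.
     X n \<in> Obj (multilinear_cat C M W n) \<and>
     (\<forall>\<sigma>. \<sigma> permutes {1..n} \<longrightarrow>
        act n \<sigma> \<in> hom (multilinear_cat C M W n) (X n) (permute_inputs C n \<sigma> (X n)) \<and>
        is_iso (multilinear_cat C M W n) (act n \<sigma>)) \<and>
     act n id = Idn (multilinear_cat C M W n) (X n) \<and>
     (\<forall>\<sigma> \<tau>. \<sigma> permutes {1..n} \<longrightarrow> \<tau> permutes {1..n} \<longrightarrow>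
        (\<forall>A \<in> Obj (pow_cat C n). ncmp (act n (\<sigma> \<circ> \<tau>)) A =
           ncmp (act n \<tau>) (permute_tuple n \<sigma> A) \<cdot>\<^bsub>M\<^esub> ncmp (act n \<sigma>) A)))"

text \<open>The canonical isomorphism \<open>\<Oplus>\<^sub>i\<^sub>\<in>\<^sub>S A i \<rightarrow> \<Oplus>\<^sub>j\<^sub>\<in>\<^sub>\<sigma>\<^sub>-\<^sub>1\<^sub>S A (\<sigma> j)\<close>, sending the summand \<open>i\<close> to the summand
  \<open>\<sigma>\<inverse> i\<close>.\<close>
definition cop_permute ::
  "('a, 'b, 'z) cat_scheme \<Rightarrow> ('a, 'b) coprods \<Rightarrow> nat \<Rightarrow> (nat \<Rightarrow> nat) \<Rightarrow> (nat \<Rightarrow> 'a) \<Rightarrow> nat set \<Rightarrow> 'b" where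
  "cop_permute C K n \<sigma> A S = copair C K S A (cop K (\<sigma> -` S) (permute_tuple n \<sigma> A))
     (\<lambda>i. cinj K (\<sigma> -` S) (permute_tuple n \<sigma> A) (inv \<sigma> i))"

text \<open>The map on total homotopy fibers induced by the isomorphisms of cubes
  \<open>F (\<Oplus>\<^sub>i\<^sub>\<in>\<^sub>S A i) \<rightarrow> F (\<Oplus>\<^sub>j\<^sub>\<in>\<^sub>\<sigma>\<^sub>-\<^sub>1\<^sub>S A (\<sigma> j))\<close>, followed by relabelling along \<open>S \<mapsto> \<sigma>\<inverse> S\<close>.\<close>
definition permutation_action ::
  "('a, 'b, 'z) cat_scheme \<Rightarrow> ('a, 'b) coprods \<Rightarrow> ('o, 'm) nmcat \<Rightarrow> 'o \<Rightarrow> ('o, 'm) holims \<Rightarrow>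
   ('a, 'b, 'o, 'm) functr \<Rightarrow> nat \<Rightarrow> (nat \<Rightarrow> nat) \<Rightarrow> (nat \<Rightarrow> 'a, nat \<Rightarrow> 'b, 'o, 'm) ntrans" where
  "permutation_action C K M z L F n \<sigma> =
     (let X = spectral_derivative C K M z L F n in
      \<lparr> nsrc = X, ntgt = permute_inputs C n \<sigma> X,
        ncmp = (\<lambda>A \<in> Obj (pow_cat C n).
          if n = 0 then Idn M (fob F (zob K)) else
          let D = cross_cube C K F n (permute_tuple n \<sigma> A) in
          total_hofiber_relabel M z L n (vimage \<sigma>) (image \<sigma>) D \<cdot>\<^bsub>M\<^esub>
          total_hofiber_map M z L n
            \<lparr> nsrc = cross_cube C K F n A, ntgt = reindex (cube n) (vimage \<sigma>) D,
              ncmp = (\<lambda>S \<in> cube n. far F (cop_permute C K n \<sigma> A S)) \<rparr>) \<rparr>)"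

end

theory Submission
  imports Defs
begin

text \<open>The homotopy limits are strictly functorial, so the total homotopy fiber is strictly functorial for
  pairs consisting of a permutation \<open>\<sigma>\<close> of the coordinates of the cube and a map of cubes \<open>D \<circ> \<sigma> \<rightarrow> E\<close>.
  Morphisms of tuples and permutations of inputs both induce such pairs on the cubes
  \<open>S \<mapsto> F (\<Oplus>\<^sub>i\<^sub>\<in>\<^sub>S A i)\<close>, by maps of coproducts that send each summand to a single summand or to zero.
  Hence functoriality of the cross-effect, naturality of the permutation isomorphisms and their
  compatibility with composition all reduce to equalities of maps of coproducts, which are checked
  on summands. Multilinearity is invariant under permuting the inputs, since the \<open>i\<close>-th variable of
  the permuted functor is the \<open>\<sigma>\<inverse> i\<close>-th variable of the original one.\<close>

section \<open>Categories and functors\<close>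

text \<open>The laws to be proved are equations in \<open>M\<close> itself, not in its localization,
  so a characterization of homotopy limits up to equivalence cannot yield them; they come from the
  strict laws for restriction along maps of index posets. A total homotopy fiber is the fiber of an
  arrow into the homotopy limit of the punctured cube, so a map between two of them needs a
  commuting square, and for a permutation this square involves the restriction, the map of diagrams
  and the unit \<open>hunit\<close> at once. Handling maps and relabellings separately would require
  a mixed interchange law beside the two separate composition laws. For pairs there is a single law,
  in which \<sigma> followed by \<tau> gives \<open>\<sigma> \<circ> \<tau>\<close>; naturality is
  then the coincidence of \<open>id \<circ> \<sigma>\<close> and \<open>\<sigma> \<circ> id\<close>.
  This is the order required of the action, since \<sigma> carries a tuple A to A composed with
  \<sigma>. Cube maps are indexed by direct images because these compose in the same order.\<close>

lemma homI: "f \<in> Arr C \<Longrightarrow> f \<in> hom C (Dom C f) (Cod C f)"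
  by (simp add: hom_def)

lemma homE:
  assumes "f \<in> hom C X Y"
  obtains "f \<in> Arr C" "Dom C f = X" "Cod C f = Y"
  using assms by (simp add: hom_def)

lemma (in category) hom_obj: "f \<in> hom C X Y \<Longrightarrow> X \<in> Obj C \<and> Y \<in> Obj C"
  using dom_cod by (auto simp: hom_def)

lemma (in category) id_arr: "X \<in> Obj C \<Longrightarrow> Idn C X \<in> Arr C"
  using id_hom by (auto simp: hom_def)

lemma functor_obj: "F \<in> functors I C \<Longrightarrow> X \<in> Obj I \<Longrightarrow> fob F X \<in> Obj C"
  by (auto simp: functors_def)

lemma functor_hom: "F \<in> functors I C \<Longrightarrow> f \<in> hom I X Y \<Longrightarrow> far F f \<in> hom C (fob F X) (fob F Y)"
  by (auto simp: functors_def hom_def)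

lemma functor_id: "F \<in> functors I C \<Longrightarrow> X \<in> Obj I \<Longrightarrow> far F (Idn I X) = Idn C (fob F X)"
  by (auto simp: functors_def)

lemma functor_cmp: "F \<in> functors I C \<Longrightarrow> f \<in> hom I X Y \<Longrightarrow> g \<in> hom I Y Z \<Longrightarrow>
    far F (Cmp I g f) = Cmp C (far F g) (far F f)"
  unfolding functors_def by blast

lemma functor_eqI:
  fixes F G :: "('o, 'm, 'p, 'q) functr"
  assumes "fob F \<in> extensional (Obj I)" "fob G \<in> extensional (Obj I)"
    and "far F \<in> extensional (Arr I)" "far G \<in> extensional (Arr I)"
    and "\<And>X. X \<in> Obj I \<Longrightarrow> fob F X = fob G X" "\<And>f. f \<in> Arr I \<Longrightarrow> far F f = far G f"
  shows "F = G"
proof -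
  have "fob F = fob G" using assms(1,2,5) by (rule extensionalityI)
  moreover have "far F = far G" using assms(3,4,6) by (rule extensionalityI)
  ultimately show ?thesis by simp
qed

lemma functor_ext:
  assumes "F \<in> functors I C"
  shows "fob F \<in> extensional (Obj I)" "far F \<in> extensional (Arr I)"
  using assms by (auto simp: functors_def PiE_def)

lemma functorI:
  assumes I: "category I" and C: "category C"
    and ext: "fob F \<in> extensional (Obj I)" "far F \<in> extensional (Arr I)"
    and ob: "\<And>X. X \<in> Obj I \<Longrightarrow> fob F X \<in> Obj C"
    and ar: "\<And>X Y f. f \<in> hom I X Y \<Longrightarrow> far F f \<in> hom C (fob F X) (fob F Y)"
    and i: "\<And>X. X \<in> Obj I \<Longrightarrow> far F (Idn I X) = Idn C (fob F X)"
    and c: "\<And>X Y Z f g. f \<in> hom I X Y \<Longrightarrow> g \<in> hom I Y Z \<Longrightarrow>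
      far F (Cmp I g f) = Cmp C (far F g) (far F f)"
  shows "F \<in> functors I C"
proof -
  have "far F f \<in> hom C (fob F (Dom I f)) (fob F (Cod I f))" if "f \<in> Arr I" for f
    using ar[OF homI[OF that]] .
  moreover from this have "far F f \<in> Arr C" if "f \<in> Arr I" for f
    using that by (auto simp: hom_def)
  ultimately show ?thesis
    using ext ob i c unfolding functors_def by (auto simp: PiE_def)
qed

text \<open>The shape in which the definitions write down maps of diagrams. The index set
  \<open>J\<close> is a parameter, tied to \<open>Obj I\<close> by an equation in the lemmas, so
  that terms can keep showing \<open>cube n\<close>, \<open>cospan\<close> or
  \<open>punctured_cube n\<close>.\<close>

abbreviation ntr where
  "ntr J D E c \<equiv> \<lparr> nsrc = D, ntgt = E, ncmp = (\<lambda>X \<in> J. c X) \<rparr>"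

lemma ntr_hom:
  assumes I: "category I" and D: "D \<in> functors I C" and E: "E \<in> functors I C"
    and c: "\<And>X. X \<in> Obj I \<Longrightarrow> c X \<in> hom C (fob D X) (fob E X)"
    and nat: "\<And>X Y f. f \<in> hom I X Y \<Longrightarrow> Cmp C (c Y) (far D f) = Cmp C (far E f) (c X)"
    and J: "J = Obj I"
  shows "ntr J D E c \<in> hom (fun_cat I C) D E"
proof -
  have "Cmp C (c (Cod I f)) (far D f) = Cmp C (far E f) (c (Dom I f))" if "f \<in> Arr I" for f
    using nat[OF homI[OF that]] .
  thus ?thesis
    using D E c category.dom_cod[OF I] J unfolding fun_cat_def nat_transformations_def hom_def
    by auto
qed

lemma ntr_cmp: "J = Obj I \<Longrightarrow>
  Cmp (fun_cat I C) (ntr J E G d) (ntr J D E' c) = ntr J D G (\<lambda>X. Cmp C (d X) (c X))"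
  by (auto simp: fun_cat_def intro: restrict_ext)

lemma ntr_id: "J = Obj I \<Longrightarrow> Idn (fun_cat I C) D = ntr J D D (\<lambda>X. Idn C (fob D X))"
  by (auto simp: fun_cat_def)

lemma ntr_cong: "(\<And>X. X \<in> J \<Longrightarrow> c X = d X) \<Longrightarrow> ntr J D E c = ntr J D E d"
  by (auto intro: restrict_ext)

lemma Obj_fun_cat: "Obj (fun_cat I C) = functors I C"
  by (simp add: fun_cat_def)

section \<open>Categories of tuples\<close>

lemma Obj_pow_cat: "Obj (pow_cat C n) = {1..n} \<rightarrow>\<^sub>E Obj C"
  and Arr_pow_cat: "Arr (pow_cat C n) = {1..n} \<rightarrow>\<^sub>E Arr C"
  by (simp_all add: pow_cat_def)

lemma hom_pow_cat:
  assumes "X \<in> extensional {1..n}" "Y \<in> extensional {1..n}"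
  shows "f \<in> hom (pow_cat C n) X Y \<longleftrightarrow>
    f \<in> extensional {1..n} \<and> (\<forall>i\<in>{1..n}. f i \<in> hom C (X i) (Y i))"
proof -
  have "(\<lambda>i\<in>{1..n}. Dom C (f i)) = X \<longleftrightarrow> (\<forall>i\<in>{1..n}. Dom C (f i) = X i)"
    using assms(1) by (auto simp: fun_eq_iff extensional_def)
  moreover have "(\<lambda>i\<in>{1..n}. Cod C (f i)) = Y \<longleftrightarrow> (\<forall>i\<in>{1..n}. Cod C (f i) = Y i)"
    using assms(2) by (auto simp: fun_eq_iff extensional_def)
  ultimately show ?thesis
    by (auto simp: hom_def pow_cat_def PiE_def)
qed

lemma hom_pow_catE:
  assumes "f \<in> hom (pow_cat C n) X Y"
  shows "f \<in> extensional {1..n}" "X \<in> extensional {1..n}" "Y \<in> extensional {1..n}"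
    "\<And>i. i \<in> {1..n} \<Longrightarrow> f i \<in> hom C (X i) (Y i)"
  using assms by (auto simp: hom_def pow_cat_def PiE_def)

lemma pow_cat_category:
  assumes "category C"
  shows "category (pow_cat C n)"
proof -
  interpret category C by fact
  show ?thesis
  proof
    fix f assume "f \<in> Arr (pow_cat C n)"
    thus "Dom (pow_cat C n) f \<in> Obj (pow_cat C n) \<and> Cod (pow_cat C n) f \<in> Obj (pow_cat C n)"
      using dom_cod by (auto simp: pow_cat_def)
  next
    fix X assume X: "X \<in> Obj (pow_cat C n)"
    hence "X \<in> extensional {1..n}" by (simp add: Obj_pow_cat PiE_def)
    thus "Idn (pow_cat C n) X \<in> hom (pow_cat C n) X X"
      using X by (simp add: hom_pow_cat) (auto simp: pow_cat_def PiE_iff intro: id_hom)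
  next
    fix X Y Z f g assume f: "f \<in> hom (pow_cat C n) X Y" and g: "g \<in> hom (pow_cat C n) Y Z"
    note h = hom_pow_catE[OF f] hom_pow_catE[OF g]
    show "Cmp (pow_cat C n) g f \<in> hom (pow_cat C n) X Z"
      using h by (simp add: hom_pow_cat) (auto simp: pow_cat_def intro: cmp_hom[OF h(4) h(8)])
  next
    fix X Y f assume f: "f \<in> hom (pow_cat C n) X Y"
    note h = hom_pow_catE[OF f]
    show "Cmp (pow_cat C n) (Idn (pow_cat C n) Y) f = f"
      using h(1) by (rule extensionalityI[rotated]) (use h in \<open>auto simp: pow_cat_def id_left[OF h(4)]\<close>)
    show "Cmp (pow_cat C n) f (Idn (pow_cat C n) X) = f"
      using h(1) by (rule extensionalityI[rotated]) (use h in \<open>auto simp: pow_cat_def id_right[OF h(4)]\<close>)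
  next
    fix X Y Z V f g h
    assume f: "f \<in> hom (pow_cat C n) X Y" and g: "g \<in> hom (pow_cat C n) Y Z"
      and h: "h \<in> hom (pow_cat C n) Z V"
    show "Cmp (pow_cat C n) (Cmp (pow_cat C n) h g) f = Cmp (pow_cat C n) h (Cmp (pow_cat C n) g f)"
      using cmp_assoc[OF hom_pow_catE(4)[OF f] hom_pow_catE(4)[OF g] hom_pow_catE(4)[OF h]]
      by (auto simp: pow_cat_def intro: restrict_ext)
  qed
qed

section \<open>Diagrams over posets and their reindexing\<close>

lemma Obj_poset_cat[simp]: "Obj (poset_cat J) = J"
  and Arr_poset_cat: "Arr (poset_cat J) = {(S, T). S \<in> J \<and> T \<in> J \<and> T \<subseteq> S}"
  and hom_poset_cat: "a \<in> hom (poset_cat J) S T \<longleftrightarrow> a = (S, T) \<and> S \<in> J \<and> T \<in> J \<and> T \<subseteq> S"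
  and Idn_poset_cat: "Idn (poset_cat J) S = (S, S)"
  and Cmp_poset_cat: "Cmp (poset_cat J) b a = (fst a, snd b)"
  by (auto simp: poset_cat_def hom_def)

lemma poset_cat_category: "category (poset_cat J)"
  by standard (auto simp: hom_poset_cat Idn_poset_cat Cmp_poset_cat, auto simp: poset_cat_def)

lemma diagramI:
  assumes C: "category C"
    and ext: "fob D \<in> extensional J" "far D \<in> extensional (Arr (poset_cat J))"
    and ob: "\<And>S. S \<in> J \<Longrightarrow> fob D S \<in> Obj C"
    and ar: "\<And>S T. S \<in> J \<Longrightarrow> T \<in> J \<Longrightarrow> T \<subseteq> S \<Longrightarrow> far D (S, T) \<in> hom C (fob D S) (fob D T)"
    and i: "\<And>S. S \<in> J \<Longrightarrow> far D (S, S) = Idn C (fob D S)"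
    and c: "\<And>S T U. S \<in> J \<Longrightarrow> T \<in> J \<Longrightarrow> U \<in> J \<Longrightarrow> T \<subseteq> S \<Longrightarrow> U \<subseteq> T \<Longrightarrow>
      far D (S, U) = Cmp C (far D (T, U)) (far D (S, T))"
  shows "D \<in> functors (poset_cat J) C"
  by (rule functorI[OF poset_cat_category C])
    (use ext in \<open>auto simp: hom_poset_cat Idn_poset_cat Cmp_poset_cat intro: ob ar i c\<close>)

lemma diagram_hom:
  "D \<in> functors (poset_cat J) C \<Longrightarrow> S \<in> J \<Longrightarrow> T \<in> J \<Longrightarrow> T \<subseteq> S \<Longrightarrow>
    far D (S, T) \<in> hom C (fob D S) (fob D T)"
  by (erule functor_hom) (simp add: hom_poset_cat)

lemma diagram_id: "D \<in> functors (poset_cat J) C \<Longrightarrow> S \<in> J \<Longrightarrow> far D (S, S) = Idn C (fob D S)"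
  using functor_id[of D "poset_cat J" C S] by (simp add: Idn_poset_cat)

lemma diagram_cmp:
  "D \<in> functors (poset_cat J) C \<Longrightarrow> S \<in> J \<Longrightarrow> T \<in> J \<Longrightarrow> U \<in> J \<Longrightarrow> T \<subseteq> S \<Longrightarrow> U \<subseteq> T \<Longrightarrow>
    Cmp C (far D (T, U)) (far D (S, T)) = far D (S, U)"
  using functor_cmp[of D "poset_cat J" C "(S, T)" S T "(T, U)" U]
  by (simp add: hom_poset_cat Cmp_poset_cat)

lemma ntr_diagram_hom:
  assumes "D \<in> functors (poset_cat J) C" "E \<in> functors (poset_cat J) C"
    and "\<And>S. S \<in> J \<Longrightarrow> c S \<in> hom C (fob D S) (fob E S)"
    and "\<And>S T. S \<in> J \<Longrightarrow> T \<in> J \<Longrightarrow> T \<subseteq> S \<Longrightarrow>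
      Cmp C (c T) (far D (S, T)) = Cmp C (far E (S, T)) (c S)"
  shows "ntr J D E c \<in> hom (diagrams C J) D E"
  by (rule ntr_hom[OF poset_cat_category]) (use assms in \<open>auto simp: hom_poset_cat\<close>)

lemma reindex_diagram:
  assumes C: "category C" and D: "D \<in> functors (poset_cat J) C" and u: "monotone_map J' J u"
  shows "reindex J' u D \<in> functors (poset_cat J') C"
proof -
  have m: "u S \<in> J" if "S \<in> J'" for S using u that by (auto simp: monotone_map_def)
  have s: "u T \<subseteq> u S" if "S \<in> J'" "T \<in> J'" "T \<subseteq> S" for S T
    using u that by (auto simp: monotone_map_def)
  show ?thesis
    by (rule diagramI[OF C])
      (auto simp: reindex_def Arr_poset_cat m s diagram_hom[OF D] diagram_id[OF D] diagram_cmp[OF D]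
        functor_obj[OF D])
qed

lemma reindex_reindex:
  assumes "monotone_map J'' J' v"
  shows "reindex J'' v (reindex J' u D) = reindex J'' (u \<circ> v) D"
  using assms by (auto simp: reindex_def monotone_map_def Arr_poset_cat fun_eq_iff)

lemma reindex_cong:
  assumes "\<And>S. S \<in> J \<Longrightarrow> u S = v S"
  shows "reindex J u D = reindex J v D"
  using assms by (auto simp: reindex_def Arr_poset_cat fun_eq_iff)

lemma const_diagram_functor:
  assumes "category C" "X \<in> Obj C"
  shows "const_diagram C J X \<in> functors (poset_cat J) C"
  by (rule diagramI[OF assms(1)])
    (use assms category.id_hom[OF assms] category.id_left[OF assms(1) category.id_hom[OF assms]]
     in \<open>auto simp: const_diagram_def Arr_poset_cat\<close>)

lemma reindex_const: "monotone_map J' J u \<Longrightarrow> reindex J' u (const_diagram C J X) = const_diagram C J' X"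
  by (auto simp: reindex_def const_diagram_def Arr_poset_cat monotone_map_def fun_eq_iff)

lemma reindex_map_ntr:
  "monotone_map J' J u \<Longrightarrow>
    reindex_map J' u (ntr J D E c) = ntr J' (reindex J' u D) (reindex J' u E) (\<lambda>S. c (u S))"
  by (auto simp: reindex_map_def monotone_map_def fun_eq_iff)

section \<open>Functoriality of total homotopy fibers\<close>

text \<open>Keeps the cospan vertex \<open>{1}\<close> and the intervals \<open>{1..n}\<close> in
  the form used by the definitions; simplification would otherwise replace 1 by
  \<open>Suc 0\<close>.\<close>

declare One_nat_def[simp del]

section \<open>Permutations acting on cubes and punctured cubes\<close>

lemma vimage_permutes: "\<sigma> permutes U \<Longrightarrow> \<sigma> -` S = inv \<sigma> ` S"
  by (simp add: bij_vimage_eq_inv_image permutes_bij)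

lemma image_cube: "\<sigma> permutes {1..n} \<Longrightarrow> S \<in> cube n \<Longrightarrow> \<sigma> ` S \<in> cube n"
  using permutes_image[of \<sigma> "{1..n}"] by (auto simp: cube_def)

text \<open>By injectivity, only the top vertex is mapped to the top vertex, so removing it leaves a
  set stable under the action.\<close>

lemma image_punctured_cube:
  assumes "\<sigma> permutes {1..n}" "S \<in> punctured_cube n"
  shows "\<sigma> ` S \<in> punctured_cube n"
proof -
  have "\<sigma> ` S \<in> cube n" using assms image_cube by (auto simp: cube_def punctured_cube_def)
  moreover have "\<sigma> ` S \<noteq> \<sigma> ` {1..n}"
    using assms(2) by (auto simp: inj_image_eq_iff[OF permutes_inj[OF assms(1)]] punctured_cube_def)
  ultimately show ?thesis
    using permutes_image[OF assms(1)] by (auto simp: cube_def punctured_cube_def)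
qed

lemma punctured_cube_sub: "S \<in> punctured_cube n \<Longrightarrow> S \<in> cube n"
  by (simp add: punctured_cube_def cube_def)

lemma top_cube: "{1..n} \<in> cube n"
  by (simp add: cube_def)

lemma cube_top: "S \<in> cube n \<Longrightarrow> S \<subseteq> {1..n}"
  by (simp add: cube_def)

lemma index_poset_punctured_cube: "index_poset (punctured_cube n)"
  by (auto simp: index_poset_def punctured_cube_def dest: finite_subset)

lemma index_poset_cospan: "index_poset cospan"
  by (auto simp: index_poset_def cospan_def)

lemma monotone_permutes:
  "\<sigma> permutes {1..n} \<Longrightarrow> monotone_map (punctured_cube n) (punctured_cube n) (image \<sigma>)"
  "\<sigma> permutes {1..n} \<Longrightarrow> monotone_map (punctured_cube n) (cube n) (image \<sigma>)"
  "\<sigma> permutes {1..n} \<Longrightarrow> monotone_map (cube n) (cube n) (image \<sigma>)"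
  by (auto simp: monotone_map_def image_punctured_cube image_cube punctured_cube_sub)

lemma monotone_punctured_id: "monotone_map (punctured_cube n) (cube n) id"
  by (auto simp: monotone_map_def punctured_cube_sub)

lemma reindex_image_id:
  "\<sigma> permutes {1..n} \<Longrightarrow> reindex (punctured_cube n) (image \<sigma>) (reindex (punctured_cube n) id D) =
    reindex (punctured_cube n) (image \<sigma>) D"
  by (simp add: reindex_reindex[OF monotone_permutes(1)])

section \<open>Homotopy fibers of arrows and their induced maps\<close>

locale hofibers = homotopy_limits M W L
  for M :: "('o, 'm) nmcat" (structure) and W :: "'m set" and L :: "('o, 'm) holims" +
  fixes z :: 'o
  assumes zero: "zero_object M z"
    and hzero_hom: "X \<in> Obj M \<Longrightarrow> Y \<in> Obj M \<Longrightarrow> hzero M X Y \<in> hom M X Y"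
begin

lemma z_obj: "z \<in> Obj M"
  using zero by (simp add: zero_object_def)

text \<open>The leg \<open>hzero M z Y\<close> of a fiber diagram is compared with other arrows only
  through this uniqueness: out of a zero object, the type determines the arrow.\<close>

lemma from_zero_eq: "f \<in> hom M z Y \<Longrightarrow> g \<in> hom M z Y \<Longrightarrow> f = g"
  using zero hom_obj[of f z Y] unfolding zero_object_def by metis

lemma hlim_hom:
  "index_poset J \<Longrightarrow> t \<in> hom (diagrams M J) D E \<Longrightarrow>
    far (hlim L J) t \<in> hom M (fob (hlim L J) D) (fob (hlim L J) E)"
  by (rule functor_hom[OF hlim_functor])

lemma hlim_obj: "index_poset J \<Longrightarrow> D \<in> functors (poset_cat J) M \<Longrightarrow> fob (hlim L J) D \<in> Obj M"
  using functor_obj[OF hlim_functor] by (simp add: Obj_fun_cat)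

lemma hlim_cmp:
  assumes "index_poset J" "ntr J D E c \<in> hom (diagrams M J) D E" "ntr J E G d \<in> hom (diagrams M J) E G"
  shows "far (hlim L J) (ntr J E G d) \<cdot> far (hlim L J) (ntr J D E c) =
    far (hlim L J) (ntr J D G (\<lambda>S. d S \<cdot> c S))"
  using functor_cmp[OF hlim_functor[OF assms(1)] assms(2,3)] by (simp add: ntr_cmp)

lemma hlim_id:
  assumes "index_poset J" "D \<in> functors (poset_cat J) M" "\<And>S. S \<in> J \<Longrightarrow> c S = Idn M (fob D S)"
  shows "far (hlim L J) (ntr J D D c) = Idn M (fob (hlim L J) D)"
proof -
  have "ntr J D D c = Idn (diagrams M J) D"
    using assms(3) by (simp add: ntr_id cong: restrict_cong)
  thus ?thesis
    using functor_id[OF hlim_functor[OF assms(1)]] assms(2) by (simp add: Obj_fun_cat)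
qed

lemma cospan_arrow_cases:
  assumes "S \<in> cospan" "T \<in> cospan" "T \<subseteq> S"
  obtains "S = T" | "S = {1}" "T = {}" | "S = {2}" "T = {}"
  using assms by (auto simp: cospan_def)

lemma fiber_diagram_simps:
  assumes f: "f \<in> hom M X Y"
  shows "fob (fiber_diagram M z f) {1} = X" "fob (fiber_diagram M z f) {} = Y"
    "fob (fiber_diagram M z f) {2} = z" "far (fiber_diagram M z f) ({1}, {}) = f"
    "far (fiber_diagram M z f) ({2}, {}) = hzero M z Y"
    "S \<in> cospan \<Longrightarrow> far (fiber_diagram M z f) (S, S) = Idn M (fob (fiber_diagram M z f) S)"
  using f by (auto simp: fiber_diagram_def cospan_def Arr_poset_cat hom_def)

text \<open>The cospan has no composable pair of non-identity arrows, so the composition law reduces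
  to the two unit laws.\<close>

lemma fiber_diagram_functor:
  assumes f: "f \<in> hom M X Y"
  shows "fiber_diagram M z f \<in> functors (poset_cat cospan) M"
proof -
  let ?D = "fiber_diagram M z f"
  note X = hom_obj[OF f, THEN conjunct1] and Y = hom_obj[OF f, THEN conjunct2]
  note D = fiber_diagram_simps[OF f]
  have ob: "fob ?D S \<in> Obj M" if "S \<in> cospan" for S
    using that D(1-3) X Y z_obj by (auto simp: cospan_def)
  have ar: "far ?D (S, T) \<in> hom M (fob ?D S) (fob ?D T)"
    if "S \<in> cospan" "T \<in> cospan" "T \<subseteq> S" for S T
    using that by (rule cospan_arrow_cases)
      (use that in \<open>simp_all only: D id_hom[OF ob] f hzero_hom[OF z_obj Y]\<close>)
  show ?thesis
  proof (rule diagramI[OF category_axioms _ _ ob ar D(6)])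
    fix S T U assume h: "S \<in> cospan" "T \<in> cospan" "U \<in> cospan" "T \<subseteq> S" "U \<subseteq> T"
    show "far ?D (S, U) = far ?D (T, U) \<cdot> far ?D (S, T)"
    proof (cases "S = T")
      case True
      thus ?thesis using h by (simp add: D(6) id_right[OF ar])
    next
      case False
      have "T = U" using h(1,2,4) by (rule cospan_arrow_cases) (use False h(5) in auto)
      thus ?thesis using h by (simp add: D(6) id_left[OF ar])
    qed
  qed (auto simp: fiber_diagram_def)
qed

text \<open>There are two non-identity squares to check: the one over \<open>{1}\<close> is the
  given square \<open>sq\<close>, and the one over \<open>{2}\<close> commutes because both of its
  composites start at the zero object.\<close>

lemma hofiber_map_hom_diagrams:
  assumes f: "f \<in> hom M X Y" and g: "g \<in> hom M X' Y'" and a: "a \<in> hom M X X'" and b: "b \<in> hom M Y Y'"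
    and sq: "b \<cdot> f = g \<cdot> a"
  shows "ntr cospan (fiber_diagram M z f) (fiber_diagram M z g)
      (\<lambda>S. if S = {1} then a else if S = {} then b else Idn M z)
    \<in> hom (diagrams M cospan) (fiber_diagram M z f) (fiber_diagram M z g)"
    (is "ntr cospan ?D ?E ?c \<in> _")
proof -
  note Y = hom_obj[OF b, THEN conjunct1] and Y' = hom_obj[OF b, THEN conjunct2]
  note i = id_hom[OF z_obj] hzero_hom[OF z_obj Y] hzero_hom[OF z_obj Y']
  have z: "b \<cdot> hzero M z Y = hzero M z Y' \<cdot> Idn M z"
    using from_zero_eq cmp_hom[OF i(2) b] cmp_hom[OF i(1) i(3)] by blast
  have c: "?c {1} = a" "?c {} = b" "?c {2} = Idn M z" by auto
  note D = fiber_diagram_simps[OF f] and E = fiber_diagram_simps[OF g]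
  have ch: "?c S \<in> hom M (fob ?D S) (fob ?E S)" if "S \<in> cospan" for S
  proof -
    from that consider "S = {1}" | "S = {}" | "S = {2}" by (auto simp: cospan_def)
    thus ?thesis by cases (simp_all only: c D E a b i)
  qed
  show ?thesis
  proof (rule ntr_diagram_hom[OF fiber_diagram_functor[OF f] fiber_diagram_functor[OF g] ch])
    fix S T assume h: "S \<in> cospan" "T \<in> cospan" "T \<subseteq> S"
    thus "?c T \<cdot> far ?D (S, T) = far ?E (S, T) \<cdot> ?c S"
    proof (cases rule: cospan_arrow_cases)
      case 1
      thus ?thesis using h(1) by (simp only: D(6) E(6) id_left[OF ch] id_right[OF ch])
    qed (simp_all only: c D E sq z)
  qed
qed

lemma hofiber_obj: "f \<in> hom M X Y \<Longrightarrow> hofiber M z L f \<in> Obj M"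
  unfolding hofiber_def by (intro hlim_obj index_poset_cospan fiber_diagram_functor)

lemma hofiber_map_hom:
  assumes "f \<in> hom M X Y" "g \<in> hom M X' Y'" "a \<in> hom M X X'" "b \<in> hom M Y Y'" "b \<cdot> f = g \<cdot> a"
  shows "hofiber_map M z L f g a b \<in> hom M (hofiber M z L f) (hofiber M z L g)"
  unfolding hofiber_def hofiber_map_def
  by (rule hlim_hom[OF index_poset_cospan hofiber_map_hom_diagrams[OF assms]])

lemma hofiber_map_cmp:
  assumes f: "f \<in> hom M X Y" and g: "g \<in> hom M X' Y'" and h: "h \<in> hom M X'' Y''"
    and a: "a \<in> hom M X X'" and b: "b \<in> hom M Y Y'" and sq: "b \<cdot> f = g \<cdot> a"
    and a': "a' \<in> hom M X' X''" and b': "b' \<in> hom M Y' Y''" and sq': "b' \<cdot> g = h \<cdot> a'"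
  shows "hofiber_map M z L g h a' b' \<cdot> hofiber_map M z L f g a b =
    hofiber_map M z L f h (a' \<cdot> a) (b' \<cdot> b)"
  unfolding hofiber_map_def
  by (subst hlim_cmp[OF index_poset_cospan hofiber_map_hom_diagrams[OF f g a b sq]
        hofiber_map_hom_diagrams[OF g h a' b' sq']])
    (auto intro!: arg_cong[where f = "far (hlim L cospan)"] restrict_ext
      simp: id_left[OF id_hom[OF z_obj]])

lemma hofiber_map_id:
  assumes f: "f \<in> hom M X Y"
  shows "hofiber_map M z L f f (Idn M X) (Idn M Y) = Idn M (hofiber M z L f)"
proof -
  have "Dom M f = X" "Cod M f = Y" using f by (auto simp: hom_def)
  thus ?thesis
    unfolding hofiber_map_def hofiber_def
    by (intro hlim_id[OF index_poset_cospan fiber_diagram_functor[OF f]])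
      (auto simp: cospan_def fiber_diagram_def)
qed

section \<open>Total homotopy fibers and twisted maps of cubes\<close>

context
  fixes n :: nat
begin

abbreviation "pc \<equiv> punctured_cube n"
abbreviation "full \<equiv> {1..n}"
abbreviation "cubes \<equiv> functors (poset_cat (cube n)) M"

lemmas idx = index_poset_punctured_cube[of n]

lemma reindex_pc:
  assumes "D \<in> cubes"
  shows "reindex pc id D \<in> functors (poset_cat pc) M"
    and "\<sigma> permutes full \<Longrightarrow> reindex pc (image \<sigma>) D \<in> functors (poset_cat pc) M"
  using assms
  by (auto intro: reindex_diagram[OF category_axioms] monotone_punctured_id monotone_permutes)

text \<open>A cone for every \<sigma>, although \<open>punctured_map\<close> involves only the
  identity: restricting the cone of D along \<sigma> produces the one over D composed with \<sigma>,
  and this intermediate cone occurs in \<open>twisted_square\<close>.\<close>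

lemma cone_hom:
  assumes D: "D \<in> cubes" and \<sigma>: "\<sigma> permutes full"
  shows "ntr pc (const_diagram M pc (fob D full)) (reindex pc (image \<sigma>) D) (\<lambda>S. far D (full, \<sigma> ` S))
    \<in> hom (diagrams M pc) (const_diagram M pc (fob D full)) (reindex pc (image \<sigma>) D)"
proof -
  have X: "fob D full \<in> Obj M" using D functor_obj[OF D] by (simp add: top_cube)
  have s: "\<sigma> ` S \<in> cube n" if "S \<in> pc" for S
    using that image_cube[OF \<sigma>] punctured_cube_sub by blast
  have h: "far D (full, \<sigma> ` S) \<in> hom M (fob D full) (fob D (\<sigma> ` S))" if "S \<in> pc" for S
    using s[OF that] by (intro diagram_hom[OF D]) (auto simp: top_cube cube_top)
  show ?thesis
  proof (rule ntr_diagram_hom[OF const_diagram_functor[OF category_axioms X] reindex_pc(2)[OF D \<sigma>]])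
    fix S assume S: "S \<in> pc"
    show "far D (full, \<sigma> ` S) \<in> hom M (fob (const_diagram M pc (fob D full)) S)
        (fob (reindex pc (image \<sigma>) D) S)"
      using h[OF S] S by (simp add: const_diagram_def reindex_def)
    fix T assume T: "T \<in> pc" "T \<subseteq> S"
    have "far D (\<sigma> ` S, \<sigma> ` T) \<cdot> far D (full, \<sigma> ` S) = far D (full, \<sigma> ` T)"
      by (rule diagram_cmp[OF D]) (use s[OF S] s[OF T(1)] T(2) in \<open>auto simp: top_cube cube_top\<close>)
    thus "far D (full, \<sigma> ` T) \<cdot> far (const_diagram M pc (fob D full)) (S, T) =
        far (reindex pc (image \<sigma>) D) (S, T) \<cdot> far D (full, \<sigma> ` S)"
      using S T by (simp add: const_diagram_def reindex_def Arr_poset_cat id_right[OF h[OF T(1)]])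
  qed
qed

text \<open>Rewrites the reindexing by \<open>id\<close> as one by \<open>image id\<close>, which
  exhibits the map as built from the case \<sigma> = \<open>id\<close> of
  \<open>cone_hom\<close>.\<close>

lemma punctured_map_eq:
  "punctured_map M L n D =
    far (hlim L pc) (ntr pc (const_diagram M pc (fob D full)) (reindex pc (image id) D)
      (\<lambda>S. far D (full, id ` S))) \<cdot> hunit L pc (fob D full)"
proof -
  have "image id = (id :: nat set \<Rightarrow> nat set)" by auto
  thus ?thesis by (simp add: punctured_map_def)
qed

lemma punctured_map_hom:
  assumes D: "D \<in> cubes"
  shows "punctured_map M L n D \<in> hom M (fob D full) (fob (hlim L pc) (reindex pc id D))"
proof -
  have X: "fob D full \<in> Obj M" using D functor_obj[OF D] by (simp add: top_cube)
  have "image id = (id :: nat set \<Rightarrow> nat set)" by auto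
  thus ?thesis
    using cmp_hom[OF hunit_hom[OF idx X] hlim_hom[OF idx cone_hom[OF D permutes_id]]]
    by (simp add: punctured_map_eq)
qed

text \<open>A map of cubes \<open>D \<circ> \<sigma> \<rightarrow> E\<close>, where \<open>\<sigma>\<close> acts on the cube by direct image. Ordinary maps of
  cubes are the case \<open>\<sigma> = id\<close>, relabellings the case where all components are identities.\<close>
definition twisted_cube_map ::
  "(nat \<Rightarrow> nat) \<Rightarrow> ('o, 'm) diagram \<Rightarrow> ('o, 'm) diagram \<Rightarrow> (nat set \<Rightarrow> 'm) \<Rightarrow> bool" where
  "twisted_cube_map \<sigma> D E c \<longleftrightarrow> \<sigma> permutes full \<and> D \<in> cubes \<and> E \<in> cubes \<and>
     (\<forall>S\<in>cube n. c S \<in> hom M (fob D (\<sigma> ` S)) (fob E S)) \<and>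
     (\<forall>S\<in>cube n. \<forall>T\<in>cube n. T \<subseteq> S \<longrightarrow> c T \<cdot> far D (\<sigma> ` S, \<sigma> ` T) = far E (S, T) \<cdot> c S)"

text \<open>Restriction along \<open>image \<sigma>\<close> ends at the homotopy limit of D composed
  with \<sigma>, which is where c starts. With this variance of c no inverse permutation is needed
  here.\<close>

definition twisted_punctured_map ::
  "(nat \<Rightarrow> nat) \<Rightarrow> ('o, 'm) diagram \<Rightarrow> ('o, 'm) diagram \<Rightarrow> (nat set \<Rightarrow> 'm) \<Rightarrow> 'm" where
  "twisted_punctured_map \<sigma> D E c =
     far (hlim L pc) (ntr pc (reindex pc (image \<sigma>) D) (reindex pc id E) c) \<cdot>
     hres L pc pc (image \<sigma>) (reindex pc id D)"

text \<open>The top vertex is fixed by \<sigma>, so there the component \<open>c full\<close> serves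
  as it is and only the punctured part needs restriction.\<close>

definition twisted_map ::
  "(nat \<Rightarrow> nat) \<Rightarrow> ('o, 'm) diagram \<Rightarrow> ('o, 'm) diagram \<Rightarrow> (nat set \<Rightarrow> 'm) \<Rightarrow> 'm" where
  "twisted_map \<sigma> D E c =
     hofiber_map M z L (punctured_map M L n D) (punctured_map M L n E) (c full)
       (twisted_punctured_map \<sigma> D E c)"

lemma twisted_cube_mapD:
  assumes "twisted_cube_map \<sigma> D E c"
  shows "\<sigma> permutes full" "D \<in> cubes" "E \<in> cubes"
    "\<And>S. S \<in> cube n \<Longrightarrow> c S \<in> hom M (fob D (\<sigma> ` S)) (fob E S)"
    "\<And>S T. S \<in> cube n \<Longrightarrow> T \<in> cube n \<Longrightarrow> T \<subseteq> S \<Longrightarrow> c T \<cdot> far D (\<sigma> ` S, \<sigma> ` T) = far E (S, T) \<cdot> c S"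
    "c full \<in> hom M (fob D full) (fob E full)"
proof -
  show *: "\<sigma> permutes full" "D \<in> cubes" "E \<in> cubes"
    "\<And>S. S \<in> cube n \<Longrightarrow> c S \<in> hom M (fob D (\<sigma> ` S)) (fob E S)"
    "\<And>S T. S \<in> cube n \<Longrightarrow> T \<in> cube n \<Longrightarrow> T \<subseteq> S \<Longrightarrow> c T \<cdot> far D (\<sigma> ` S, \<sigma> ` T) = far E (S, T) \<cdot> c S"
    using assms by (auto simp: twisted_cube_map_def)
  show "c full \<in> hom M (fob D full) (fob E full)"
    using *(4)[OF top_cube] by (simp only: permutes_image[OF *(1)])
qed

lemma twisted_components_hom:
  assumes "twisted_cube_map \<sigma> D E c"
  shows "ntr pc (reindex pc (image \<sigma>) D) (reindex pc id E) c
    \<in> hom (diagrams M pc) (reindex pc (image \<sigma>) D) (reindex pc id E)"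
proof -
  note t = twisted_cube_mapD[OF assms]
  show ?thesis
    by (rule ntr_diagram_hom[OF reindex_pc(2)[OF t(2,1)] reindex_pc(1)[OF t(3)]])
      (use t(4,5) in \<open>auto simp: reindex_def Arr_poset_cat punctured_cube_sub\<close>)
qed

lemma hres_permute_hom:
  assumes "\<sigma> permutes full" "D \<in> cubes"
  shows "hres L pc pc (image \<sigma>) (reindex pc id D)
    \<in> hom M (fob (hlim L pc) (reindex pc id D)) (fob (hlim L pc) (reindex pc (image \<sigma>) D))"
  using hres_hom[OF idx idx monotone_permutes(1)[OF assms(1)], of "reindex pc id D"]
  by (simp add: Obj_fun_cat reindex_pc(1)[OF assms(2)] reindex_image_id[OF assms(1)])

lemma twisted_punctured_map_hom:
  assumes "twisted_cube_map \<sigma> D E c"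
  shows "twisted_punctured_map \<sigma> D E c
    \<in> hom M (fob (hlim L pc) (reindex pc id D)) (fob (hlim L pc) (reindex pc id E))"
  unfolding twisted_punctured_map_def
  by (rule cmp_hom[OF hres_permute_hom hlim_hom[OF idx twisted_components_hom[OF assms]]])
    (use twisted_cube_mapD[OF assms] in auto)

text \<open>The restriction is moved towards the unit: by \<open>hres_nat\<close> it passes the cone
  of D, which becomes the cone over D composed with \<sigma>, and by \<open>hres_hunit\<close> it is
  absorbed by the unit of the constant diagram. Compatibility of c with the edges out of the top
  vertex then exchanges this cone for the cone of E preceded by the constant map
  \<open>c full\<close>, and \<open>hunit_nat\<close> pulls \<open>c full\<close> out in
  front.\<close>

lemma twisted_square:
  assumes "twisted_cube_map \<sigma> D E c"
  shows "twisted_punctured_map \<sigma> D E c \<cdot> punctured_map M L n D = punctured_map M L n E \<cdot> c full"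
proof -
  note t = twisted_cube_mapD[OF assms]
  have im: "image id = (id :: nat set \<Rightarrow> nat set)" by auto
  have s: "\<sigma> ` full = full" using permutes_image[OF t(1)] .
  define X Y where "X = fob D full" and "Y = fob E full"
  have X: "X \<in> Obj M" and Y: "Y \<in> Obj M"
    unfolding X_def Y_def using functor_obj[OF t(2)] functor_obj[OF t(3)] by (simp_all add: top_cube)
  have ct: "c full \<in> hom M X Y" unfolding X_def Y_def by (rule t(6))
  let ?cX = "const_diagram M pc X" and ?cY = "const_diagram M pc Y"
  let ?H = "far (hlim L pc)"
  define tD where "tD = ntr pc ?cX (reindex pc id D) (\<lambda>S. far D (full, S))"
  define tD' where "tD' = ntr pc ?cX (reindex pc (image \<sigma>) D) (\<lambda>S. far D (full, \<sigma> ` S))"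
  define tE where "tE = ntr pc ?cY (reindex pc id E) (\<lambda>S. far E (full, S))"
  define cc where "cc = ntr pc (reindex pc (image \<sigma>) D) (reindex pc id E) c"
  define r where "r = hres L pc pc (image \<sigma>) (reindex pc id D)"
  have hD: "tD \<in> hom (diagrams M pc) ?cX (reindex pc id D)"
    using cone_hom[OF t(2) permutes_id] by (simp add: tD_def X_def im)
  have hD': "tD' \<in> hom (diagrams M pc) ?cX (reindex pc (image \<sigma>) D)"
    using cone_hom[OF t(2) t(1)] by (simp add: tD'_def X_def)
  have hE: "tE \<in> hom (diagrams M pc) ?cY (reindex pc id E)"
    using cone_hom[OF t(3) permutes_id] by (simp add: tE_def Y_def im)
  have hcc: "cc \<in> hom (diagrams M pc) (reindex pc (image \<sigma>) D) (reindex pc id E)"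
    unfolding cc_def by (rule twisted_components_hom[OF assms])
  have hr: "r \<in> hom M (fob (hlim L pc) (reindex pc id D)) (fob (hlim L pc) (reindex pc (image \<sigma>) D))"
    unfolding r_def by (rule hres_permute_hom[OF t(1,2)])
  note uX = hunit_hom[OF idx X] and uY = hunit_hom[OF idx Y]
  note mono = monotone_permutes(1)[OF t(1)]
  \<comment> \<open>Restriction replaces the vertex S of the cone by its image under \<sigma>, while
    a constant diagram is unchanged by reindexing.\<close>
  have rm: "reindex_map pc (image \<sigma>) tD = tD'"
    unfolding tD_def tD'_def
    by (simp only: reindex_map_ntr[OF mono] reindex_const[OF mono] reindex_image_id[OF t(1)])
  have rX: "hres L pc pc (image \<sigma>) ?cX
      \<in> hom M (fob (hlim L pc) ?cX) (fob (hlim L pc) ?cX)"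
    using hres_hom[OF idx idx mono, of ?cX] const_diagram_functor[OF category_axioms X]
    by (simp add: Obj_fun_cat reindex_const[OF mono])
  have cm: "const_map M pc (c full) = ntr pc ?cX ?cY (\<lambda>S. c full)"
    using ct by (auto simp: const_map_def hom_def)
  have hcm: "ntr pc ?cX ?cY (\<lambda>S. c full) \<in> hom (diagrams M pc) ?cX ?cY"
    by (rule ntr_diagram_hom[OF const_diagram_functor[OF category_axioms X]
          const_diagram_functor[OF category_axioms Y]])
      (use ct in \<open>auto simp: const_diagram_def Arr_poset_cat id_left[OF ct] id_right[OF ct]\<close>)
  have pD: "punctured_map M L n D = ?H tD \<cdot> hunit L pc X"
    by (simp add: punctured_map_eq tD_def X_def im)
  have pE: "punctured_map M L n E = ?H tE \<cdot> hunit L pc Y"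
    by (simp add: punctured_map_eq tE_def Y_def im)
  have "twisted_punctured_map \<sigma> D E c \<cdot> punctured_map M L n D = ?H cc \<cdot> r \<cdot> (?H tD \<cdot> hunit L pc X)"
    by (simp add: twisted_punctured_map_def cc_def r_def pD)
  also have "\<dots> = ?H cc \<cdot> (r \<cdot> (?H tD \<cdot> hunit L pc X))"
    by (rule cmp_assoc[OF cmp_hom[OF uX hlim_hom[OF idx hD]] hr hlim_hom[OF idx hcc]])
  also have "r \<cdot> (?H tD \<cdot> hunit L pc X) = r \<cdot> ?H tD \<cdot> hunit L pc X"
    by (rule cmp_assoc[symmetric, OF uX hlim_hom[OF idx hD] hr])
  also have "r \<cdot> ?H tD = ?H tD' \<cdot> hres L pc pc (image \<sigma>) ?cX"
    unfolding r_def using hres_nat[OF idx idx mono hD] by (simp only: rm)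
  also have "?H tD' \<cdot> hres L pc pc (image \<sigma>) ?cX \<cdot> hunit L pc X =
      ?H tD' \<cdot> (hres L pc pc (image \<sigma>) ?cX \<cdot> hunit L pc X)"
    by (rule cmp_assoc[OF uX rX hlim_hom[OF idx hD']])
  also have "hres L pc pc (image \<sigma>) ?cX \<cdot> hunit L pc X = hunit L pc X"
    by (rule hres_hunit[OF idx idx mono X])
  also have "?H cc \<cdot> (?H tD' \<cdot> hunit L pc X) = ?H cc \<cdot> ?H tD' \<cdot> hunit L pc X"
    by (rule cmp_assoc[symmetric, OF uX hlim_hom[OF idx hD'] hlim_hom[OF idx hcc]])
  also have "?H cc \<cdot> ?H tD' = ?H (ntr pc ?cX (reindex pc id E) (\<lambda>S. c S \<cdot> far D (full, \<sigma> ` S)))"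
    using hlim_cmp[OF idx hD'[unfolded tD'_def] hcc[unfolded cc_def]] by (simp add: tD'_def cc_def)
  \<comment> \<open>This is compatibility of c with the edge from the top vertex to S; the source of
    that edge stays at the top because \<sigma> fixes \<open>full\<close>.\<close>
  also have "ntr pc ?cX (reindex pc id E) (\<lambda>S. c S \<cdot> far D (full, \<sigma> ` S)) =
      ntr pc ?cX (reindex pc id E) (\<lambda>S. far E (full, S) \<cdot> c full)"
  proof (rule ntr_cong)
    fix S assume "S \<in> pc"
    hence "S \<in> cube n" by (rule punctured_cube_sub)
    from t(5)[OF top_cube this cube_top[OF this]]
    show "c S \<cdot> far D (full, \<sigma> ` S) = far E (full, S) \<cdot> c full" by (simp only: s)
  qed
  also have "?H \<dots> = ?H tE \<cdot> ?H (const_map M pc (c full))"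
    using hlim_cmp[OF idx hcm hE[unfolded tE_def]] by (simp add: tE_def cm)
  also have "\<dots> \<cdot> hunit L pc X = ?H tE \<cdot> (?H (const_map M pc (c full)) \<cdot> hunit L pc X)"
    using cmp_assoc[OF uX hlim_hom[OF idx hcm] hlim_hom[OF idx hE]] by (simp add: cm)
  also have "?H (const_map M pc (c full)) \<cdot> hunit L pc X = hunit L pc Y \<cdot> c full"
    by (rule hunit_nat[OF idx ct])
  also have "?H tE \<cdot> (hunit L pc Y \<cdot> c full) = ?H tE \<cdot> hunit L pc Y \<cdot> c full"
    by (rule cmp_assoc[symmetric, OF ct uY hlim_hom[OF idx hE]])
  finally show ?thesis by (simp add: pE)
qed

lemma twisted_map_hom:
  assumes "twisted_cube_map \<sigma> D E c"
  shows "twisted_map \<sigma> D E c \<in> hom M (total_hofiber M z L n D) (total_hofiber M z L n E)"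
proof -
  note t = twisted_cube_mapD[OF assms]
  show ?thesis
    unfolding twisted_map_def total_hofiber_def
    by (rule hofiber_map_hom[OF punctured_map_hom[OF t(2)] punctured_map_hom[OF t(3)] t(6)
          twisted_punctured_map_hom[OF assms] twisted_square[OF assms]])
qed

text \<open>At S the composite runs from D at the image under
  \<open>\<sigma> \<circ> \<tau>\<close>, through E at the image under \<tau>, to G at S, which
  explains both the index permutation and the shifted argument of c. On homotopy limits, the
  restriction along \<tau> has to be moved past c before it can be merged with the restriction along
  \<sigma>.\<close>

lemma twisted_map_cmp:
  assumes c: "twisted_cube_map \<sigma> D E c" and d: "twisted_cube_map \<tau> E G d"
  shows "twisted_map \<tau> E G d \<cdot> twisted_map \<sigma> D E c =
    twisted_map (\<sigma> \<circ> \<tau>) D G (\<lambda>S. d S \<cdot> c (\<tau> ` S))"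
proof -
  note t = twisted_cube_mapD[OF c] and u = twisted_cube_mapD[OF d]
  have st: "\<sigma> \<circ> \<tau> permutes full" by (rule permutes_compose[OF u(1) t(1)])
  let ?H = "far (hlim L pc)" and ?r = "\<lambda>\<sigma>. hres L pc pc (image \<sigma>)" and ?R = "\<lambda>\<sigma>. reindex pc (image \<sigma>)"
  let ?I = "reindex pc id"
  let ?c = "ntr pc (?R \<sigma> D) (?I E) c" and ?d = "ntr pc (?R \<tau> E) (?I G) d"
  note hc = twisted_components_hom[OF c] and hd = twisted_components_hom[OF d]
  note mono = monotone_permutes(1)[OF u(1)]
  have rr: "?R \<tau> (?R \<sigma> D) = ?R (\<sigma> \<circ> \<tau>) D"
    unfolding reindex_reindex[OF mono] by (rule reindex_cong) (simp add: image_comp)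
  have m: "reindex_map pc (image \<tau>) ?c = ntr pc (?R (\<sigma> \<circ> \<tau>) D) (?R \<tau> E) (\<lambda>S. c (\<tau> ` S))"
    by (simp only: reindex_map_ntr[OF mono] rr reindex_image_id[OF u(1)])
  have hm: "ntr pc (?R (\<sigma> \<circ> \<tau>) D) (?R \<tau> E) (\<lambda>S. c (\<tau> ` S))
      \<in> hom (diagrams M pc) (?R (\<sigma> \<circ> \<tau>) D) (?R \<tau> E)"
  proof (rule ntr_diagram_hom[OF reindex_pc(2)[OF t(2) st] reindex_pc(2)[OF u(2) u(1)]])
    fix S assume "S \<in> pc"
    hence S: "S \<in> pc" "S \<in> cube n" "\<tau> ` S \<in> cube n"
      using image_cube[OF u(1)] punctured_cube_sub by blast+
    show "c (\<tau> ` S) \<in> hom M (fob (?R (\<sigma> \<circ> \<tau>) D) S) (fob (?R \<tau> E) S)"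
      using t(4)[OF S(3)] S(1) by (simp add: reindex_def image_comp)
    fix T assume "T \<in> pc" and ST: "T \<subseteq> S"
    hence T: "T \<in> pc" "T \<in> cube n" "\<tau> ` T \<in> cube n"
      using image_cube[OF u(1)] punctured_cube_sub by blast+
    show "c (\<tau> ` T) \<cdot> far (?R (\<sigma> \<circ> \<tau>) D) (S, T) = far (?R \<tau> E) (S, T) \<cdot> c (\<tau> ` S)"
      using t(5)[OF S(3) T(3) image_mono[OF ST]] S T ST
      by (simp add: reindex_def Arr_poset_cat image_comp)
  qed
  have r1: "?r \<sigma> (?I D) \<in> hom M (fob (hlim L pc) (?I D)) (fob (hlim L pc) (?R \<sigma> D))"
    by (rule hres_permute_hom[OF t(1,2)])
  have r2: "?r \<tau> (?I E) \<in> hom M (fob (hlim L pc) (?I E)) (fob (hlim L pc) (?R \<tau> E))"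
    by (rule hres_permute_hom[OF u(1,2)])
  have r3: "?r \<tau> (?R \<sigma> D) \<in> hom M (fob (hlim L pc) (?R \<sigma> D)) (fob (hlim L pc) (?R (\<sigma> \<circ> \<tau>) D))"
    using hres_hom[OF idx idx mono, of "?R \<sigma> D"] reindex_pc(2)[OF t(2,1)]
    by (simp add: Obj_fun_cat rr)
  have "twisted_punctured_map \<tau> E G d \<cdot> twisted_punctured_map \<sigma> D E c =
      ?H ?d \<cdot> ?r \<tau> (?I E) \<cdot> (?H ?c \<cdot> ?r \<sigma> (?I D))"
    by (simp add: twisted_punctured_map_def)
  also have "\<dots> = ?H ?d \<cdot> (?r \<tau> (?I E) \<cdot> (?H ?c \<cdot> ?r \<sigma> (?I D)))"
    by (rule cmp_assoc[OF cmp_hom[OF r1 hlim_hom[OF idx hc]] r2 hlim_hom[OF idx hd]])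
  also have "?r \<tau> (?I E) \<cdot> (?H ?c \<cdot> ?r \<sigma> (?I D)) = ?r \<tau> (?I E) \<cdot> ?H ?c \<cdot> ?r \<sigma> (?I D)"
    by (rule cmp_assoc[symmetric, OF r1 hlim_hom[OF idx hc] r2])
  \<comment> \<open>The interchange: passing the restriction along \<tau> reindexes the components
    of c.\<close>
  also have "?r \<tau> (?I E) \<cdot> ?H ?c = ?H (reindex_map pc (image \<tau>) ?c) \<cdot> ?r \<tau> (?R \<sigma> D)"
    by (rule hres_nat[OF idx idx mono hc])
  also have "?H (reindex_map pc (image \<tau>) ?c) \<cdot> ?r \<tau> (?R \<sigma> D) \<cdot> ?r \<sigma> (?I D) =
      ?H (reindex_map pc (image \<tau>) ?c) \<cdot> (?r \<tau> (?R \<sigma> D) \<cdot> ?r \<sigma> (?I D))"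
    unfolding m by (rule cmp_assoc[OF r1 r3 hlim_hom[OF idx hm]])
  \<comment> \<open>Strict functoriality of restriction in the indexing poset merges the two
    permutations.\<close>
  also have "?r \<tau> (?R \<sigma> D) \<cdot> ?r \<sigma> (?I D) = ?r (\<sigma> \<circ> \<tau>) (?I D)"
    using hres_cmp[OF idx idx idx monotone_permutes(1)[OF t(1)] mono, of "image (\<sigma> \<circ> \<tau>)" "?I D"]
      reindex_pc(1)[OF t(2)]
    by (simp add: Obj_fun_cat image_comp reindex_image_id[OF t(1)])
  also have "?H ?d \<cdot> (?H (reindex_map pc (image \<tau>) ?c) \<cdot> ?r (\<sigma> \<circ> \<tau>) (?I D)) =
      ?H ?d \<cdot> ?H (reindex_map pc (image \<tau>) ?c) \<cdot> ?r (\<sigma> \<circ> \<tau>) (?I D)"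
    unfolding m
    by (rule cmp_assoc[symmetric, OF hres_permute_hom[OF st t(2)] hlim_hom[OF idx hm] hlim_hom[OF idx hd]])
  also have "?H ?d \<cdot> ?H (reindex_map pc (image \<tau>) ?c) =
      ?H (ntr pc (?R (\<sigma> \<circ> \<tau>) D) (?I G) (\<lambda>S. d S \<cdot> c (\<tau> ` S)))"
    unfolding m by (rule hlim_cmp[OF idx hm hd])
  finally have tp: "twisted_punctured_map \<tau> E G d \<cdot> twisted_punctured_map \<sigma> D E c =
      twisted_punctured_map (\<sigma> \<circ> \<tau>) D G (\<lambda>S. d S \<cdot> c (\<tau> ` S))"
    by (simp only: twisted_punctured_map_def)
  \<comment> \<open>At the top vertex \<tau> fixes \<open>full\<close>, so the composite component
    there is \<open>d full\<close> after \<open>c full\<close>, as the composition law for homotopy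
    fibers demands.\<close>
  show ?thesis
    unfolding twisted_map_def tp[symmetric] permutes_image[OF u(1)]
    by (rule hofiber_map_cmp[OF punctured_map_hom[OF t(2)] punctured_map_hom[OF t(3)]
          punctured_map_hom[OF u(3)] t(6) twisted_punctured_map_hom[OF c] twisted_square[OF c]
          u(6) twisted_punctured_map_hom[OF d] twisted_square[OF d]])
qed

text \<open>Component families are ordinary functions on sets of naturals; a twisted map evaluates
  them only at the top vertex and, through a restricted function, on the punctured cube.\<close>

lemma twisted_map_cong:
  assumes "\<And>S. S \<in> cube n \<Longrightarrow> c S = c' S"
  shows "twisted_map \<sigma> D E c = twisted_map \<sigma> D E c'"
proof -
  have "ntr pc D' E' c = ntr pc D' E' c'" for D' E'
    by (rule ntr_cong) (use assms punctured_cube_sub in blast)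
  thus ?thesis using assms[OF top_cube] by (simp add: twisted_map_def twisted_punctured_map_def)
qed

lemma hres_image_id:
  assumes D: "D \<in> cubes"
  shows "hres L pc pc (image id) (reindex pc id D) = Idn M (fob (hlim L pc) (reindex pc id D))"
  by (rule hres_id[OF idx]) (use reindex_pc(1)[OF D] in \<open>auto simp: Obj_fun_cat\<close>)

lemma twisted_map_id:
  assumes D: "D \<in> cubes"
  shows "twisted_map id D D (\<lambda>S. Idn M (fob D S)) = Idn M (total_hofiber M z L n D)"
proof -
  have im: "image id = (id :: nat set \<Rightarrow> nat set)" by auto
  have "far (hlim L pc) (ntr pc (reindex pc id D) (reindex pc id D) (\<lambda>S. Idn M (fob D S))) =
      Idn M (fob (hlim L pc) (reindex pc id D))"
    by (rule hlim_id[OF idx reindex_pc(1)[OF D]]) (simp add: reindex_def)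
  hence "twisted_punctured_map id D D (\<lambda>S. Idn M (fob D S)) =
      Idn M (fob (hlim L pc) (reindex pc id D))"
    using hres_image_id[OF D] id_left[OF id_hom[OF hlim_obj[OF idx reindex_pc(1)[OF D]]]]
    by (simp add: twisted_punctured_map_def im)
  thus ?thesis
    using hofiber_map_id[OF punctured_map_hom[OF D]] by (simp add: twisted_map_def total_hofiber_def)
qed

text \<open>For \<sigma> = \<open>id\<close> the restriction factor is an identity by
  \<open>hres_id\<close>, which leaves exactly the map of homotopy limits in the definition.\<close>

lemma total_hofiber_map_eq_twisted:
  assumes "twisted_cube_map id D E c"
  shows "total_hofiber_map M z L n (ntr (cube n) D E c) = twisted_map id D E c"
proof -
  note t = twisted_cube_mapD[OF assms]
  have im: "image id = (id :: nat set \<Rightarrow> nat set)" by auto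
  have "far (hlim L pc) (ntr pc (reindex pc id D) (reindex pc id E) c) = twisted_punctured_map id D E c"
    unfolding twisted_punctured_map_def hres_image_id[OF t(2)]
    using id_right[OF hlim_hom[OF idx twisted_components_hom[OF assms]]] by (simp add: im)
  thus ?thesis
    by (simp add: total_hofiber_map_def twisted_map_def reindex_map_ntr[OF monotone_punctured_id] top_cube)
qed

text \<open>The preimage under \<sigma> of the image of S is S, so the reindexed cube takes the
  value of D at S on the image of S, and identities have the right type.\<close>

lemma twisted_cube_map_relabel:
  assumes \<sigma>: "\<sigma> permutes full" and D: "D \<in> cubes"
  shows "twisted_cube_map \<sigma> (reindex (cube n) (vimage \<sigma>) D) D (\<lambda>S. Idn M (fob D S))"
proof -
  have vi: "vimage \<sigma> = image (inv \<sigma>)" by (rule ext) (rule vimage_permutes[OF \<sigma>])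
  have iv: "\<sigma> -` \<sigma> ` S = S" for S by (rule inj_vimage_image_eq[OF permutes_inj[OF \<sigma>]])
  have "reindex (cube n) (vimage \<sigma>) D \<in> cubes"
    unfolding vi
    by (rule reindex_diagram[OF category_axioms D monotone_permutes(3)[OF permutes_inv[OF \<sigma>]]])
  moreover have "fob D S \<in> Obj M" if "S \<in> cube n" for S using functor_obj[OF D] that by simp
  ultimately show ?thesis
    using \<sigma> D id_hom diagram_hom[OF D] id_left[OF diagram_hom[OF D]] id_right[OF diagram_hom[OF D]]
    by (auto simp: twisted_cube_map_def reindex_def Arr_poset_cat image_cube[OF \<sigma>] iv image_mono)
qed

text \<open>Complementary to the case of ordinary maps: the map of diagrams is now an identity and
  only the restriction remains. The definition reindexes D directly to the punctured cube, the
  twisted form goes through the full cube; the two diagrams coincide.\<close>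

lemma total_hofiber_relabel_eq_twisted:
  assumes \<sigma>: "\<sigma> permutes full" and D: "D \<in> cubes"
  shows "total_hofiber_relabel M z L n (vimage \<sigma>) (image \<sigma>) D =
    twisted_map \<sigma> (reindex (cube n) (vimage \<sigma>) D) D (\<lambda>S. Idn M (fob D S))"
proof -
  let ?D = "reindex (cube n) (vimage \<sigma>) D"
  have t: "twisted_cube_map \<sigma> ?D D (\<lambda>S. Idn M (fob D S))" by (rule twisted_cube_map_relabel[OF assms])
  have r: "reindex pc (vimage \<sigma>) D = reindex pc id ?D"
    using reindex_reindex[OF monotone_punctured_id, of n "vimage \<sigma>" D] by simp
  have iv: "\<sigma> -` \<sigma> ` S = S" for S by (rule inj_vimage_image_eq[OF permutes_inj[OF \<sigma>]])
  have rD: "reindex pc (image \<sigma>) ?D = reindex pc id D"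
    unfolding reindex_reindex[OF monotone_permutes(2)[OF \<sigma>]] by (rule reindex_cong) (simp add: iv)
  have "far (hlim L pc) (ntr pc (reindex pc id D) (reindex pc id D) (\<lambda>S. Idn M (fob D S))) =
      Idn M (fob (hlim L pc) (reindex pc id D))"
    by (rule hlim_id[OF idx reindex_pc(1)[OF D]]) (simp add: reindex_def)
  hence "twisted_punctured_map \<sigma> ?D D (\<lambda>S. Idn M (fob D S)) = hres L pc pc (image \<sigma>) (reindex pc id ?D)"
    using id_left[OF hres_permute_hom[OF \<sigma> twisted_cube_mapD(2)[OF t]]]
    by (simp add: twisted_punctured_map_def rD)
  thus ?thesis by (simp add: total_hofiber_relabel_def twisted_map_def r)
qed

end

end


section \<open>Maps between coproducts\<close>

locale pointed_category = category C
  for C :: "('a, 'b, 'z) cat_scheme" (structure) +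
  fixes K :: "('a, 'b) coprods"
  assumes pointed: "pointed_with_coproducts C K"
begin

lemma zob: "zero_object C (zob K)"
  using pointed by (simp add: pointed_with_coproducts_def)

lemma zob_obj: "zob K \<in> Obj C"
  using zob by (simp add: zero_object_def)

lemma to_zob: "X \<in> Obj C \<Longrightarrow> (THE f. f \<in> hom C X (zob K)) \<in> hom C X (zob K)"
  by (rule theI') (use zob in \<open>simp add: zero_object_def\<close>)

lemma from_zob: "X \<in> Obj C \<Longrightarrow> (THE f. f \<in> hom C (zob K) X) \<in> hom C (zob K) X"
  by (rule theI') (use zob in \<open>simp add: zero_object_def\<close>)

lemma to_zob_eq: "f \<in> hom C X (zob K) \<Longrightarrow> g \<in> hom C X (zob K) \<Longrightarrow> f = g"
  using zob hom_obj[of f X "zob K"] unfolding zero_object_def by metis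

lemma from_zob_eq: "f \<in> hom C (zob K) X \<Longrightarrow> g \<in> hom C (zob K) X \<Longrightarrow> f = g"
  using zob hom_obj[of f "zob K" X] unfolding zero_object_def by metis

lemma zero_arr_hom: "X \<in> Obj C \<Longrightarrow> Y \<in> Obj C \<Longrightarrow> zero_arr C K X Y \<in> hom C X Y"
  unfolding zero_arr_def by (rule cmp_hom[OF to_zob from_zob])

lemma cmp_zero_arr:
  assumes "X \<in> Obj C" "g \<in> hom C Y Z"
  shows "g \<cdot> zero_arr C K X Y = zero_arr C K X Z"
proof -
  note Y = hom_obj[OF assms(2), THEN conjunct1] and Z = hom_obj[OF assms(2), THEN conjunct2]
  have "g \<cdot> (THE f. f \<in> hom C (zob K) Y) = (THE f. f \<in> hom C (zob K) Z)"
    by (rule from_zob_eq[OF cmp_hom[OF from_zob[OF Y] assms(2)] from_zob[OF Z]])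
  thus ?thesis
    unfolding zero_arr_def
    using cmp_assoc[OF to_zob[OF assms(1)] from_zob[OF Y] assms(2)] by simp
qed

lemma zero_arr_cmp:
  assumes "f \<in> hom C X Y" "Z \<in> Obj C"
  shows "zero_arr C K Y Z \<cdot> f = zero_arr C K X Z"
proof -
  note X = hom_obj[OF assms(1), THEN conjunct1] and Y = hom_obj[OF assms(1), THEN conjunct2]
  have "(THE f. f \<in> hom C Y (zob K)) \<cdot> f = (THE f. f \<in> hom C X (zob K))"
    by (rule to_zob_eq[OF cmp_hom[OF assms(1) to_zob[OF Y]] to_zob[OF X]])
  thus ?thesis
    unfolding zero_arr_def
    using cmp_assoc[OF assms(1) to_zob[OF Y] from_zob[OF assms(2)]] by simp
qed

section \<open>Maps out of finite coproducts\<close>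

definition family :: "nat set \<Rightarrow> (nat \<Rightarrow> 'a) \<Rightarrow> bool" where
  "family S A \<longleftrightarrow> finite S \<and> (\<forall>i\<in>S. A i \<in> Obj C)"

lemma coproduct_cop: "family S A \<Longrightarrow> coproduct C S A (cinj K S A) (cop K S A)"
  using pointed by (auto simp: pointed_with_coproducts_def family_def)

lemma cop_obj: "family S A \<Longrightarrow> cop K S A \<in> Obj C"
  using coproduct_cop[of S A] by (simp add: coproduct_def)

lemma cinj_hom: "family S A \<Longrightarrow> i \<in> S \<Longrightarrow> cinj K S A i \<in> hom C (A i) (cop K S A)"
  using coproduct_cop[of S A] by (simp add: coproduct_def)

lemma copair_unique:
  assumes "family S A" "Y \<in> Obj C" "\<And>i. i \<in> S \<Longrightarrow> f i \<in> hom C (A i) Y"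
  shows "\<exists>!h. h \<in> hom C (cop K S A) Y \<and> (\<forall>i\<in>S. h \<cdot> cinj K S A i = f i)"
  using coproduct_cop[OF assms(1)] assms(2,3) unfolding coproduct_def by blast

lemma copair_hom:
  assumes "family S A" "Y \<in> Obj C" "\<And>i. i \<in> S \<Longrightarrow> f i \<in> hom C (A i) Y"
  shows "copair C K S A Y f \<in> hom C (cop K S A) Y"
  using theI'[OF copair_unique[OF assms]] by (simp add: copair_def)

lemma copair_cinj:
  assumes "family S A" "Y \<in> Obj C" "\<And>i. i \<in> S \<Longrightarrow> f i \<in> hom C (A i) Y" "i \<in> S"
  shows "copair C K S A Y f \<cdot> cinj K S A i = f i"
  using theI'[OF copair_unique[OF assms(1-3)]] assms(4) by (simp add: copair_def)

lemma copair_cong: "(\<And>i. i \<in> S \<Longrightarrow> f i = g i) \<Longrightarrow> copair C K S A Y f = copair C K S A Y g"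
  by (simp add: copair_def)

lemma cop_arrow_eqI:
  assumes A: "family S A" and h: "h \<in> hom C (cop K S A) Y" and h': "h' \<in> hom C (cop K S A) Y"
    and eq: "\<And>i. i \<in> S \<Longrightarrow> h \<cdot> cinj K S A i = h' \<cdot> cinj K S A i"
  shows "h = h'"
proof -
  have "h' \<cdot> cinj K S A i \<in> hom C (A i) Y" if "i \<in> S" for i
    by (rule cmp_hom[OF cinj_hom[OF A that] h'])
  from copair_unique[OF A hom_obj[OF h, THEN conjunct2] this] h h' eq show ?thesis by metis
qed

text \<open>The map that sends summand \<open>i\<close> to summand \<open>p i\<close> by \<open>f i\<close>, or to zero if \<open>p i\<close> lies outside the
  target index set. Collapses, coproducts of maps and permutations of summands are all of this form,
  so that the single composition law below covers their interaction.\<close>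
definition summand_map ::
  "nat set \<Rightarrow> (nat \<Rightarrow> 'a) \<Rightarrow> nat set \<Rightarrow> (nat \<Rightarrow> 'a) \<Rightarrow> (nat \<Rightarrow> nat) \<Rightarrow> (nat \<Rightarrow> 'b) \<Rightarrow> 'b" where
  "summand_map S A T B p f = copair C K S A (cop K T B)
     (\<lambda>i. if p i \<in> T then cinj K T B (p i) \<cdot> f i else zero_arr C K (A i) (cop K T B))"

lemma summand_map_component:
  assumes "family S A" "family T B" "\<And>i. i \<in> S \<Longrightarrow> p i \<in> T \<Longrightarrow> f i \<in> hom C (A i) (B (p i))" "i \<in> S"
  shows "(if p i \<in> T then cinj K T B (p i) \<cdot> f i else zero_arr C K (A i) (cop K T B))
    \<in> hom C (A i) (cop K T B)"
proof (cases "p i \<in> T")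
  case True
  thus ?thesis using cmp_hom[OF assms(3)[OF assms(4)] cinj_hom[OF assms(2)]] by simp
next
  case False
  thus ?thesis using zero_arr_hom[OF _ cop_obj[OF assms(2)]] assms(1,4) by (simp add: family_def)
qed

lemma summand_map_hom:
  assumes "family S A" "family T B" "\<And>i. i \<in> S \<Longrightarrow> p i \<in> T \<Longrightarrow> f i \<in> hom C (A i) (B (p i))"
  shows "summand_map S A T B p f \<in> hom C (cop K S A) (cop K T B)"
  unfolding summand_map_def
  by (rule copair_hom[OF assms(1) cop_obj[OF assms(2)] summand_map_component[OF assms]])

lemma summand_map_cinj:
  assumes "family S A" "family T B" "\<And>i. i \<in> S \<Longrightarrow> p i \<in> T \<Longrightarrow> f i \<in> hom C (A i) (B (p i))" "i \<in> S"
  shows "summand_map S A T B p f \<cdot> cinj K S A i =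
    (if p i \<in> T then cinj K T B (p i) \<cdot> f i else zero_arr C K (A i) (cop K T B))"
  unfolding summand_map_def
  by (rule copair_cinj[OF assms(1) cop_obj[OF assms(2)] summand_map_component[OF assms(1-3)] assms(4)])

lemma summand_map_cong:
  assumes "\<And>i. i \<in> S \<Longrightarrow> p i = q i" "\<And>i. i \<in> S \<Longrightarrow> q i \<in> T \<Longrightarrow> f i = g i"
  shows "summand_map S A T B p f = summand_map S A T B q g"
  unfolding summand_map_def by (rule copair_cong) (use assms in auto)

lemma summand_map_id:
  assumes "family S A"
  shows "summand_map S A S A (\<lambda>i. i) (\<lambda>i. Idn C (A i)) = Idn C (cop K S A)"
proof (rule cop_arrow_eqI[OF assms _ id_hom[OF cop_obj[OF assms]]])
  have f: "Idn C (A i) \<in> hom C (A i) (A i)" if "i \<in> S" for i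
    using assms that by (auto simp: family_def intro: id_hom)
  show "summand_map S A S A (\<lambda>i. i) (\<lambda>i. Idn C (A i)) \<in> hom C (cop K S A) (cop K S A)"
    by (rule summand_map_hom[OF assms assms f])
  fix i assume i: "i \<in> S"
  show "summand_map S A S A (\<lambda>i. i) (\<lambda>i. Idn C (A i)) \<cdot> cinj K S A i =
      Idn C (cop K S A) \<cdot> cinj K S A i"
    using summand_map_cinj[OF assms assms f i] i
    by (simp add: id_left[OF cinj_hom[OF assms i]] id_right[OF cinj_hom[OF assms i]])
qed

text \<open>Hypothesis \<open>pq\<close> is what makes the formula true: a summand with
  \<open>p i\<close> outside T is already sent to zero, so \<open>q (p i)\<close> must not point
  into U, where the right-hand side would use \<open>g (p i) \<cdot> f i\<close> instead of
  zero.\<close>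

lemma summand_map_cmp:
  assumes A: "family S A" and B: "family T B" and D: "family U D"
    and f: "\<And>i. i \<in> S \<Longrightarrow> p i \<in> T \<Longrightarrow> f i \<in> hom C (A i) (B (p i))"
    and g: "\<And>i. i \<in> T \<Longrightarrow> q i \<in> U \<Longrightarrow> g i \<in> hom C (B i) (D (q i))"
    and pq: "\<And>i. i \<in> S \<Longrightarrow> q (p i) \<in> U \<Longrightarrow> p i \<in> T"
  shows "summand_map T B U D q g \<cdot> summand_map S A T B p f =
    summand_map S A U D (\<lambda>i. q (p i)) (\<lambda>i. g (p i) \<cdot> f i)"
proof (rule cop_arrow_eqI[OF A])
  let ?f = "summand_map S A T B p f" and ?g = "summand_map T B U D q g"
    and ?h = "summand_map S A U D (\<lambda>i. q (p i)) (\<lambda>i. g (p i) \<cdot> f i)"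
  have fh: "?f \<in> hom C (cop K S A) (cop K T B)" by (rule summand_map_hom[OF A B f])
  have gh: "?g \<in> hom C (cop K T B) (cop K U D)" by (rule summand_map_hom[OF B D g])
  have gf: "g (p i) \<cdot> f i \<in> hom C (A i) (D (q (p i)))" if "i \<in> S" "q (p i) \<in> U" for i
    by (rule cmp_hom[OF f g]) (use that pq in auto)
  show "?g \<cdot> ?f \<in> hom C (cop K S A) (cop K U D)" by (rule cmp_hom[OF fh gh])
  show "?h \<in> hom C (cop K S A) (cop K U D)" by (rule summand_map_hom[OF A D gf])
  fix i assume i: "i \<in> S"
  have Ai: "A i \<in> Obj C" using A i by (simp add: family_def)
  have "?g \<cdot> ?f \<cdot> cinj K S A i = ?g \<cdot> (?f \<cdot> cinj K S A i)"
    by (rule cmp_assoc[OF cinj_hom[OF A i] fh gh])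
  also have "\<dots> = (if q (p i) \<in> U then cinj K U D (q (p i)) \<cdot> (g (p i) \<cdot> f i)
      else zero_arr C K (A i) (cop K U D))"
  proof (cases "p i \<in> T")
    case True
    note fi = f[OF i True]
    have "?g \<cdot> (?f \<cdot> cinj K S A i) = ?g \<cdot> (cinj K T B (p i) \<cdot> f i)"
      using summand_map_cinj[OF A B f i] True by simp
    also have "\<dots> = ?g \<cdot> cinj K T B (p i) \<cdot> f i"
      by (rule cmp_assoc[symmetric, OF fi cinj_hom[OF B True] gh])
    also have "?g \<cdot> cinj K T B (p i) = (if q (p i) \<in> U then cinj K U D (q (p i)) \<cdot> g (p i)
        else zero_arr C K (B (p i)) (cop K U D))"
      by (rule summand_map_cinj[OF B D g True])
    finally show ?thesis
      using cmp_assoc[OF fi g[OF True] cinj_hom[OF D]] zero_arr_cmp[OF fi cop_obj[OF D]] by simp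
  \<comment> \<open>Here the first map is zero on summand i, and by the contrapositive of
    \<open>pq\<close> the right-hand side is zero there as well.\<close>
  next
    case False
    thus ?thesis
      using summand_map_cinj[OF A B f i] cmp_zero_arr[OF Ai gh] pq[OF i] by auto
  qed
  also have "\<dots> = ?h \<cdot> cinj K S A i"
    by (rule summand_map_cinj[symmetric, OF A D gf i])
  finally show "?g \<cdot> ?f \<cdot> cinj K S A i = ?h \<cdot> cinj K S A i" .
qed

lemma collapse_eq:
  assumes "family T A"
  shows "collapse C K A S T = summand_map S A T A (\<lambda>i. i) (\<lambda>i. Idn C (A i))"
  unfolding collapse_def summand_map_def
  by (rule copair_cong) (simp add: id_right[OF cinj_hom[OF assms]])

lemma cop_map_eq: "cop_map C K S A B f = summand_map S A S B (\<lambda>i. i) f"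
  unfolding cop_map_def summand_map_def by (rule copair_cong) simp

end


section \<open>Permutations of inputs\<close>

lemma permute_tuple_apply [simp]: "i \<in> {1..n} \<Longrightarrow> permute_tuple n \<sigma> A i = A (\<sigma> i)"
  by (simp add: permute_tuple_def)

lemma permute_tuple_ext: "permute_tuple n \<sigma> A \<in> extensional {1..n}"
  by (simp add: permute_tuple_def)

lemma permutes_in: "\<sigma> permutes {1..n} \<Longrightarrow> i \<in> {1..n} \<Longrightarrow> \<sigma> i \<in> {1..n}"
  by (simp only: permutes_in_image)

text \<open>Permuting inputs is precomposition, hence a right action; this is the source of the
  order of factors in the composition law for the action.\<close>

lemma permute_tuple_permute_tuple:
  "\<tau> permutes {1..n} \<Longrightarrow> permute_tuple n \<tau> (permute_tuple n \<sigma> A) = permute_tuple n (\<sigma> \<circ> \<tau>) A"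
  unfolding permute_tuple_def by (rule restrict_ext) (simp add: permutes_in del: atLeastAtMost_iff)

lemma permute_tuple_id: "A \<in> extensional {1..n} \<Longrightarrow> permute_tuple n id A = A"
  by (rule extensionalityI[OF permute_tuple_ext]) auto

lemma pow_obj_ext: "A \<in> Obj (pow_cat C n) \<Longrightarrow> A \<in> extensional {1..n}"
  by (simp add: Obj_pow_cat PiE_def)

lemma pow_objD: "A \<in> Obj (pow_cat C n) \<Longrightarrow> i \<in> {1..n} \<Longrightarrow> A i \<in> Obj C"
  by (auto simp: Obj_pow_cat PiE_iff)

lemma permute_tuple_obj:
  "\<sigma> permutes {1..n} \<Longrightarrow> A \<in> Obj (pow_cat C n) \<Longrightarrow> permute_tuple n \<sigma> A \<in> Obj (pow_cat C n)"
  using permutes_in[of \<sigma> n] by (auto simp: Obj_pow_cat PiE_iff permute_tuple_def)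

lemma permute_tuple_hom:
  assumes "\<sigma> permutes {1..n}" "f \<in> hom (pow_cat C n) A B"
  shows "permute_tuple n \<sigma> f \<in> hom (pow_cat C n) (permute_tuple n \<sigma> A) (permute_tuple n \<sigma> B)"
  unfolding hom_pow_cat[OF permute_tuple_ext permute_tuple_ext]
  using hom_pow_catE(4)[OF assms(2) permutes_in[OF assms(1)]] by (simp add: permute_tuple_ext)

lemma permute_tuple_Idn:
  "\<sigma> permutes {1..n} \<Longrightarrow>
    permute_tuple n \<sigma> (Idn (pow_cat C n) A) = Idn (pow_cat C n) (permute_tuple n \<sigma> A)"
  by (auto simp: permute_tuple_def pow_cat_def permutes_in simp del: atLeastAtMost_iff intro!: restrict_ext)

lemma permute_tuple_Cmp:
  "\<sigma> permutes {1..n} \<Longrightarrow> permute_tuple n \<sigma> (Cmp (pow_cat C n) g f) =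
    Cmp (pow_cat C n) (permute_tuple n \<sigma> g) (permute_tuple n \<sigma> f)"
  by (auto simp: permute_tuple_def pow_cat_def permutes_in simp del: atLeastAtMost_iff intro!: restrict_ext)

text \<open>Position j of the permuted tuple shows the entry \<sigma> j, so the entry i is seen at
  position \<open>inv \<sigma> i\<close>.\<close>

lemma permute_tuple_upd:
  assumes "\<sigma> permutes {1..n}" "i \<in> {1..n}"
  shows "permute_tuple n \<sigma> (A(i := x)) = (permute_tuple n \<sigma> A)(inv \<sigma> i := x)"
proof (rule extensionalityI[OF permute_tuple_ext])
  have i: "inv \<sigma> i \<in> {1..n}" by (rule permutes_in[OF permutes_inv[OF assms(1)] assms(2)])
  thus "(permute_tuple n \<sigma> A)(inv \<sigma> i := x) \<in> extensional {1..n}"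
    by (auto simp: permute_tuple_def extensional_def)
  fix j assume "j \<in> {1..n}"
  thus "permute_tuple n \<sigma> (A(i := x)) j = ((permute_tuple n \<sigma> A)(inv \<sigma> i := x)) j"
    using permutes_inverses[OF assms(1)] by auto
qed

lemma permute_tuple_slot:
  assumes "\<sigma> permutes {1..n}" "i \<in> {1..n}"
  shows "permute_tuple n \<sigma> (slot C n A i f) = slot C n (permute_tuple n \<sigma> A) (inv \<sigma> i) f"
proof -
  have "permute_tuple n \<sigma> (\<lambda>k\<in>{1..n}. Idn C (A k)) = (\<lambda>k\<in>{1..n}. Idn C (permute_tuple n \<sigma> A k))"
    unfolding permute_tuple_def by (rule restrict_ext) (simp add: permutes_in[OF assms(1)] del: atLeastAtMost_iff)
  thus ?thesis unfolding slot_def permute_tuple_upd[OF assms] by simp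
qed

lemma permute_inputs_functor:
  assumes C: "category C" and M: "category M" and \<sigma>: "\<sigma> permutes {1..n}"
    and G: "G \<in> functors (pow_cat C n) M"
  shows "permute_inputs C n \<sigma> G \<in> functors (pow_cat C n) M"
proof -
  interpret P: category "pow_cat C n" by (rule pow_cat_category[OF C])
  show ?thesis
  proof (rule functorI[OF P.category_axioms M])
    show "fob (permute_inputs C n \<sigma> G) \<in> extensional (Obj (pow_cat C n))"
      "far (permute_inputs C n \<sigma> G) \<in> extensional (Arr (pow_cat C n))"
      by (simp_all add: permute_inputs_def)
  next
    fix A assume A: "A \<in> Obj (pow_cat C n)"
    show "fob (permute_inputs C n \<sigma> G) A \<in> Obj M"
      using A functor_obj[OF G permute_tuple_obj[OF \<sigma> A]] by (simp add: permute_inputs_def)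
    show "far (permute_inputs C n \<sigma> G) (Idn (pow_cat C n) A) =
        Idn M (fob (permute_inputs C n \<sigma> G) A)"
      using A functor_id[OF G permute_tuple_obj[OF \<sigma> A]] P.id_arr[OF A]
      by (simp add: permute_inputs_def permute_tuple_Idn[OF \<sigma>])
  next
    fix A B f assume f: "f \<in> hom (pow_cat C n) A B"
    show "far (permute_inputs C n \<sigma> G) f
        \<in> hom M (fob (permute_inputs C n \<sigma> G) A) (fob (permute_inputs C n \<sigma> G) B)"
      using functor_hom[OF G permute_tuple_hom[OF \<sigma> f]] P.hom_obj[OF f] f
      by (auto simp: permute_inputs_def elim: homE)
    fix D g assume g: "g \<in> hom (pow_cat C n) B D"
    show "far (permute_inputs C n \<sigma> G) (Cmp (pow_cat C n) g f) =
        Cmp M (far (permute_inputs C n \<sigma> G) g) (far (permute_inputs C n \<sigma> G) f)"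
      using functor_cmp[OF G permute_tuple_hom[OF \<sigma> f] permute_tuple_hom[OF \<sigma> g]]
        P.cmp_hom[OF f g] f g
      by (auto simp: permute_inputs_def permute_tuple_Cmp[OF \<sigma>] elim!: homE)
  qed
qed

section \<open>Multilinearity and symmetric sequences from components\<close>

lemma coproduct_cong:
  assumes "coproduct C I X ins T" "\<And>i. i \<in> I \<Longrightarrow> X i = Y i" "\<And>i. i \<in> I \<Longrightarrow> ins i = ins' i"
  shows "coproduct C I Y ins' T"
  using assms unfolding coproduct_def by (simp cong: ball_cong)

lemma permute_inputs_separately_linear:
  assumes C: "category C" and \<sigma>: "\<sigma> permutes {1..n}" and G: "separately_linear C M W n G"
  shows "separately_linear C M W n (permute_inputs C n \<sigma> G)"
  unfolding separately_linear_def
proof (intro ballI allI impI, elim conjE)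
  fix i V A and I :: "nat set" and B ins T
  assume i: "i \<in> {1..n}" and V: "V \<in> Obj M" and A: "A \<in> Obj (pow_cat C n)" and I: "finite I"
    and cop: "coproduct C I B ins T"
  let ?k = "inv \<sigma> i" and ?A = "permute_tuple n \<sigma> A" and ?G = "permute_inputs C n \<sigma> G"
  have k: "?k \<in> {1..n}" by (rule permutes_in[OF permutes_inv[OF \<sigma>] i])
  have ob: "fob ?G (A(i := x)) = fob G (?A(?k := x))" if "x \<in> Obj C" for x
  proof -
    have "A(i := x) \<in> Obj (pow_cat C n)"
      using A i that by (auto simp: Obj_pow_cat PiE_iff extensional_def)
    thus ?thesis by (simp add: permute_inputs_def permute_tuple_upd[OF \<sigma> i])
  qed
  have ar: "far ?G (slot C n A i f) = far G (slot C n ?A ?k f)" if "f \<in> Arr C" for f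
  proof -
    have "Idn C (A j) \<in> Arr C" if "j \<in> {1..n}" for j
      using category.id_arr[OF C pow_objD[OF A that]] .
    hence "slot C n A i f \<in> Arr (pow_cat C n)"
      using i that by (auto simp: Arr_pow_cat PiE_iff slot_def extensional_def)
    thus ?thesis by (simp add: permute_inputs_def permute_tuple_slot[OF \<sigma> i])
  qed
  \<comment> \<open>The permuted functor is specified only on genuine tuples of objects and arrows,
    so \<open>ob\<close> and \<open>ar\<close> apply to the data of the coproduct only after this
    check.\<close>
  have BT: "T \<in> Obj C" "\<And>j. j \<in> I \<Longrightarrow> B j \<in> Obj C \<and> ins j \<in> Arr C"
    using cop by (auto simp: coproduct_def hom_def)
  have "coproduct (loc_cat M W) I (\<lambda>j. V \<otimes>\<^bsub>M\<^esub> fob G (?A(?k := B j)))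
      (\<lambda>j. loc_arr M W (Idn M V \<odot>\<^bsub>M\<^esub> far G (slot C n ?A ?k (ins j))))
      (V \<otimes>\<^bsub>M\<^esub> fob G (?A(?k := T)))"
    using G k V permute_tuple_obj[OF \<sigma> A] I cop unfolding separately_linear_def by blast
  thus "coproduct (loc_cat M W) I (\<lambda>j. V \<otimes>\<^bsub>M\<^esub> fob ?G (A(i := B j)))
      (\<lambda>j. loc_arr M W (Idn M V \<odot>\<^bsub>M\<^esub> far ?G (slot C n A i (ins j))))
      (V \<otimes>\<^bsub>M\<^esub> fob ?G (A(i := T)))"
    unfolding ob[OF BT(1)] by (rule coproduct_cong) (use BT(2) ob ar in auto)
qed

lemma permute_inputs_multilinear:
  "category C \<Longrightarrow> category M \<Longrightarrow> \<sigma> permutes {1..n} \<Longrightarrow> G \<in> multilinear_functors C M W n \<Longrightarrow>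
    permute_inputs C n \<sigma> G \<in> multilinear_functors C M W n"
  by (simp add: multilinear_functors_def permute_inputs_functor permute_inputs_separately_linear)

lemma permute_inputs_id:
  assumes "category C" "G \<in> functors (pow_cat C n) M"
  shows "permute_inputs C n id G = G"
proof (rule functor_eqI)
  show "fob G \<in> extensional (Obj (pow_cat C n))" "far G \<in> extensional (Arr (pow_cat C n))"
    using functor_ext[OF assms(2)] by auto
qed (auto simp: permute_inputs_def permute_tuple_id pow_obj_ext Arr_pow_cat PiE_def)

lemma hom_multilinear_cat:
  "t \<in> hom (multilinear_cat C M W n) G H \<longleftrightarrow>
    t \<in> hom (fun_cat (pow_cat C n) M) G H \<and> G \<in> multilinear_functors C M W n \<and>
    H \<in> multilinear_functors C M W n"
  by (auto simp: multilinear_cat_def full_subcat_def hom_def)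

text \<open>Invertibility does not appear among the premises on components: it follows from the unit
  and composition laws, the inverse of the action of \<sigma> at A being the action of
  \<open>inv \<sigma>\<close> at the permuted tuple.\<close>

lemma symmetric_sequenceI:
  assumes C: "category C" and M: "category M"
    and X: "\<And>n. X n \<in> multilinear_functors C M W n"
    and act: "\<And>n \<sigma>. \<sigma> permutes {1..n} \<Longrightarrow>
      act n \<sigma> = ntr (Obj (pow_cat C n)) (X n) (permute_inputs C n \<sigma> (X n)) (a n \<sigma>)"
    and a_hom: "\<And>n \<sigma> A. \<sigma> permutes {1..n} \<Longrightarrow> A \<in> Obj (pow_cat C n) \<Longrightarrow>
      a n \<sigma> A \<in> hom M (fob (X n) A) (fob (X n) (permute_tuple n \<sigma> A))"
    and a_nat: "\<And>n \<sigma> A B f. \<sigma> permutes {1..n} \<Longrightarrow> f \<in> hom (pow_cat C n) A B \<Longrightarrow>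
      Cmp M (a n \<sigma> B) (far (X n) f) = Cmp M (far (X n) (permute_tuple n \<sigma> f)) (a n \<sigma> A)"
    and a_id: "\<And>n A. A \<in> Obj (pow_cat C n) \<Longrightarrow> a n id A = Idn M (fob (X n) A)"
    and a_cmp: "\<And>n \<sigma> \<tau> A. \<sigma> permutes {1..n} \<Longrightarrow> \<tau> permutes {1..n} \<Longrightarrow> A \<in> Obj (pow_cat C n) \<Longrightarrow>
      a n (\<sigma> \<circ> \<tau>) A = Cmp M (a n \<tau> (permute_tuple n \<sigma> A)) (a n \<sigma> A)"
  shows "symmetric_sequence C M W X act"
  unfolding symmetric_sequence_def
proof (intro allI conjI impI ballI)
  fix n
  interpret P: category "pow_cat C n" by (rule pow_cat_category[OF C])
  let ?O = "Obj (pow_cat C n)" and ?Q = "\<lambda>\<sigma>. permute_inputs C n \<sigma> (X n)"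
  have Xf: "X n \<in> functors (pow_cat C n) M" using X[of n] by (simp add: multilinear_functors_def)
  show "X n \<in> Obj (multilinear_cat C M W n)"
    using X Xf by (simp add: multilinear_cat_def full_subcat_def Obj_fun_cat)
  have "act n id = ntr ?O (X n) (X n) (\<lambda>A. Idn M (fob (X n) A))"
    unfolding act[OF permutes_id] permute_inputs_id[OF C Xf] by (rule ntr_cong) (rule a_id)
  thus "act n id = Idn (multilinear_cat C M W n) (X n)"
    by (simp add: multilinear_cat_def full_subcat_def ntr_id)
  fix \<sigma> assume \<sigma>: "\<sigma> permutes {1..n}"
  note Q = permute_inputs_multilinear[OF C M \<sigma> X[of n]]
  note Qf = permute_inputs_functor[OF C M \<sigma> Xf]
  note pi = permutes_inv[OF \<sigma>]
  have act_hom: "act n \<sigma> \<in> hom (fun_cat (pow_cat C n) M) (X n) (?Q \<sigma>)"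
    unfolding act[OF \<sigma>]
  proof (rule ntr_hom[OF P.category_axioms Xf Qf])
    fix A assume A: "A \<in> ?O"
    show "a n \<sigma> A \<in> hom M (fob (X n) A) (fob (?Q \<sigma>) A)"
      using a_hom[OF \<sigma> A] A by (simp add: permute_inputs_def)
  next
    fix A B f assume f: "f \<in> hom (pow_cat C n) A B"
    show "Cmp M (a n \<sigma> B) (far (X n) f) = Cmp M (far (?Q \<sigma>) f) (a n \<sigma> A)"
      using a_nat[OF \<sigma> f] f by (auto simp: permute_inputs_def elim: homE)
  qed simp
  thus act_mhom: "act n \<sigma> \<in> hom (multilinear_cat C M W n) (X n) (?Q \<sigma>)"
    using X Q by (simp add: hom_multilinear_cat)
  \<comment> \<open>Stated for entries of arbitrary type, since it serves both tuples of objects and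
    tuples of arrows.\<close>
  have unpermute: "permute_tuple n (inv \<sigma>) (permute_tuple n \<sigma> A) = A" if "A \<in> extensional {1..n}"
    for A :: "nat \<Rightarrow> 'x"
    using that by (simp add: permute_tuple_permute_tuple[OF pi] permutes_inv_o[OF \<sigma>] permute_tuple_id)
  define b where "b A = a n (inv \<sigma>) (permute_tuple n \<sigma> A)" for A
  let ?b = "ntr ?O (?Q \<sigma>) (X n) b"
  have "?b \<in> hom (fun_cat (pow_cat C n) M) (?Q \<sigma>) (X n)"
  proof (rule ntr_hom[OF P.category_axioms Qf Xf])
    fix A assume A: "A \<in> ?O"
    show "b A \<in> hom M (fob (?Q \<sigma>) A) (fob (X n) A)"
      using a_hom[OF pi permute_tuple_obj[OF \<sigma> A]] A
      by (simp add: permute_inputs_def b_def unpermute[OF pow_obj_ext[OF A]])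
  next
    fix A B f assume f: "f \<in> hom (pow_cat C n) A B"
    show "Cmp M (b B) (far (?Q \<sigma>) f) = Cmp M (far (X n) f) (b A)"
      using a_nat[OF pi permute_tuple_hom[OF \<sigma> f]] f
      by (auto simp: permute_inputs_def b_def unpermute[OF hom_pow_catE(1)[OF f]] elim: homE)
  qed simp
  hence b_mhom: "?b \<in> hom (multilinear_cat C M W n) (?Q \<sigma>) (X n)"
    using X Q by (simp add: hom_multilinear_cat)
  have ba: "Cmp M (b A) (a n \<sigma> A) = Idn M (fob (X n) A)" if A: "A \<in> ?O" for A
    using a_cmp[OF \<sigma> pi A] a_id[OF A] by (simp add: b_def permutes_inv_o[OF \<sigma>])
  \<comment> \<open>Here the composition law is applied at the permuted tuple, with
    \<open>inv \<sigma>\<close> acting first.\<close>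
  have ab: "Cmp M (a n \<sigma> A) (b A) = Idn M (fob (?Q \<sigma>) A)" if A: "A \<in> ?O" for A
    using a_cmp[OF pi \<sigma> permute_tuple_obj[OF \<sigma> A]] a_id[OF permute_tuple_obj[OF \<sigma> A]] A
    by (simp add: b_def permutes_inv_o[OF \<sigma>] unpermute[OF pow_obj_ext[OF A]] permute_inputs_def)
  have "inverse_arrows (multilinear_cat C M W n) (act n \<sigma>) ?b"
    unfolding inverse_arrows_def
    using act_mhom b_mhom ba ab
    by (auto simp: multilinear_cat_def full_subcat_def hom_def act[OF \<sigma>] ntr_cmp ntr_id intro!: ntr_cong)
  thus "is_iso (multilinear_cat C M W n) (act n \<sigma>)" unfolding is_iso_def by blast
  fix \<tau> A assume \<tau>: "\<tau> permutes {1..n}" and A: "A \<in> ?O"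
  show "ncmp (act n (\<sigma> \<circ> \<tau>)) A = Cmp M (ncmp (act n \<tau>) (permute_tuple n \<sigma> A)) (ncmp (act n \<sigma>) A)"
    using a_cmp[OF \<sigma> \<tau> A] A permute_tuple_obj[OF \<sigma> A]
    by (simp add: act[OF \<sigma>] act[OF \<tau>] act[OF permutes_compose[OF \<tau> \<sigma>]])
qed


section \<open>Cross-effects\<close>

locale cross_effects = hofibers M W L z + C: pointed_category C K
  for M :: "('o, 'm) nmcat" (structure) and W :: "'m set" and L :: "('o, 'm) holims" and z :: 'o
    and C :: "('a, 'b, 'z) cat_scheme" and K :: "('a, 'b) coprods" +
  fixes F :: "('a, 'b, 'o, 'm) functr"
  assumes F: "F \<in> functors C M"
begin

context
  fixes n :: nat
begin

abbreviation "tuples \<equiv> Obj (pow_cat C n)"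
abbreviation "crs \<equiv> cross_cube C K F n"

lemma tuple_family: "A \<in> tuples \<Longrightarrow> S \<in> cube n \<Longrightarrow> C.family S A"
  using pow_objD[of A C n] cube_top[of S n]
  by (auto simp: C.family_def intro: finite_subset[of S "{1..n}"])

lemma tuple_id_hom: "A \<in> tuples \<Longrightarrow> S \<in> cube n \<Longrightarrow> i \<in> S \<Longrightarrow> Idn C (A i) \<in> hom C (A i) (A i)"
  using tuple_family[of A S] C.id_hom by (auto simp: C.family_def)

lemma F_summand_map_cmp:
  assumes "C.family S A" "C.family T B" "C.family U D"
    and "\<And>i. i \<in> S \<Longrightarrow> p i \<in> T \<Longrightarrow> f i \<in> hom C (A i) (B (p i))"
    and "\<And>i. i \<in> T \<Longrightarrow> q i \<in> U \<Longrightarrow> g i \<in> hom C (B i) (D (q i))"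
    and "\<And>i. i \<in> S \<Longrightarrow> q (p i) \<in> U \<Longrightarrow> p i \<in> T"
  shows "far F (C.summand_map T B U D q g) \<cdot> far F (C.summand_map S A T B p f) =
    far F (C.summand_map S A U D (\<lambda>i. q (p i)) (\<lambda>i. g (p i) \<cdot>\<^bsub>C\<^esub> f i))"
  using functor_cmp[OF F C.summand_map_hom[OF assms(1,2,4)] C.summand_map_hom[OF assms(2,3,5)]]
  by (simp only: C.summand_map_cmp[OF assms])

lemma crs_fob: "S \<in> cube n \<Longrightarrow> fob (crs A) S = fob F (cop K S A)"
  by (simp add: cross_cube_def)

lemma crs_far:
  assumes A: "A \<in> tuples" and S: "S \<in> cube n" and T: "T \<in> cube n" and ST: "T \<subseteq> S"
  shows "far (crs A) (S, T) = far F (C.summand_map S A T A (\<lambda>i. i) (\<lambda>i. Idn C (A i)))"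
  using S T ST by (simp add: cross_cube_def Arr_poset_cat C.collapse_eq[OF tuple_family[OF A T]])

lemma cross_cube_functor:
  assumes A: "A \<in> tuples"
  shows "crs A \<in> functors (poset_cat (cube n)) M"
proof (rule diagramI[OF category_axioms])
  note fam = tuple_family[OF A] and ih = tuple_id_hom[OF A]
  show "fob (crs A) \<in> extensional (cube n)" "far (crs A) \<in> extensional (Arr (poset_cat (cube n)))"
    by (simp_all add: cross_cube_def)
  fix S assume S: "S \<in> cube n"
  show "fob (crs A) S \<in> Obj M"
    using functor_obj[OF F C.cop_obj[OF fam[OF S]]] S by (simp add: crs_fob)
  show "far (crs A) (S, S) = Idn M (fob (crs A) S)"
    using functor_id[OF F C.cop_obj[OF fam[OF S]]] S
    by (simp add: crs_far[OF A] crs_fob C.summand_map_id[OF fam])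
  fix T assume T: "T \<in> cube n" and ST: "T \<subseteq> S"
  show "far (crs A) (S, T) \<in> hom M (fob (crs A) S) (fob (crs A) T)"
    unfolding crs_far[OF A S T ST] crs_fob[OF S] crs_fob[OF T]
    by (rule functor_hom[OF F C.summand_map_hom[OF fam[OF S] fam[OF T] ih[OF S]]])
  fix U assume U: "U \<in> cube n" and TU: "U \<subseteq> T"
  have SU: "U \<subseteq> S" using ST TU by simp
  have "far (crs A) (T, U) \<cdot> far (crs A) (S, T) =
      far F (C.summand_map S A U A (\<lambda>i. i) (\<lambda>i. Idn C (A i) \<cdot>\<^bsub>C\<^esub> Idn C (A i)))"
    unfolding crs_far[OF A S T ST] crs_far[OF A T U TU]
    by (rule F_summand_map_cmp[OF fam[OF S] fam[OF T] fam[OF U] ih[OF S] ih[OF T]])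
      (use TU in auto)
  also have "C.summand_map S A U A (\<lambda>i. i) (\<lambda>i. Idn C (A i) \<cdot>\<^bsub>C\<^esub> Idn C (A i)) =
      C.summand_map S A U A (\<lambda>i. i) (\<lambda>i. Idn C (A i))"
    by (rule C.summand_map_cong) (simp_all add: C.id_left[OF ih[OF S]])
  finally show "far (crs A) (S, U) = far (crs A) (T, U) \<cdot> far (crs A) (S, T)"
    by (simp add: crs_far[OF A S U SU])
qed

text \<open>Common form of both kinds of maps: \<sigma> = \<open>id\<close> gives the maps induced
  by morphisms of tuples, and identity components give the permutations of summands. The summand
  labelled i goes to the label \<open>inv \<sigma> i\<close> because that is where a tuple permuted
  by \<sigma> shows the entry i.\<close>

definition input_map ::
  "(nat \<Rightarrow> nat) \<Rightarrow> (nat \<Rightarrow> 'a) \<Rightarrow> (nat \<Rightarrow> 'a) \<Rightarrow> (nat \<Rightarrow> 'b) \<Rightarrow> nat set \<Rightarrow> 'm" where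
  "input_map \<sigma> A B f S = far F (C.summand_map (\<sigma> ` S) A S B (inv \<sigma>) f)"

lemma input_map_component:
  assumes \<sigma>: "\<sigma> permutes {1..n}" and S: "S \<in> cube n" and i: "i \<in> \<sigma> ` S"
  shows "inv \<sigma> i \<in> S" "i \<in> {1..n}"
  using i permutes_inverses(2)[OF \<sigma>] cube_top[OF image_cube[OF \<sigma> S]] by auto

text \<open>Collapsing before or after the map gives the same map of coproducts: both composites
  relabel by \<open>inv \<sigma>\<close> and kill the same summands, and their components differ
  only by the side on which an identity is composed.\<close>

lemma input_map_twisted:
  assumes \<sigma>: "\<sigma> permutes {1..n}" and A: "A \<in> tuples" and B: "B \<in> tuples"
    and f: "\<And>i. i \<in> {1..n} \<Longrightarrow> f i \<in> hom C (A i) (B (inv \<sigma> i))"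
  shows "twisted_cube_map n \<sigma> (crs A) (crs B) (input_map \<sigma> A B f)"
  unfolding twisted_cube_map_def
proof (intro conjI ballI impI)
  note famA = tuple_family[OF A image_cube[OF \<sigma>]] and famB = tuple_family[OF B]
  note comp = input_map_component[OF \<sigma>]
  have fS: "f i \<in> hom C (A i) (B (inv \<sigma> i))" if "S \<in> cube n" "i \<in> \<sigma> ` S" for S i
    by (rule f[OF comp(2)[OF that]])
  fix S assume S: "S \<in> cube n"
  show "input_map \<sigma> A B f S \<in> hom M (fob (crs A) (\<sigma> ` S)) (fob (crs B) S)"
    unfolding input_map_def crs_fob[OF S] crs_fob[OF image_cube[OF \<sigma> S]]
    by (rule functor_hom[OF F C.summand_map_hom[OF famA[OF S] famB[OF S] fS[OF S]]])
  fix T assume T: "T \<in> cube n" and ST: "T \<subseteq> S"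
  have ST': "\<sigma> ` T \<subseteq> \<sigma> ` S" using ST by auto
  \<comment> \<open>The side condition of the composition law: a summand whose new label lies in T
    must have survived the collapse to the image of T.\<close>
  have inT: "i \<in> \<sigma> ` T" if "inv \<sigma> i \<in> T" for i
    using imageI[OF that, of \<sigma>] permutes_inverses(1)[OF \<sigma>] by simp
  note iA = tuple_id_hom[OF A image_cube[OF \<sigma> S]] and iB = tuple_id_hom[OF B S]
  have "input_map \<sigma> A B f T \<cdot> far (crs A) (\<sigma> ` S, \<sigma> ` T) =
      far F (C.summand_map (\<sigma> ` S) A T B (inv \<sigma>) (\<lambda>i. f i \<cdot>\<^bsub>C\<^esub> Idn C (A i)))"
    unfolding input_map_def crs_far[OF A image_cube[OF \<sigma> S] image_cube[OF \<sigma> T] ST']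
    by (rule F_summand_map_cmp[OF famA[OF S] famA[OF T] famB[OF T] iA fS[OF T] inT])
  also have "C.summand_map (\<sigma> ` S) A T B (inv \<sigma>) (\<lambda>i. f i \<cdot>\<^bsub>C\<^esub> Idn C (A i)) =
      C.summand_map (\<sigma> ` S) A T B (inv \<sigma>) (\<lambda>i. Idn C (B (inv \<sigma> i)) \<cdot>\<^bsub>C\<^esub> f i)"
    by (rule C.summand_map_cong) (simp_all add: C.id_left[OF fS[OF S]] C.id_right[OF fS[OF S]])
  also have "far F \<dots> = far (crs B) (S, T) \<cdot> input_map \<sigma> A B f S"
    unfolding input_map_def crs_far[OF B S T ST]
    by (rule F_summand_map_cmp[symmetric, OF famA[OF S] famB[OF S] famB[OF T] fS[OF S] iB])
      (use comp(1)[OF S] in auto)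
  finally show "input_map \<sigma> A B f T \<cdot> far (crs A) (\<sigma> ` S, \<sigma> ` T) =
      far (crs B) (S, T) \<cdot> input_map \<sigma> A B f S" .
qed (use assms cross_cube_functor in auto)

definition cross_map :: "(nat \<Rightarrow> nat) \<Rightarrow> (nat \<Rightarrow> 'a) \<Rightarrow> (nat \<Rightarrow> 'a) \<Rightarrow> (nat \<Rightarrow> 'b) \<Rightarrow> 'm" where
  "cross_map \<sigma> A B f = twisted_map n \<sigma> (crs A) (crs B) (input_map \<sigma> A B f)"

lemma cross_map_hom:
  assumes "\<sigma> permutes {1..n}" "A \<in> tuples" "B \<in> tuples"
    "\<And>i. i \<in> {1..n} \<Longrightarrow> f i \<in> hom C (A i) (B (inv \<sigma> i))"
  shows "cross_map \<sigma> A B f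
    \<in> hom M (total_hofiber M z L n (crs A)) (total_hofiber M z L n (crs B))"
  unfolding cross_map_def by (rule twisted_map_hom[OF input_map_twisted[OF assms]])

lemma cross_map_cong:
  assumes \<sigma>: "\<sigma> permutes {1..n}" and "\<And>i. i \<in> {1..n} \<Longrightarrow> f i = g i"
  shows "cross_map \<sigma> A B f = cross_map \<sigma> A B g"
  unfolding cross_map_def
proof (rule twisted_map_cong)
  fix S assume "S \<in> cube n"
  with input_map_component(2)[OF \<sigma> this] show "input_map \<sigma> A B f S = input_map \<sigma> A B g S"
    unfolding input_map_def
    by (intro arg_cong[where f = "far F"] C.summand_map_cong) (auto intro: assms(2))
qed

text \<open>Composition of twisted maps and composition of summand maps combine. After the first map
  the summand i sits at \<open>inv \<sigma> i\<close>, so this is the component of g that acts on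
  it.\<close>

lemma cross_map_cmp:
  assumes \<sigma>: "\<sigma> permutes {1..n}" and \<tau>: "\<tau> permutes {1..n}"
    and A: "A \<in> tuples" and B: "B \<in> tuples" and D: "D \<in> tuples"
    and f: "\<And>i. i \<in> {1..n} \<Longrightarrow> f i \<in> hom C (A i) (B (inv \<sigma> i))"
    and g: "\<And>i. i \<in> {1..n} \<Longrightarrow> g i \<in> hom C (B i) (D (inv \<tau> i))"
  shows "cross_map \<tau> B D g \<cdot> cross_map \<sigma> A B f =
    cross_map (\<sigma> \<circ> \<tau>) A D (\<lambda>i. g (inv \<sigma> i) \<cdot>\<^bsub>C\<^esub> f i)"
proof -
  have i: "inv (\<sigma> \<circ> \<tau>) = inv \<tau> \<circ> inv \<sigma>"
    by (rule o_inv_distrib[OF permutes_bij[OF \<sigma>] permutes_bij[OF \<tau>]])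
  have *: "input_map \<tau> B D g S \<cdot> input_map \<sigma> A B f (\<tau> ` S) =
      input_map (\<sigma> \<circ> \<tau>) A D (\<lambda>i. g (inv \<sigma> i) \<cdot>\<^bsub>C\<^esub> f i) S" if S: "S \<in> cube n" for S
  proof -
    note tS = image_cube[OF \<tau> S]
    note cs = input_map_component[OF \<sigma> tS] and ct = input_map_component[OF \<tau> S]
    have "far F (C.summand_map (\<tau> ` S) B S D (inv \<tau>) g) \<cdot>
        far F (C.summand_map (\<sigma> ` \<tau> ` S) A (\<tau> ` S) B (inv \<sigma>) f) =
        far F (C.summand_map (\<sigma> ` \<tau> ` S) A S D (\<lambda>i. inv \<tau> (inv \<sigma> i)) (\<lambda>i. g (inv \<sigma> i) \<cdot>\<^bsub>C\<^esub> f i))"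
      by (rule F_summand_map_cmp[OF tuple_family[OF A image_cube[OF \<sigma> tS]] tuple_family[OF B tS]
            tuple_family[OF D S] f[OF cs(2)] g[OF ct(2)] cs(1)])
    thus ?thesis unfolding input_map_def i image_comp[symmetric] by (simp add: comp_def)
  qed
  show ?thesis
    unfolding cross_map_def
    by (rule trans[OF twisted_map_cmp[OF input_map_twisted[OF \<sigma> A B f]
            input_map_twisted[OF \<tau> B D g]] twisted_map_cong[OF *]])
qed

lemma cross_map_id:
  assumes A: "A \<in> tuples"
  shows "cross_map id A A (\<lambda>i. Idn C (A i)) = Idn M (total_hofiber M z L n (crs A))"
proof -
  have "input_map id A A (\<lambda>i. Idn C (A i)) S = Idn M (fob (crs A) S)" if S: "S \<in> cube n" for S
    using functor_id[OF F C.cop_obj[OF tuple_family[OF A S]]] C.summand_map_id[OF tuple_family[OF A S]]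
    by (simp add: input_map_def crs_fob[OF S] id_def)
  thus ?thesis
    unfolding cross_map_def twisted_map_id[OF cross_cube_functor[OF A], symmetric]
    by (rule twisted_map_cong)
qed

lemma cross_effect_far:
  assumes f: "f \<in> hom (pow_cat C n) A B" and A: "A \<in> tuples" and B: "B \<in> tuples"
  shows "far (cross_effect C K M z L F n) f = cross_map id A B f"
proof -
  have fAB: "f \<in> Arr (pow_cat C n)" "Dom (pow_cat C n) f = A" "Cod (pow_cat C n) f = B"
    using f by (auto elim: homE)
  have fh: "f i \<in> hom C (A i) (B (inv id i))" if "i \<in> {1..n}" for i
    using hom_pow_catE(4)[OF f that] by simp
  have e: "cross_cube_map C K F n f = ntr (cube n) (crs A) (crs B) (input_map id A B f)"
    by (simp add: cross_cube_map_def fAB input_map_def C.cop_map_eq) (simp add: id_def)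
  have t: "twisted_cube_map n id (crs A) (crs B) (input_map id A B f)"
    by (rule input_map_twisted[OF permutes_id A B fh])
  have "far (cross_effect C K M z L F n) f = total_hofiber_map M z L n (cross_cube_map C K F n f)"
    using fAB(1) by (simp add: cross_effect_def)
  also have "\<dots> = cross_map id A B f"
    unfolding e cross_map_def by (rule total_hofiber_map_eq_twisted[OF t])
  finally show ?thesis .
qed

lemma cross_effect_functor: "cross_effect C K M z L F n \<in> functors (pow_cat C n) M"
proof -
  let ?X = "cross_effect C K M z L F n"
  interpret P: category "pow_cat C n" by (rule pow_cat_category[OF C.category_axioms])
  have fob: "fob ?X A = total_hofiber M z L n (crs A)" if "A \<in> tuples" for A
    using that by (simp add: cross_effect_def)
  show ?thesis
  proof (rule functorI[OF P.category_axioms category_axioms])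
    show "fob ?X \<in> extensional tuples" "far ?X \<in> extensional (Arr (pow_cat C n))"
      by (simp_all add: cross_effect_def)
  next
    fix A assume A: "A \<in> tuples"
    show "fob ?X A \<in> Obj M"
      unfolding fob[OF A] total_hofiber_def
      by (rule hofiber_obj[OF punctured_map_hom[OF cross_cube_functor[OF A]]])
    have "cross_map id A A (Idn (pow_cat C n) A) = cross_map id A A (\<lambda>i. Idn C (A i))"
      by (rule cross_map_cong[OF permutes_id]) (simp add: pow_cat_def)
    thus "far ?X (Idn (pow_cat C n) A) = Idn M (fob ?X A)"
      by (simp add: cross_effect_far[OF P.id_hom[OF A] A A] fob[OF A] cross_map_id[OF A])
  next
    fix A B f assume f: "f \<in> hom (pow_cat C n) A B"
    note A = P.hom_obj[OF f, THEN conjunct1] and B = P.hom_obj[OF f, THEN conjunct2]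
    have fh: "f i \<in> hom C (A i) (B (inv id i))" if "i \<in> {1..n}" for i
      using hom_pow_catE(4)[OF f that] by simp
    show "far ?X f \<in> hom M (fob ?X A) (fob ?X B)"
      unfolding cross_effect_far[OF f A B] fob[OF A] fob[OF B]
      by (rule cross_map_hom[OF permutes_id A B fh])
    fix D g assume g: "g \<in> hom (pow_cat C n) B D"
    note D = P.hom_obj[OF g, THEN conjunct2]
    have gh: "g i \<in> hom C (B i) (D (inv id i))" if "i \<in> {1..n}" for i
      using hom_pow_catE(4)[OF g that] by simp
    have "far ?X g \<cdot> far ?X f = cross_map (id \<circ> id) A D (\<lambda>i. g (inv id i) \<cdot>\<^bsub>C\<^esub> f i)"
      unfolding cross_effect_far[OF f A B] cross_effect_far[OF g B D]
      by (rule cross_map_cmp[OF permutes_id permutes_id A B D fh gh])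
    also have "\<dots> = cross_map id A D (Cmp (pow_cat C n) g f)"
      unfolding id_o by (rule cross_map_cong[OF permutes_id]) (simp add: pow_cat_def)
    also have "\<dots> = far ?X (Cmp (pow_cat C n) g f)"
      by (rule cross_effect_far[symmetric, OF P.cmp_hom[OF f g] A D])
    finally show "far ?X (Cmp (pow_cat C n) g f) = far ?X g \<cdot> far ?X f" ..
  qed
qed

text \<open>The identity of \<open>A i\<close> has the required type because the permuted tuple has
  \<open>A i\<close> in position \<open>inv \<sigma> i\<close>.\<close>

definition permutation_map :: "(nat \<Rightarrow> nat) \<Rightarrow> (nat \<Rightarrow> 'a) \<Rightarrow> 'm" where
  "permutation_map \<sigma> A = cross_map \<sigma> A (permute_tuple n \<sigma> A) (\<lambda>i. Idn C (A i))"

lemma permutation_component: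
  assumes \<sigma>: "\<sigma> permutes {1..n}" and i: "i \<in> {1..n}"
  shows "inv \<sigma> i \<in> {1..n}" "permute_tuple n \<sigma> A (inv \<sigma> i) = A i"
  using permutes_in[OF permutes_inv[OF \<sigma>] i] permutes_inverses(1)[OF \<sigma>] by auto

lemma permutation_id_hom:
  assumes \<sigma>: "\<sigma> permutes {1..n}" and A: "A \<in> tuples" and i: "i \<in> {1..n}"
  shows "Idn C (A i) \<in> hom C (A i) (permute_tuple n \<sigma> A (inv \<sigma> i))"
  unfolding permutation_component(2)[OF \<sigma> i] by (rule C.id_hom[OF pow_objD[OF A i]])

text \<open>The action is defined as a map of cubes followed by a relabelling. These are twisted
  maps over \<open>id\<close> and over \<sigma>, so their composite is one over \<sigma>, and it
  remains to identify its components with permutations of summands.\<close>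

lemma permutation_action_component:
  assumes \<sigma>: "\<sigma> permutes {1..n}" and A: "A \<in> tuples"
  shows "total_hofiber_relabel M z L n (vimage \<sigma>) (image \<sigma>) (crs (permute_tuple n \<sigma> A)) \<cdot>
      total_hofiber_map M z L n
        (ntr (cube n) (crs A) (reindex (cube n) (vimage \<sigma>) (crs (permute_tuple n \<sigma> A)))
          (\<lambda>S. far F (cop_permute C K n \<sigma> A S))) = permutation_map \<sigma> A"
proof -
  let ?A = "permute_tuple n \<sigma> A"
  let ?D = "crs ?A" and ?c = "\<lambda>S. far F (cop_permute C K n \<sigma> A S)" and ?f = "\<lambda>i. Idn C (A i)"
  let ?R = "reindex (cube n) (vimage \<sigma>) ?D"
  note A' = permute_tuple_obj[OF \<sigma> A]
  note t = input_map_twisted[OF \<sigma> A A' permutation_id_hom[OF \<sigma> A]]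
  note r = twisted_cube_map_relabel[OF \<sigma> cross_cube_functor[OF A']]
  have si: "\<sigma> ` \<sigma> -` S = S" for S by (rule surj_image_vimage_eq[OF permutes_surj[OF \<sigma>]])
  have vi: "\<sigma> -` \<sigma> ` S = S" for S by (rule inj_vimage_image_eq[OF permutes_inj[OF \<sigma>]])
  have vc: "\<sigma> -` S \<in> cube n" if "S \<in> cube n" for S
    unfolding vimage_permutes[OF \<sigma>] by (rule image_cube[OF permutes_inv[OF \<sigma>] that])
  \<comment> \<open>\<open>cop_permute\<close> is indexed by the label set of its source and
    \<open>input_map\<close> by that of its target, hence the preimage of S on the right.\<close>
  have c: "?c S = input_map \<sigma> A ?A ?f (\<sigma> -` S)" if S: "S \<in> cube n" for S
  proof -
    have "cop_permute C K n \<sigma> A S = C.summand_map S A (\<sigma> -` S) ?A (inv \<sigma>) ?f"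
      unfolding cop_permute_def C.summand_map_def
    proof (rule C.copair_cong)
      fix i assume i: "i \<in> S"
      hence i': "i \<in> {1..n}" using cube_top[OF S] by auto
      have m: "inv \<sigma> i \<in> \<sigma> -` S" using i permutes_inverses(1)[OF \<sigma>] by simp
      have "cinj K (\<sigma> -` S) ?A (inv \<sigma> i) \<in> hom C (A i) (cop K (\<sigma> -` S) ?A)"
        using C.cinj_hom[OF tuple_family[OF A' vc[OF S]] m]
        by (simp only: permutation_component(2)[OF \<sigma> i'])
      thus "cinj K (\<sigma> -` S) ?A (inv \<sigma> i) = (if inv \<sigma> i \<in> \<sigma> -` S
          then cinj K (\<sigma> -` S) ?A (inv \<sigma> i) \<cdot>\<^bsub>C\<^esub> Idn C (A i)
          else zero_arr C K (A i) (cop K (\<sigma> -` S) ?A))"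
        using m by (simp add: C.id_right)
    qed
    thus ?thesis by (simp only: input_map_def si)
  qed
  \<comment> \<open>Its typing and compatibility are those of \<open>t\<close>, evaluated at
    preimages under \<sigma>.\<close>
  have tc: "twisted_cube_map n id (crs A) ?R ?c"
    unfolding twisted_cube_map_def
  proof (intro conjI ballI impI)
    fix S assume S: "S \<in> cube n"
    show "?c S \<in> hom M (fob (crs A) (id ` S)) (fob ?R S)"
      using twisted_cube_mapD(4)[OF t vc[OF S], unfolded si] S by (simp add: c reindex_def)
    fix T assume T: "T \<in> cube n" and ST: "T \<subseteq> S"
    show "?c T \<cdot> far (crs A) (id ` S, id ` T) = far ?R (S, T) \<cdot> ?c S"
      using twisted_cube_mapD(5)[OF t vc[OF S] vc[OF T] vimage_mono[OF ST], unfolded si] S T ST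
      by (simp add: c reindex_def Arr_poset_cat)
  qed (use twisted_cube_mapD(2)[OF t] twisted_cube_mapD(2)[OF r] permutes_id in auto)
  have eq: "Idn M (fob ?D S) \<cdot> ?c (\<sigma> ` S) = input_map \<sigma> A ?A ?f S" if S: "S \<in> cube n" for S
    using id_left[OF twisted_cube_mapD(4)[OF t S]] by (simp add: c[OF image_cube[OF \<sigma> S]] vi)
  show ?thesis
    unfolding total_hofiber_relabel_eq_twisted[OF \<sigma> cross_cube_functor[OF A']]
      total_hofiber_map_eq_twisted[OF tc] twisted_map_cmp[OF tc r] id_o
      permutation_map_def cross_map_def
    by (rule twisted_map_cong[OF eq])
qed

lemma permutation_map_hom:
  assumes \<sigma>: "\<sigma> permutes {1..n}" and A: "A \<in> tuples"
  shows "permutation_map \<sigma> A \<in> hom M (fob (cross_effect C K M z L F n) A)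
    (fob (cross_effect C K M z L F n) (permute_tuple n \<sigma> A))"
  using cross_map_hom[OF \<sigma> A permute_tuple_obj[OF \<sigma> A] permutation_id_hom[OF \<sigma> A]]
    A permute_tuple_obj[OF \<sigma> A]
  by (simp add: permutation_map_def cross_effect_def)

lemma permutation_map_id:
  assumes A: "A \<in> tuples"
  shows "permutation_map id A = Idn M (fob (cross_effect C K M z L F n) A)"
  using cross_map_id[OF A] A
  by (simp add: permutation_map_def cross_effect_def permute_tuple_id[OF pow_obj_ext[OF A]])

text \<open>Identity components compose to identity components, so only the permutations are
  multiplied by \<open>cross_map_cmp\<close>.\<close>

lemma permutation_map_cmp:
  assumes \<sigma>: "\<sigma> permutes {1..n}" and \<tau>: "\<tau> permutes {1..n}" and A: "A \<in> tuples"
  shows "permutation_map (\<sigma> \<circ> \<tau>) A = permutation_map \<tau> (permute_tuple n \<sigma> A) \<cdot> permutation_map \<sigma> A"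
proof -
  note A1 = permute_tuple_obj[OF \<sigma> A] and A2 = permute_tuple_obj[OF \<tau> permute_tuple_obj[OF \<sigma> A]]
  have i: "Idn C (permute_tuple n \<sigma> A (inv \<sigma> i)) \<cdot>\<^bsub>C\<^esub> Idn C (A i) = Idn C (A i)"
    if "i \<in> {1..n}" for i
    unfolding permutation_component(2)[OF \<sigma> that]
    by (rule C.id_left[OF C.id_hom[OF pow_objD[OF A that]]])
  show ?thesis
    unfolding permutation_map_def permute_tuple_permute_tuple[OF \<tau>, symmetric]
    by (rule sym, rule trans[OF cross_map_cmp[OF \<sigma> \<tau> A A1 A2 permutation_id_hom[OF \<sigma> A]
            permutation_id_hom[OF \<tau> A1]] cross_map_cong[OF permutes_compose[OF \<tau> \<sigma>] i]])
qed

text \<open>Both sides are cross maps over the same permutation, as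
  \<open>id \<circ> \<sigma>\<close> and as \<open>\<sigma> \<circ> id\<close>. Their components
  agree because the permuted f has the entry \<open>f i\<close> in position
  \<open>inv \<sigma> i\<close>.\<close>

lemma permutation_map_nat:
  assumes \<sigma>: "\<sigma> permutes {1..n}" and f: "f \<in> hom (pow_cat C n) A B"
  shows "permutation_map \<sigma> B \<cdot> far (cross_effect C K M z L F n) f =
    far (cross_effect C K M z L F n) (permute_tuple n \<sigma> f) \<cdot> permutation_map \<sigma> A"
proof -
  interpret P: category "pow_cat C n" by (rule pow_cat_category[OF C.category_axioms])
  note A = P.hom_obj[OF f, THEN conjunct1] and B = P.hom_obj[OF f, THEN conjunct2]
  note A' = permute_tuple_obj[OF \<sigma> A] and B' = permute_tuple_obj[OF \<sigma> B]
  note f' = permute_tuple_hom[OF \<sigma> f]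
  have fh: "f i \<in> hom C (A i) (B (inv id i))" if "i \<in> {1..n}" for i
    using hom_pow_catE(4)[OF f that] by simp
  have fh': "permute_tuple n \<sigma> f i \<in> hom C (permute_tuple n \<sigma> A i) (permute_tuple n \<sigma> B (inv id i))"
    if "i \<in> {1..n}" for i
    using hom_pow_catE(4)[OF f' that] by simp
  have eq: "Idn C (B (inv id i)) \<cdot>\<^bsub>C\<^esub> f i = permute_tuple n \<sigma> f (inv \<sigma> i) \<cdot>\<^bsub>C\<^esub> Idn C (A i)"
    if i: "i \<in> {1..n}" for i
    using hom_pow_catE(4)[OF f i] permutation_component(2)[OF \<sigma> i, of f]
    by (simp add: C.id_left C.id_right)
  have "permutation_map \<sigma> B \<cdot> far (cross_effect C K M z L F n) f =
      cross_map (id \<circ> \<sigma>) A (permute_tuple n \<sigma> B) (\<lambda>i. Idn C (B (inv id i)) \<cdot>\<^bsub>C\<^esub> f i)"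
    unfolding permutation_map_def cross_effect_far[OF f A B]
    by (rule cross_map_cmp[OF permutes_id \<sigma> A B B' fh permutation_id_hom[OF \<sigma> B]])
  also have "\<dots> = cross_map (\<sigma> \<circ> id) A (permute_tuple n \<sigma> B)
      (\<lambda>i. permute_tuple n \<sigma> f (inv \<sigma> i) \<cdot>\<^bsub>C\<^esub> Idn C (A i))"
    unfolding id_o o_id by (rule cross_map_cong[OF \<sigma> eq])
  also have "\<dots> = far (cross_effect C K M z L F n) (permute_tuple n \<sigma> f) \<cdot> permutation_map \<sigma> A"
    unfolding permutation_map_def cross_effect_far[OF f' A' B']
    by (rule cross_map_cmp[symmetric, OF \<sigma> permutes_id A A' B' permutation_id_hom[OF \<sigma> A] fh'])
  finally show ?thesis .
qed

end

section \<open>Degree zero and the whole sequence\<close>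

lemma spectral_derivative_0_functor: "spectral_derivative C K M z L F 0 \<in> functors (pow_cat C 0) M"
proof -
  interpret P: category "pow_cat C 0" by (rule pow_cat_category[OF C.category_axioms])
  have Z: "fob F (zob K) \<in> Obj M" by (rule functor_obj[OF F C.zob_obj])
  let ?X = "spectral_derivative C K M z L F 0"
  have far: "far ?X f = Idn M (fob F (zob K))" if "f \<in> hom (pow_cat C 0) A B" for f A B
    using that by (auto simp: spectral_derivative_def elim: homE)
  have fob: "fob ?X A = fob F (zob K)" if "A \<in> Obj (pow_cat C 0)" for A
    using that by (simp add: spectral_derivative_def)
  show ?thesis
  proof (rule functorI[OF P.category_axioms category_axioms])
    fix A B f assume f: "f \<in> hom (pow_cat C 0) A B"
    show "far ?X f \<in> hom M (fob ?X A) (fob ?X B)"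
      using P.hom_obj[OF f] id_hom[OF Z] by (simp add: far[OF f] fob)
    fix D g assume g: "g \<in> hom (pow_cat C 0) B D"
    show "far ?X (Cmp (pow_cat C 0) g f) = far ?X g \<cdot> far ?X f"
      by (simp only: far[OF f] far[OF g] far[OF P.cmp_hom[OF f g]] id_left[OF id_hom[OF Z]])
  qed (simp_all add: fob Z far[OF P.id_hom], simp_all add: spectral_derivative_def)
qed

lemma spectral_derivative_symmetric_sequence:
  assumes lin: "\<And>n. n \<ge> 1 \<Longrightarrow> separately_linear C M W n (cross_effect C K M z L F n)"
  shows "symmetric_sequence C M W (spectral_derivative C K M z L F) (permutation_action C K M z L F)"
proof (rule symmetric_sequenceI[OF C.category_axioms category_axioms, where
      a = "\<lambda>n \<sigma> A. if n = 0 then Idn M (fob F (zob K)) else permutation_map n \<sigma> A"])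
  fix n
  let ?X = "spectral_derivative C K M z L F n"
  have X: "?X = cross_effect C K M z L F n" if "n \<noteq> 0"
    using that by (simp add: spectral_derivative_def)
  have Z: "fob F (zob K) \<in> Obj M" by (rule functor_obj[OF F C.zob_obj])
  note iz = id_hom[OF Z] id_left[OF id_hom[OF Z]]
  have X0: "A \<in> Obj (pow_cat C n) \<Longrightarrow> fob ?X A = fob F (zob K)"
    "f \<in> Arr (pow_cat C n) \<Longrightarrow> far ?X f = Idn M (fob F (zob K))" if "n = 0" for A f
    using that by (auto simp: spectral_derivative_def)
  show "?X \<in> multilinear_functors C M W n"
  proof (cases "n = 0")
    \<comment> \<open>In degree zero there are no variables, so separate linearity is
      vacuous.\<close>
    case True
    thus ?thesis
      using spectral_derivative_0_functor by (simp add: multilinear_functors_def separately_linear_def)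
  next
    case False
    thus ?thesis using lin[of n] cross_effect_functor by (simp add: multilinear_functors_def X)
  qed
  fix \<sigma> assume \<sigma>: "\<sigma> permutes {1..n}"
  show "permutation_action C K M z L F n \<sigma> = ntr (Obj (pow_cat C n)) ?X (permute_inputs C n \<sigma> ?X)
      (\<lambda>A. if n = 0 then Idn M (fob F (zob K)) else permutation_map n \<sigma> A)"
    unfolding permutation_action_def Let_def
    by (rule ntr_cong) (simp add: permutation_action_component[OF \<sigma>])
  show "(if n = 0 then Idn M (fob F (zob K)) else permutation_map n \<sigma> B) \<cdot> far ?X f =
      far ?X (permute_tuple n \<sigma> f) \<cdot> (if n = 0 then Idn M (fob F (zob K)) else permutation_map n \<sigma> A)"
    if f: "f \<in> hom (pow_cat C n) A B" for A B f
    using permutation_map_nat[OF \<sigma> f] X X0(2) f permute_tuple_hom[OF \<sigma> f]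
    by (auto elim!: homE)
  fix A assume A: "A \<in> Obj (pow_cat C n)"
  show "(if n = 0 then Idn M (fob F (zob K)) else permutation_map n \<sigma> A)
      \<in> hom M (fob ?X A) (fob ?X (permute_tuple n \<sigma> A))"
    using permutation_map_hom[OF \<sigma> A] X X0(1)[OF _ A] X0(1)[OF _ permute_tuple_obj[OF \<sigma> A]] iz(1)
    by auto
  fix \<tau> assume \<tau>: "\<tau> permutes {1..n}"
  show "(if n = 0 then Idn M (fob F (zob K)) else permutation_map n (\<sigma> \<circ> \<tau>) A) =
      (if n = 0 then Idn M (fob F (zob K)) else permutation_map n \<tau> (permute_tuple n \<sigma> A)) \<cdot>
      (if n = 0 then Idn M (fob F (zob K)) else permutation_map n \<sigma> A)"
    using permutation_map_cmp[OF \<sigma> \<tau> A] iz(2) by simp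
next
  fix n A assume A: "A \<in> Obj (pow_cat C n)"
  show "(if n = 0 then Idn M (fob F (zob K)) else permutation_map n id A) =
      Idn M (fob (spectral_derivative C K M z L F n) A)"
    using permutation_map_id[OF A] A by (auto simp: spectral_derivative_def)
qed

end


section \<open>Algebras over an operad\<close>

lemma (in normed_sym_mon_cat) tens_obj: "set Xs \<subseteq> Obj M \<Longrightarrow> tens M Xs \<in> Obj M"
  by (induction Xs) (auto simp: tunit_obj tob_obj)

lemma (in normed_sym_mon_cat) tens_arr_id:
  "set Xs \<subseteq> Obj M \<Longrightarrow> tens_arr M (map (Idn M) Xs) = Idn M (tens M Xs)"
  by (induction Xs) (auto simp: tar_id tens_obj)

lemma (in normed_sym_mon_cat) tens_arr_hom:
  "(\<And>c. c \<in> set cs \<Longrightarrow> f c \<in> hom M (X c) (Y c)) \<Longrightarrow>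
    tens_arr M (map f cs) \<in> hom M (tens M (map X cs)) (tens M (map Y cs))"
  by (induction cs) (auto intro: id_hom tunit_obj tar_hom)

lemma (in normed_sym_mon_cat) tens_arr_cmp:
  assumes "\<And>c. c \<in> set cs \<Longrightarrow> f c \<in> hom M (X c) (Y c)" "\<And>c. c \<in> set cs \<Longrightarrow> g c \<in> hom M (Y c) (Z c)"
  shows "tens_arr M (map (\<lambda>c. g c \<cdot> f c) cs) = tens_arr M (map g cs) \<cdot> tens_arr M (map f cs)"
  using assms
proof (induction cs)
  case Nil
  thus ?case by (simp add: id_left[OF id_hom[OF tunit_obj]])
next
  case (Cons c cs)
  have "(g c \<cdot> f c) \<odot> (tens_arr M (map g cs) \<cdot> tens_arr M (map f cs)) =
      (g c \<odot> tens_arr M (map g cs)) \<cdot> (f c \<odot> tens_arr M (map f cs))"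
    by (rule tar_cmp[OF _ _ tens_arr_hom tens_arr_hom]) (use Cons.prems in auto)
  thus ?case using Cons by simp
qed

text \<open>The substantial point is that composites of algebra homomorphisms are homomorphisms: the
  two structure squares are pasted, and the interchange law for the tensor, iterated in
  \<open>tens_arr_cmp\<close>, merges the two tensor powers of maps into one.\<close>

lemma alg_cat_category:
  assumes M: "normed_sym_mon_cat M" and P: "colored_operad M P"
  shows "category (alg_cat M P)"
proof -
  interpret normed_sym_mon_cat M by fact
  have pob: "pob P cs d \<in> Obj M" for cs d
    using right_module.rob_obj[OF colored_operad.regular[OF P], of d cs]
    by (simp add: regular_module_def)
  have act: "aact A cs d \<in> hom M (pob P cs d \<otimes>\<^bsub>M\<^esub> tens M (map (aob A) cs)) (aob A d)"
    if "is_algebra M P A" for A cs d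
    using that by (auto simp: is_algebra_def balanced_def regular_module_def)
  have ob: "aob A c \<in> Obj M" if "is_algebra M P A" for A c
    using that by (auto simp: is_algebra_def)
  have hom: "f \<in> hom (alg_cat M P) A B \<longleftrightarrow> is_alghom M P f \<and> asrc f = A \<and> atgt f = B" for f A B
    by (auto simp: hom_def alg_cat_def)
  have fh: "acmp f c \<in> hom M (aob (asrc f) c) (aob (atgt f) c)" if "is_alghom M P f" for f c
    using that by (simp add: is_alghom_def)
  have feq: "acmp f d \<cdot>\<^bsub>M\<^esub> aact (asrc f) cs d =
      aact (atgt f) cs d \<cdot>\<^bsub>M\<^esub> (Idn M (pob P cs d) \<odot>\<^bsub>M\<^esub> tens_arr M (map (acmp f) cs))"
    if "is_alghom M P f" for f cs d
    using that by (simp add: is_alghom_def)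
  show ?thesis
  proof
    fix f assume "f \<in> Arr (alg_cat M P)"
    thus "Dom (alg_cat M P) f \<in> Obj (alg_cat M P) \<and> Cod (alg_cat M P) f \<in> Obj (alg_cat M P)"
      by (auto simp: alg_cat_def is_alghom_def)
  next
    fix A assume "A \<in> Obj (alg_cat M P)"
    hence A: "is_algebra M P A" by (simp add: alg_cat_def)
    have "tens_arr M (map (\<lambda>c. Idn M (aob A c)) cs) = Idn M (tens M (map (aob A) cs))" for cs
      using tens_arr_id[of "map (aob A) cs"] ob[OF A] by (auto simp: comp_def)
    moreover have "tens M (map (aob A) cs) \<in> Obj M" for cs
      using tens_obj[of "map (aob A) cs"] ob[OF A] by auto
    ultimately show "Idn (alg_cat M P) A \<in> hom (alg_cat M P) A A"
      unfolding hom
      by (auto simp: alg_cat_def is_alghom_def A id_hom[OF ob[OF A]] tar_id pob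
          id_left[OF act[OF A]] id_right[OF act[OF A]])
  next
    fix A B D f g assume f: "f \<in> hom (alg_cat M P) A B" and g: "g \<in> hom (alg_cat M P) B D"
    hence f': "is_alghom M P f" "asrc f = A" "atgt f = B"
      and g': "is_alghom M P g" "asrc g = B" "atgt g = D" by (auto simp: hom)
    have alg: "is_algebra M P A" "is_algebra M P B" "is_algebra M P D"
      using f' g' by (auto simp: is_alghom_def)
    note fc = fh[OF f'(1), unfolded f'(2,3)] and gc = fh[OF g'(1), unfolded g'(2,3)]
    have "acmp g d \<cdot>\<^bsub>M\<^esub> acmp f d \<cdot>\<^bsub>M\<^esub> aact A cs d =
        aact D cs d \<cdot>\<^bsub>M\<^esub>
          (Idn M (pob P cs d) \<odot>\<^bsub>M\<^esub> tens_arr M (map (\<lambda>c. acmp g c \<cdot>\<^bsub>M\<^esub> acmp f c) cs))" for cs d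
    proof -
      let ?I = "Idn M (pob P cs d)"
      let ?f = "tens_arr M (map (acmp f) cs)" and ?g = "tens_arr M (map (acmp g) cs)"
      have tf: "?f \<in> hom M (tens M (map (aob A) cs)) (tens M (map (aob B) cs))"
        by (rule tens_arr_hom[OF fc])
      have tg: "?g \<in> hom M (tens M (map (aob B) cs)) (tens M (map (aob D) cs))"
        by (rule tens_arr_hom[OF gc])
      note If = tar_hom[OF id_hom[OF pob] tf] and Ig = tar_hom[OF id_hom[OF pob] tg]
      have "acmp g d \<cdot>\<^bsub>M\<^esub> acmp f d \<cdot>\<^bsub>M\<^esub> aact A cs d = acmp g d \<cdot>\<^bsub>M\<^esub> (acmp f d \<cdot>\<^bsub>M\<^esub> aact A cs d)"
        by (rule cmp_assoc[OF act[OF alg(1)] fc gc])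
      also have "\<dots> = acmp g d \<cdot>\<^bsub>M\<^esub> (aact B cs d \<cdot>\<^bsub>M\<^esub> (?I \<odot>\<^bsub>M\<^esub> ?f))"
        using feq[OF f'(1)] by (simp add: f')
      also have "\<dots> = acmp g d \<cdot>\<^bsub>M\<^esub> aact B cs d \<cdot>\<^bsub>M\<^esub> (?I \<odot>\<^bsub>M\<^esub> ?f)"
        by (rule cmp_assoc[symmetric, OF If act[OF alg(2)] gc])
      also have "acmp g d \<cdot>\<^bsub>M\<^esub> aact B cs d = aact D cs d \<cdot>\<^bsub>M\<^esub> (?I \<odot>\<^bsub>M\<^esub> ?g)"
        using feq[OF g'(1)] by (simp add: g')
      also have "\<dots> \<cdot>\<^bsub>M\<^esub> (?I \<odot>\<^bsub>M\<^esub> ?f) = aact D cs d \<cdot>\<^bsub>M\<^esub> ((?I \<odot>\<^bsub>M\<^esub> ?g) \<cdot>\<^bsub>M\<^esub> (?I \<odot>\<^bsub>M\<^esub> ?f))"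
        by (rule cmp_assoc[OF If Ig act[OF alg(3)]])
      also have "(?I \<odot>\<^bsub>M\<^esub> ?g) \<cdot>\<^bsub>M\<^esub> (?I \<odot>\<^bsub>M\<^esub> ?f) = (?I \<cdot>\<^bsub>M\<^esub> ?I) \<odot>\<^bsub>M\<^esub> (?g \<cdot>\<^bsub>M\<^esub> ?f)"
        by (rule tar_cmp[symmetric, OF id_hom[OF pob] id_hom[OF pob] tf tg])
      also have "?I \<cdot>\<^bsub>M\<^esub> ?I = ?I" by (rule id_left[OF id_hom[OF pob]])
      also have "?g \<cdot>\<^bsub>M\<^esub> ?f = tens_arr M (map (\<lambda>c. acmp g c \<cdot>\<^bsub>M\<^esub> acmp f c) cs)"
        by (rule tens_arr_cmp[symmetric, OF fc gc])
      finally show ?thesis .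
    qed
    thus "Cmp (alg_cat M P) g f \<in> hom (alg_cat M P) A D"
      unfolding hom using cmp_hom[OF fc gc] f' g' alg by (auto simp: alg_cat_def is_alghom_def)
  next
    fix A B f assume f: "f \<in> hom (alg_cat M P) A B"
    hence f': "is_alghom M P f" "asrc f = A" "atgt f = B" by (auto simp: hom)
    note fc = fh[OF f'(1), unfolded f'(2,3)]
    show "Cmp (alg_cat M P) (Idn (alg_cat M P) B) f = f" "Cmp (alg_cat M P) f (Idn (alg_cat M P) A) = f"
      using f'(2,3) by (auto simp: alg_cat_def id_left[OF fc] id_right[OF fc])
  next
    fix A B D E f g h
    assume f: "f \<in> hom (alg_cat M P) A B" and g: "g \<in> hom (alg_cat M P) B D"
      and h: "h \<in> hom (alg_cat M P) D E"
    hence hs: "is_alghom M P f" "asrc f = A" "atgt f = B" "is_alghom M P g" "asrc g = B" "atgt g = D"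
      "is_alghom M P h" "asrc h = D" "atgt h = E" by (auto simp: hom)
    show "Cmp (alg_cat M P) (Cmp (alg_cat M P) h g) f = Cmp (alg_cat M P) h (Cmp (alg_cat M P) g f)"
      using cmp_assoc[OF fh[OF hs(1), unfolded hs] fh[OF hs(4), unfolded hs] fh[OF hs(7), unfolded hs]]
      by (simp add: alg_cat_def)
  qed
qed

theorem theorem8:
  fixes M :: "('o, 'm) nmcat" and P :: "('c, 'o, 'm) opd"
    and K :: "(('c, 'o, 'm) alg, ('c, 'o, 'm) alghom) coprods"
    and W :: "'m set" and L :: "('o, 'm) holims" and z :: 'o
    and Hoch :: "('c, 'o, 'm) alg \<Rightarrow> ('c, 'o, 'm) rmod" and Ores :: "('c, 'o, 'm) alg"
    and sig :: "('c, 'o, 'm) alg \<Rightarrow> 'o" and realize :: "'o \<Rightarrow> complex set"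
    and F :: "(('c, 'o, 'm) alg, ('c, 'o, 'm) alghom, 'o, 'm) functr"
  assumes "normed_sym_mon_cat M"
    and "colored_operad M P"
    and "pointed_with_coproducts (alg_cat M P) K"
    and "zero_object M z"
    and "homotopy_limits M W L"
    and "spectral_data M P Hoch Ores sig realize"
    and "admissible M P sig realize F"
    and "\<And>n. n \<ge> 1 \<Longrightarrow>
      separately_linear (alg_cat M P) M W n (cross_effect (alg_cat M P) K M z L F n)"
  shows "symmetric_sequence (alg_cat M P) M W
    (spectral_derivative (alg_cat M P) K M z L F)
    (permutation_action (alg_cat M P) K M z L F)"
proof -
  interpret cross_effects M W L z "alg_cat M P" K F
  proof (intro cross_effects.intro hofibers.intro hofibers_axioms.intro pointed_category.intro
      pointed_category_axioms.intro cross_effects_axioms.intro alg_cat_category)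
    \<comment> \<open>The zero arrow is the zero vector of a Hom-space, hence an arrow of that
      type.\<close>
    show "hzero M X Y \<in> hom M X Y" if "X \<in> Obj M" "Y \<in> Obj M" for X Y
      using complex_banach_space.zero_closed[OF normed_sym_mon_cat.hom_banach[OF assms(1) that]] .
    show "F \<in> functors (alg_cat M P) M" using assms(7) by (simp add: admissible_def)
  qed (use assms in auto)
  show ?thesis by (rule spectral_derivative_symmetric_sequence) (rule assms(8))
qed

end
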